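(* Let $H$ be a non-trivial finite simple graph on $n$ vertices, let $U$ be a vertex cover of $H$, let $x$ be a new vertex, and let $G=x*_U H$. If the $j$-strand of $I(H)$ is connected, then the $j$-strand of $I(G)$ is connected. In particular, if $I(H)$ is strand connected, then $I(G)$ is strand connected.
   Context: Non-trivial means having at least one edge. A vertex cover of $H$ is a subset $U\subseteq V(H)$ meeting every edge of $H$. The cone $x*_U H$ is the graph with vertex set $V(H)\cup\{x\}$ and edge set $E(H)\cup\{\{x,u\}:u\in U\}$. For a graph $G$ and a field $\mathbb{K}$, $I(G)=(uv:\{u,v\}\in E(G))$ is its edge ideal in the standard graded polynomial ring $R$ over $\mathbb{K}$ whose variables are the vertices of $G$. For a homogeneous ideal $I\subset R$, the $j$-strand of $I$ is the set $\{i:\beta_{i,i+j}^R(R/I)\neq 0\}$. A non-empty $j$-strand is connected if it equals the integer interval $[q_j(I),p_j(I)]$, where $q_j(I)$ and $p_j(I)$ are its minimum and maximum. $I$ is strand connected if every non-empty strand is connected. *)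

theory Defs
  imports "HOL-Library.Poly_Mapping" "HOL-Algebra.Ideal"
begin

section \<open>Finite simple graphs, vertex covers and cones\<close>

type_synonym 'a graph = "'a set \<times> 'a set set"

abbreviation verts :: "'a graph \<Rightarrow> 'a set" where "verts \<equiv> fst"
abbreviation edges :: "'a graph \<Rightarrow> 'a set set" where "edges \<equiv> snd"

definition finite_simple_graph :: "'a graph \<Rightarrow> bool" where
  "finite_simple_graph G \<longleftrightarrow>
     finite (verts G) \<and> (\<forall>e \<in> edges G. e \<subseteq> verts G \<and> card e = 2)"

definition nontrivial :: "'a graph \<Rightarrow> bool" where
  "nontrivial G \<longleftrightarrow> edges G \<noteq> {}"

definition vertex_cover :: "'a graph \<Rightarrow> 'a set \<Rightarrow> bool" where
  "vertex_cover G U \<longleftrightarrow> U \<subseteq> verts G \<and> (\<forall>e \<in> edges G. e \<inter> U \<noteq> {})"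

definition cone :: "'a \<Rightarrow> 'a set \<Rightarrow> 'a graph \<Rightarrow> 'a graph" where
  "cone x U H = (insert x (verts H), edges H \<union> {{x, u} |u. u \<in> U})"

section \<open>Polynomial rings and edge ideals\<close>

text \<open>A monomial is its finitely supported exponent function, so that adding exponent
  functions multiplies monomials; \<open>('a, 'k) mpoly\<close> has all elements of
  \<^typ>\<open>'a\<close> as variables.\<close>

type_synonym ('a, 'k) mpoly = "('a \<Rightarrow>\<^sub>0 nat) \<Rightarrow>\<^sub>0 'k"

definition mpoly_ring :: "'a set \<Rightarrow> ('a, 'k::field) mpoly ring" where
  "mpoly_ring V =
     \<lparr>carrier = {p. \<forall>m \<in> Poly_Mapping.keys p. Poly_Mapping.keys m \<subseteq> V},
      monoid.mult = (*), one = 1, ring.zero = 0, add = (+)\<rparr>"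

definition mvar :: "'a \<Rightarrow> ('a, 'k::field) mpoly" where
  "mvar v = Poly_Mapping.single (Poly_Mapping.single v 1) 1"

definition mon_degree :: "('a \<Rightarrow>\<^sub>0 nat) \<Rightarrow> nat" where
  "mon_degree m = (\<Sum>v \<in> Poly_Mapping.keys m. Poly_Mapping.lookup m v)"

definition edge_ideal :: "'a graph \<Rightarrow> ('a, 'k::field) mpoly set" where
  "edge_ideal G =
     Idl\<^bsub>mpoly_ring (verts G)\<^esub> {mvar u * mvar v |u v. {u, v} \<in> edges G}"

section \<open>Minimal graded free resolutions and graded Betti numbers\<close>

text \<open>A function \<open>n :: nat \<Rightarrow> nat\<close> encodes the graded free module
  \<open>\<Oplus>\<^sub>j R(-j)\<^bsup>n j\<^esup>\<close> over the polynomial ring \<open>R\<close> in the variables \<open>V\<close>.  Its homogeneous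
  basis consists of the pairs \<open>(j, k)\<close> with \<open>k < n j\<close>, where \<open>(j, k)\<close> has degree \<open>j\<close>.\<close>

definition free_basis :: "(nat \<Rightarrow> nat) \<Rightarrow> (nat \<times> nat) set" where
  "free_basis n = {(j, k). k < n j}"

definition free_module ::
  "'a set \<Rightarrow> (nat \<Rightarrow> nat) \<Rightarrow> (nat \<times> nat \<Rightarrow>\<^sub>0 ('a, 'k::field) mpoly) set" where
  "free_module V n =
     {f. Poly_Mapping.keys f \<subseteq> free_basis n \<and>
         (\<forall>e. Poly_Mapping.lookup f e \<in> carrier (mpoly_ring V))}"

definition scale ::
  "('a, 'k::field) mpoly \<Rightarrow> ('b \<Rightarrow>\<^sub>0 ('a, 'k) mpoly) \<Rightarrow> ('b \<Rightarrow>\<^sub>0 ('a, 'k) mpoly)" where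
  "scale p f = Poly_Mapping.map ((*) p) f"

text \<open>The linear map that sends each basis element \<open>e\<close> to \<open>\<phi> e\<close>.\<close>

definition lin_ext ::
  "('b \<Rightarrow> ('c \<Rightarrow>\<^sub>0 ('a, 'k::field) mpoly)) \<Rightarrow> ('b \<Rightarrow>\<^sub>0 ('a, 'k) mpoly)
    \<Rightarrow> ('c \<Rightarrow>\<^sub>0 ('a, 'k) mpoly)" where
  "lin_ext \<phi> f = (\<Sum>e \<in> Poly_Mapping.keys f. scale (Poly_Mapping.lookup f e) (\<phi> e))"

text \<open>For a proper homogeneous ideal \<open>I\<close> of \<open>R\<close>, the following says that
  \<open>\<dots> \<rightarrow> F 2 \<rightarrow> F 1 \<rightarrow> F 0 = R \<rightarrow> R/I \<rightarrow> 0\<close> is a minimal graded free resolution, where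
  \<open>F i = \<Oplus>\<^sub>j R(-j)\<^bsup>b i j\<^esup>\<close> and \<open>d i\<close> gives the values of the differential \<open>F i \<rightarrow> F (i - 1)\<close>
  on the basis, for \<open>i \<ge> 1\<close>.  The differentials preserve degrees, so the \<open>c\<close>-entry of
  \<open>d i e\<close> is homogeneous of degree \<open>deg e - deg c\<close>; minimality says that the image of the
  differential lies in \<open>\<mm> F (i - 1)\<close>, where \<open>\<mm>\<close> is the ideal generated by the
  variables, so no entry has a constant term.\<close>

definition minimal_graded_free_resolution ::
  "'a set \<Rightarrow> ('a, 'k::field) mpoly set \<Rightarrow> (nat \<Rightarrow> nat \<Rightarrow> nat)
    \<Rightarrow> (nat \<Rightarrow> nat \<times> nat \<Rightarrow> (nat \<times> nat \<Rightarrow>\<^sub>0 ('a, 'k) mpoly)) \<Rightarrow> bool" where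
  "minimal_graded_free_resolution V I b d \<longleftrightarrow>
     b 0 = (\<lambda>j. if j = 0 then 1 else 0) \<and>
     (\<forall>i \<ge> 1. \<forall>e \<in> free_basis (b i).
        d i e \<in> free_module V (b (i - 1)) \<and>
        (\<forall>c. \<forall>m \<in> Poly_Mapping.keys (Poly_Mapping.lookup (d i e) c).
           mon_degree m + fst c = fst e) \<and>
        (\<forall>c. Poly_Mapping.lookup (Poly_Mapping.lookup (d i e) c) 0 = 0)) \<and>
     lin_ext (d 1) ` free_module V (b 1) =
       {f \<in> free_module V (b 0). Poly_Mapping.lookup f (0, 0) \<in> I} \<and>
     (\<forall>i \<ge> 1. lin_ext (d (i + 1)) ` free_module V (b (i + 1)) =
       {f \<in> free_module V (b i). lin_ext (d i) f = 0})"

text \<open>\<open>graded_betti V I i j\<close> is \<open>\<beta>\<^sub>i\<^sub>,\<^sub>j(R/I)\<close>; minimal graded free resolutions exist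
  and are unique up to isomorphism if \<open>V\<close> is finite and \<open>I\<close> is proper and homogeneous.\<close>

definition graded_betti ::
  "'a set \<Rightarrow> ('a, 'k::field) mpoly set \<Rightarrow> nat \<Rightarrow> nat \<Rightarrow> nat" where
  "graded_betti V I = (THE b. \<exists>d. minimal_graded_free_resolution V I b d)"

section \<open>Strands\<close>

definition strand :: "'a set \<Rightarrow> ('a, 'k::field) mpoly set \<Rightarrow> nat \<Rightarrow> nat set" where
  "strand V I j = {i. graded_betti V I i (i + j) \<noteq> 0}"

definition connected_strand :: "'a set \<Rightarrow> ('a, 'k::field) mpoly set \<Rightarrow> nat \<Rightarrow> bool" where
  "connected_strand V I j \<longleftrightarrow>
     strand V I j \<noteq> {} \<and> strand V I j = {Min (strand V I j)..Max (strand V I j)}"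

definition strand_connected :: "'a set \<Rightarrow> ('a, 'k::field) mpoly set \<Rightarrow> bool" where
  "strand_connected V I \<longleftrightarrow> (\<forall>j. strand V I j \<noteq> {} \<longrightarrow> connected_strand V I j)"

end

theory Submission
  imports Defs "HOL.Vector_Spaces"
begin

text \<open>Let \<open>F\<close> be the minimal resolution of \<open>R/I(H)\<close> and \<open>K\<close> the Koszul resolution of \<open>R/(U)\<close>.
  Since \<open>U\<close> is a vertex cover, \<open>I(H) \<subseteq> (U)\<close>, and \<open>1 \<mapsto> (1, x)\<close> gives an exact sequence
  \<open>0 \<rightarrow> R/I(H)(-1) \<rightarrow> R/(U)(-1) \<oplus> R/I(H) \<rightarrow> R/I(G) \<rightarrow> 0\<close>.  Its mapping cone, with
  \<open>\<phi> : F \<rightarrow> K\<close> lifting \<open>R/I(H) \<rightarrow> R/(U)\<close>, becomes a minimal resolution of \<open>R/I(G)\<close>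
  once the unit \<open>\<phi>\<^sub>0\<close> is cancelled, because \<open>F\<^sub>i\<close> lives in degrees above \<open>i\<close> and \<open>K\<^sub>i\<close> in degree
  \<open>i\<close>.  So for \<open>j \<ge> 1\<close> the \<open>j\<close>-strand of \<open>I(G)\<close> is \<open>S \<union> (S + 1)\<close>, where \<open>S\<close> is that of
  \<open>I(H)\<close>, enlarged by \<open>[1, |U|]\<close> if \<open>j = 1\<close>; in that case \<open>1 \<in> S\<close>.

  Betti numbers are computed over the ring in all variables of type \<open>'a\<close>, which is flat over
  every \<open>mpoly_ring V\<close>; only the existence of minimal resolutions needs \<open>V\<close> finite.\<close>

section \<open>Free modules over the polynomial ring\<close>

text \<open>On a strand the twist and the homological shift cancel: F_i(-1) sits in position i + 1
  of the mapping cone with degrees raised by one, so it repeats the strand of F_i one step to the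
  right, while K_i(-1), in position i and degree i + 1, meets only the 1-strand. Hence an interval
  grows by one step, and for j = 1 it merges with [1, |U|] because both start at 1. The obstacle is
  that \<open>graded_betti\<close> is a definite description over resolutions with bases of number
  pairs and coefficients in the variables \<open>V\<close>. The Koszul complex and the cone have
  vertex sets and disjoint sums as bases, and \<open>H\<close> and \<open>G\<close> live over
  different rings. So resolutions are allowed bases of any type and coefficients in all variables,
  and their graded ranks are shown to depend only on the ideal. A description also needs something
  to describe, so minimal resolutions of monomial ideals have to be constructed.\<close>

abbreviation "lkp \<equiv> Poly_Mapping.lookup"
abbreviation "keys \<equiv> Poly_Mapping.keys"
abbreviation "single \<equiv> Poly_Mapping.single"

lemma poly_mapping_sum_single: "p = (\<Sum>m\<in>keys p. single m (lkp p m))"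
proof (rule poly_mapping_eqI)
  fix k
  have "lkp (\<Sum>m\<in>keys p. single m (lkp p m)) k = (\<Sum>m\<in>keys p. if m = k then lkp p k else 0)"
    unfolding lookup_sum by (rule sum.cong) (auto simp: lookup_single when_def)
  then show "lkp p k = lkp (\<Sum>m\<in>keys p. single m (lkp p m)) k"
    by (simp add: in_keys_iff)
qed

lemma lookup_single_mult:
  fixes p :: "('a \<Rightarrow>\<^sub>0 nat) \<Rightarrow>\<^sub>0 'k::field"
  shows "lkp (single m k * p) (m + m') = k * lkp p m'"
proof -
  have "single m k * p = (\<Sum>n\<in>keys p. single (m + n) (k * lkp p n))"
    by (subst poly_mapping_sum_single[of p]) (simp add: sum_distrib_left mult_single)
  then have "lkp (single m k * p) (m + m') = (\<Sum>n\<in>keys p. if n = m' then k * lkp p m' else 0)"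
    by (auto simp: lookup_sum lookup_single when_def intro!: sum.cong)
  then show ?thesis by (simp add: in_keys_iff)
qed

lemma keys_times: "m \<in> keys (p * q) \<Longrightarrow> \<exists>a\<in>keys p. \<exists>b\<in>keys q. m = a + b"
  by (drule subsetD[OF keys_mult]) blast

lemma keys_monom_mult:
  fixes p :: "('a \<Rightarrow>\<^sub>0 nat) \<Rightarrow>\<^sub>0 'k::field"
  shows "keys (single m 1 * p) = (+) m ` keys p"
proof (intro equalityI subsetI)
  fix n assume "n \<in> keys (single m 1 * p)"
  then show "n \<in> (+) m ` keys p" by (auto dest!: keys_times)
next
  fix n assume "n \<in> (+) m ` keys p"
  then obtain m' where "n = m + m'" "m' \<in> keys p" by auto
  then show "n \<in> keys (single m 1 * p)" by (simp add: in_keys_iff lookup_single_mult)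
qed

lemma mon_degree_eq_sum: "finite S \<Longrightarrow> keys m \<subseteq> S \<Longrightarrow> mon_degree m = (\<Sum>v\<in>S. lkp m v)"
  unfolding mon_degree_def by (rule sum.mono_neutral_left) (auto simp: in_keys_iff)

lemma mon_degree_add: "mon_degree (m + m') = mon_degree m + mon_degree m'"
proof -
  let ?S = "keys m \<union> keys m'"
  have "keys (m + m') \<subseteq> ?S" by (rule Poly_Mapping.keys_add)
  then show ?thesis
    by (simp add: mon_degree_eq_sum[of ?S] lookup_add sum.distrib)
qed

lemma mon_degree_0 [simp]: "mon_degree 0 = 0"
  by (simp add: mon_degree_def)

lemma mon_degree_single [simp]: "mon_degree (single v n) = n"
  by (simp add: mon_degree_def)

lemma mon_degree_eq_0_iff: "mon_degree m = 0 \<longleftrightarrow> m = 0"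
proof
  assume "mon_degree m = 0"
  then have "\<forall>v\<in>keys m. lkp m v = 0" by (simp add: mon_degree_def)
  then show "m = 0"
    by (intro poly_mapping_eqI) (metis lookup_zero not_in_keys_iff_lookup_eq_zero)
qed simp

lemma lookup_mapp: "f k 0 = 0 \<Longrightarrow> lkp (Poly_Mapping.mapp f p) k = f k (lkp p k)"
  by (simp add: Poly_Mapping.lookup_mapp when_def in_keys_iff)

lemma lookup_scale [simp]: "lkp (scale p f) c = p * lkp f c"
  by (simp add: scale_def Poly_Mapping.map.rep_eq when_def)

interpretation mod: module "scale :: ('a, 'k::field) mpoly \<Rightarrow> ('b \<Rightarrow>\<^sub>0 ('a, 'k) mpoly) \<Rightarrow> _"
  by unfold_locales (auto intro!: poly_mapping_eqI simp: lookup_add algebra_simps)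

lemma keys_scale: "keys (scale p f) \<subseteq> keys f"
  by (auto simp: in_keys_iff)

lemma scale_single: "scale p (single c q) = single c (p * q)"
  by (rule poly_mapping_eqI) (simp add: lookup_single when_def)

lemma lin_ext_eq_sum:
  assumes "finite S" "keys f \<subseteq> S"
  shows "lin_ext \<phi> f = (\<Sum>e\<in>S. scale (lkp f e) (\<phi> e))"
  unfolding lin_ext_def using assms
  by (intro sum.mono_neutral_left) (auto simp: in_keys_iff)

lemma lin_ext_0 [simp]: "lin_ext \<phi> 0 = 0"
  by (simp add: lin_ext_def)

lemma lin_ext_add: "lin_ext \<phi> (f + g) = lin_ext \<phi> f + lin_ext \<phi> g"
proof -
  let ?S = "keys f \<union> keys g"
  have "keys (f + g) \<subseteq> ?S" by (rule Poly_Mapping.keys_add)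
  then show ?thesis
    by (simp add: lin_ext_eq_sum[of ?S] lookup_add sum.distrib mod.scale_left_distrib)
qed

lemma lin_ext_scale: "lin_ext \<phi> (scale p f) = scale p (lin_ext \<phi> f)"
  using keys_scale[of p f]
  by (simp add: lin_ext_eq_sum[of "keys f"] mod.scale_sum_right)

lemma lin_ext_uminus: "lin_ext \<phi> (- f) = - lin_ext \<phi> f"
  using lin_ext_scale[of \<phi> "-1" f] by simp

lemma lin_ext_diff: "lin_ext \<phi> (f - g) = lin_ext \<phi> f - lin_ext \<phi> g"
  using lin_ext_add[of \<phi> f "- g"] by (simp add: lin_ext_uminus)

lemma lin_ext_sum: "lin_ext \<phi> (sum g A) = (\<Sum>a\<in>A. lin_ext \<phi> (g a))"
  by (induction A rule: infinite_finite_induct) (auto simp: lin_ext_add)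

lemma lin_ext_single [simp]: "lin_ext \<phi> (single c p) = scale p (\<phi> c)"
  by (simp add: lin_ext_eq_sum[of "{c}"])

lemma lin_ext_cong: "(\<And>e. e \<in> keys f \<Longrightarrow> \<phi> e = \<psi> e) \<Longrightarrow> lin_ext \<phi> f = lin_ext \<psi> f"
  by (simp add: lin_ext_def)

lemma lin_ext_lin_ext: "lin_ext \<psi> (lin_ext \<phi> f) = lin_ext (\<lambda>e. lin_ext \<psi> (\<phi> e)) f"
  by (simp add: lin_ext_def[of \<phi>] lin_ext_def[of "\<lambda>e. lin_ext \<psi> (\<phi> e)"] lin_ext_sum lin_ext_scale)

lemma lin_ext_plus_fun: "lin_ext (\<lambda>e. \<phi> e + \<psi> e) f = lin_ext \<phi> f + lin_ext \<psi> f"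
  by (simp add: lin_ext_def mod.scale_right_distrib sum.distrib)

lemma lin_ext_uminus_fun: "lin_ext (\<lambda>e. - \<phi> e) f = - lin_ext \<phi> f"
  by (simp add: lin_ext_def sum_negf)

lemma lin_ext_diff_fun: "lin_ext (\<lambda>e. \<phi> e - \<psi> e) f = lin_ext \<phi> f - lin_ext \<psi> f"
  by (simp add: lin_ext_def mod.scale_right_diff_distrib sum_subtractf)

lemma lin_ext_scale_fun: "lin_ext (\<lambda>e. scale p (\<phi> e)) f = scale p (lin_ext \<phi> f)"
  by (simp add: lin_ext_def mod.scale_sum_right mult.commute)

lemma lin_ext_unit: "lin_ext (\<lambda>e. single e 1) f = f"
  unfolding lin_ext_def scale_single mult_1_right by (rule poly_mapping_sum_single[symmetric])

lemma lookup_lin_ext: "lkp (lin_ext \<phi> f) c = (\<Sum>e\<in>keys f. lkp f e * lkp (\<phi> e) c)"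
  by (simp add: lin_ext_def lookup_sum)

lemma keys_lin_ext: "(\<And>e. e \<in> keys f \<Longrightarrow> keys (\<phi> e) \<subseteq> B) \<Longrightarrow> keys (lin_ext \<phi> f) \<subseteq> B"
  unfolding lin_ext_def by (intro order_trans[OF keys_sum] UN_least order_trans[OF keys_scale])

lemma lin_ext_in_closed:
  assumes "0 \<in> Z" "\<And>f g. f \<in> Z \<Longrightarrow> g \<in> Z \<Longrightarrow> f + g \<in> Z"
    and "\<And>e. e \<in> keys f \<Longrightarrow> scale (lkp f e) (\<phi> e) \<in> Z"
  shows "lin_ext \<phi> f \<in> Z"
proof -
  have "(\<Sum>e\<in>A. scale (lkp f e) (\<phi> e)) \<in> Z" if "A \<subseteq> keys f" for A
  proof -
    have "finite A" using that finite_keys finite_subset by blast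
    then show ?thesis using that by (induction A) (auto intro!: assms)
  qed
  then show ?thesis unfolding lin_ext_def by blast
qed

text \<open>Coefficients range over all variables and the basis over any type, so that number pairs,
  vertex sets and disjoint sums can all serve as bases.\<close>

definition free :: "'b set \<Rightarrow> ('b \<Rightarrow>\<^sub>0 ('a, 'k::field) mpoly) set" where
  "free B = {f. keys f \<subseteq> B}"

lemma free_0 [simp]: "0 \<in> free B"
  by (simp add: free_def)

lemma free_add: "f \<in> free B \<Longrightarrow> g \<in> free B \<Longrightarrow> f + g \<in> free B"
  using Poly_Mapping.keys_add[of f g] by (auto simp: free_def)

lemma free_scale: "f \<in> free B \<Longrightarrow> scale p f \<in> free B"
  using keys_scale[of p f] by (auto simp: free_def)

lemma free_uminus: "f \<in> free B \<Longrightarrow> - f \<in> free B"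
  using free_scale[of f B "-1"] by simp

lemma free_diff: "f \<in> free B \<Longrightarrow> g \<in> free B \<Longrightarrow> f - g \<in> free B"
  using free_add[of f B "- g"] by (simp add: free_uminus)

lemma free_single: "c \<in> B \<Longrightarrow> single c p \<in> free B"
  by (simp add: free_def)

lemma free_lin_ext: "f \<in> free A \<Longrightarrow> (\<And>e. e \<in> A \<Longrightarrow> \<phi> e \<in> free B) \<Longrightarrow> lin_ext \<phi> f \<in> free B"
  unfolding free_def by (simp, rule keys_lin_ext) auto

lemma lin_ext_cong_free:
  "f \<in> free B \<Longrightarrow> (\<And>e. e \<in> B \<Longrightarrow> \<phi> e = \<psi> e) \<Longrightarrow> lin_ext \<phi> f = lin_ext \<psi> f"
  by (rule lin_ext_cong) (auto simp: free_def)

lemma free_singleton: "f \<in> free {c} \<Longrightarrow> f = single c (lkp f c)"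
  by (rule poly_mapping_eqI) (auto simp: free_def lookup_single when_def in_keys_iff)

subsection \<open>Homogeneous components\<close>

definition pfilt :: "('m \<Rightarrow> bool) \<Rightarrow> ('m \<Rightarrow>\<^sub>0 'k::zero) \<Rightarrow> ('m \<Rightarrow>\<^sub>0 'k)" where
  "pfilt Q p = Poly_Mapping.mapp (\<lambda>m k. k when Q m) p"

lemma lookup_pfilt: "lkp (pfilt Q p) m = (lkp p m when Q m)"
  by (simp add: pfilt_def lookup_mapp)

lemma keys_pfilt: "keys (pfilt Q p) = {m \<in> keys p. Q m}"
  by (auto simp: in_keys_iff lookup_pfilt)

lemma pfilt_0 [simp]: "pfilt Q 0 = 0"
  by (rule poly_mapping_eqI) (simp add: lookup_pfilt)

lemma pfilt_add: "pfilt Q (p + q) = pfilt Q p + pfilt Q q"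
  by (rule poly_mapping_eqI) (simp add: lookup_pfilt lookup_add when_def)

lemma pfilt_sum: "pfilt Q (sum g A) = (\<Sum>a\<in>A. pfilt Q (g a))"
  by (induction A rule: infinite_finite_induct) (auto simp: pfilt_add)

lemma pfilt_split: "p = pfilt Q p + pfilt (\<lambda>m. \<not> Q m) p"
  by (rule poly_mapping_eqI) (simp add: lookup_pfilt lookup_add when_def)

lemma pfilt_all: "(\<And>m. m \<in> keys p \<Longrightarrow> Q m) \<Longrightarrow> pfilt Q p = p"
proof (rule poly_mapping_eqI)
  fix m assume *: "\<And>m. m \<in> keys p \<Longrightarrow> Q m"
  show "lkp (pfilt Q p) m = lkp p m"
    using *[of m] by (cases "m \<in> keys p") (simp_all add: lookup_pfilt not_in_keys_iff_lookup_eq_zero)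
qed

lemma pfilt_none: "(\<And>m. m \<in> keys p \<Longrightarrow> \<not> Q m) \<Longrightarrow> pfilt Q p = 0"
proof (rule poly_mapping_eqI)
  fix m assume *: "\<And>m. m \<in> keys p \<Longrightarrow> \<not> Q m"
  show "lkp (pfilt Q p) m = lkp 0 m"
    using *[of m] by (cases "m \<in> keys p") (simp_all add: lookup_pfilt not_in_keys_iff_lookup_eq_zero)
qed

text \<open>Components with respect to a grading of the monomials by \<open>w\<close> and of the basis by \<open>v\<close>.
  Besides the degree, the exponents outside a given set of variables are such a grading.\<close>

definition wcomp ::
  "(('a \<Rightarrow>\<^sub>0 nat) \<Rightarrow> 'g::cancel_comm_monoid_add) \<Rightarrow> ('b \<Rightarrow> 'g) \<Rightarrow> 'g
    \<Rightarrow> ('b \<Rightarrow>\<^sub>0 ('a, 'k::field) mpoly) \<Rightarrow> ('b \<Rightarrow>\<^sub>0 ('a, 'k) mpoly)" where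
  "wcomp w v g f = Poly_Mapping.mapp (\<lambda>c. pfilt (\<lambda>m. w m + v c = g)) f"

definition whom ::
  "(('a \<Rightarrow>\<^sub>0 nat) \<Rightarrow> 'g::cancel_comm_monoid_add) \<Rightarrow> ('b \<Rightarrow> 'g) \<Rightarrow> 'g
    \<Rightarrow> ('b \<Rightarrow>\<^sub>0 ('a, 'k::field) mpoly) \<Rightarrow> bool" where
  "whom w v g f \<longleftrightarrow> (\<forall>c. \<forall>m\<in>keys (lkp f c). w m + v c = g)"

lemma lookup_wcomp: "lkp (wcomp w v g f) c = pfilt (\<lambda>m. w m + v c = g) (lkp f c)"
  by (simp add: wcomp_def lookup_mapp)

lemma whom_wcomp: "whom w v g (wcomp w v g f)"
  by (simp add: whom_def lookup_wcomp keys_pfilt)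

lemma wcomp_whom: "whom w v g f \<Longrightarrow> wcomp w v g f = f"
  by (rule poly_mapping_eqI) (auto simp: lookup_wcomp whom_def intro: pfilt_all)

lemma wcomp_free: "f \<in> free B \<Longrightarrow> wcomp w v g f \<in> free B"
  unfolding free_def by (auto simp: in_keys_iff lookup_wcomp) (metis in_keys_iff pfilt_0 subsetD)

lemma wcomp_add: "wcomp w v g (f + f') = wcomp w v g f + wcomp w v g f'"
  by (rule poly_mapping_eqI) (simp add: lookup_wcomp lookup_add pfilt_add)

lemma wcomp_0 [simp]: "wcomp w v g 0 = 0"
  by (rule poly_mapping_eqI) (simp add: lookup_wcomp)

lemma whom_0 [simp]: "whom w v g 0"
  by (simp add: whom_def)

lemma whom_add: "whom w v g f \<Longrightarrow> whom w v g f' \<Longrightarrow> whom w v g (f + f')"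
  using whom_wcomp[of w v g "f + f'"] by (simp add: wcomp_add wcomp_whom)

lemma whom_uminus: "whom w v g f \<Longrightarrow> whom w v g (- f)"
  by (simp add: whom_def in_keys_iff)

lemma whom_diff: "whom w v g f \<Longrightarrow> whom w v g f' \<Longrightarrow> whom w v g (f - f')"
  using whom_add[of w v g f "- f'"] by (simp add: whom_uminus)

text \<open>Splitting \<open>p\<close> by the weight of its terms also splits the product, because
  \<open>w m + c\<close> takes only the value \<open>e\<close> on the terms of
  \<open>q\<close>.\<close>

lemma pfilt_mult_weight:
  fixes p q :: "('a, 'k::field) mpoly"
    and w :: "('a \<Rightarrow>\<^sub>0 nat) \<Rightarrow> 'g::cancel_comm_monoid_add"
  assumes w: "\<And>m m'. w (m + m') = w m + w m'" and q: "\<And>m. m \<in> keys q \<Longrightarrow> w m + c = e"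
  shows "pfilt (\<lambda>m. w m + c = g) (p * q) = pfilt (\<lambda>m. w m + e = g) p * q"
proof -
  have *: "w (a + b) + c = w a + e" if "b \<in> keys q" for a b
    using q[OF that] by (simp add: w add.assoc)
  let ?p1 = "pfilt (\<lambda>m. w m + e = g) p" and ?p2 = "pfilt (\<lambda>m. w m + e \<noteq> g) p"
  have "p * q = ?p1 * q + ?p2 * q"
    unfolding distrib_right[symmetric] by (rule arg_cong[where f = "\<lambda>x. x * q"], rule pfilt_split)
  moreover have "pfilt (\<lambda>m. w m + c = g) (?p1 * q) = ?p1 * q"
  proof (rule pfilt_all)
    fix m assume "m \<in> keys (?p1 * q)"
    then obtain a b where "a \<in> keys ?p1" "b \<in> keys q" "m = a + b" using keys_times by blast
    then show "w m + c = g" by (simp add: * keys_pfilt)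
  qed
  moreover have "pfilt (\<lambda>m. w m + c = g) (?p2 * q) = 0"
  proof (rule pfilt_none)
    fix m assume "m \<in> keys (?p2 * q)"
    then obtain a b where "a \<in> keys ?p2" "b \<in> keys q" "m = a + b" using keys_times by blast
    then show "w m + c \<noteq> g" by (simp add: * keys_pfilt)
  qed
  ultimately show ?thesis by (simp add: pfilt_add)
qed

text \<open>The payoff is that a preimage of a homogeneous element under a weight-preserving map can
  be replaced by its own homogeneous component.\<close>

lemma wcomp_lin_ext:
  assumes w: "\<And>m m'. w (m + m') = w m + w m'"
    and \<phi>: "\<And>e. e \<in> keys f \<Longrightarrow> whom w v' (v e) (\<phi> e)"
  shows "wcomp w v' g (lin_ext \<phi> f) = lin_ext \<phi> (wcomp w v g f)"
proof (rule poly_mapping_eqI)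
  fix c
  have "keys (wcomp w v g f) \<subseteq> keys f" by (auto simp: in_keys_iff lookup_wcomp)
  then have "lin_ext \<phi> (wcomp w v g f) = (\<Sum>e\<in>keys f. scale (pfilt (\<lambda>m. w m + v e = g) (lkp f e)) (\<phi> e))"
    by (simp add: lin_ext_eq_sum[of "keys f"] lookup_wcomp)
  then have "lkp (lin_ext \<phi> (wcomp w v g f)) c
      = (\<Sum>e\<in>keys f. pfilt (\<lambda>m. w m + v e = g) (lkp f e) * lkp (\<phi> e) c)"
    by (simp add: lookup_sum)
  also have "\<dots> = (\<Sum>e\<in>keys f. pfilt (\<lambda>m. w m + v' c = g) (lkp f e * lkp (\<phi> e) c))"
    using \<phi> by (intro sum.cong refl pfilt_mult_weight[OF w, symmetric]) (auto simp: whom_def)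
  also have "\<dots> = lkp (wcomp w v' g (lin_ext \<phi> f)) c"
    by (simp add: lookup_wcomp lookup_lin_ext pfilt_sum)
  finally show "lkp (wcomp w v' g (lin_ext \<phi> f)) c = lkp (lin_ext \<phi> (wcomp w v g f)) c" ..
qed

lemma whom_lin_ext:
  assumes "\<And>m m'. w (m + m') = w m + w m'" "\<And>e. e \<in> keys f \<Longrightarrow> whom w v' (v e) (\<phi> e)"
    and "whom w v g f"
  shows "whom w v' g (lin_ext \<phi> f)"
  using whom_wcomp[of w v' g "lin_ext \<phi> f"]
  by (simp add: wcomp_lin_ext[OF assms(1,2)] wcomp_whom[OF assms(3)])

text \<open>An element is the finite sum of its components at the weights \<open>?G\<close> of its
  own terms. With degrees as weights this reduces generation to one degree at a time; with exponents
  outside \<open>V\<close> it reduces exactness to the ring in \<open>V\<close>.\<close>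

lemma wcomp_closed:
  assumes "0 \<in> Z" "\<And>f g. f \<in> Z \<Longrightarrow> g \<in> Z \<Longrightarrow> f + g \<in> Z" "\<And>g. wcomp w v g f \<in> Z"
  shows "f \<in> Z"
proof -
  let ?G = "\<Union>c\<in>keys f. (\<lambda>m. w m + v c) ` keys (lkp f c)"
  have fin: "finite ?G" by simp
  have f_eq: "f = (\<Sum>g\<in>?G. wcomp w v g f)"
  proof (intro poly_mapping_eqI)
    fix c m
    have "lkp (lkp (\<Sum>g\<in>?G. wcomp w v g f) c) m
        = (\<Sum>g\<in>?G. if g = w m + v c then lkp (lkp f c) m else 0)"
      unfolding lookup_sum by (auto simp: lookup_wcomp lookup_pfilt when_def intro!: sum.cong)
    also have "\<dots> = (if w m + v c \<in> ?G then lkp (lkp f c) m else 0)" 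
      using fin by (rule sum.delta)
    also have "\<dots> = lkp (lkp f c) m"
    proof (cases "lkp (lkp f c) m = 0")
      case False
      then have "m \<in> keys (lkp f c)" "c \<in> keys f" by (auto simp: in_keys_iff)
      then show ?thesis by auto
    qed simp
    finally show "lkp (lkp f c) m = lkp (lkp (\<Sum>g\<in>?G. wcomp w v g f) c) m" ..
  qed
  have "(\<Sum>g\<in>A. wcomp w v g f) \<in> Z" for A
    by (induction A rule: infinite_finite_induct) (auto intro: assms)
  then show ?thesis by (subst f_eq)
qed

section \<open>Linear algebra over the field, and constant terms\<close>

interpretation kvec: vector_space "\<lambda>a::'k::field. scale (single 0 a :: ('a, 'k) mpoly) :: ('b \<Rightarrow>\<^sub>0 ('a, 'k) mpoly) \<Rightarrow> _"
  by unfold_locales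
    (auto simp: mod.scale_right_distrib single_add mod.scale_left_distrib mult_single)

lemma lookup_kscale: "lkp (lkp (scale (single 0 a) f) c) m = a * lkp (lkp f c) m"
  using lookup_single_mult[of 0 a "lkp f c" m] by simp

text \<open>Degrees of monomials add and vanish only at 0, so a constant term arises only from two
  constant terms. Thus taking constant terms is the ring map that kills all variables.\<close>

lemma lookup_mult_0:
  fixes p q :: "('a, 'k::field) mpoly"
  shows "lkp (p * q) 0 = lkp p 0 * lkp q 0"
proof -
  have split: "p = pfilt (\<lambda>m. m = 0) p + pfilt (\<lambda>m. m \<noteq> 0) p" by (rule pfilt_split)
  have c: "pfilt (\<lambda>m. m = 0) p = single 0 (lkp p 0)"
    by (rule poly_mapping_eqI) (auto simp: lookup_pfilt lookup_single when_def)
  have "0 \<notin> keys (pfilt (\<lambda>m. m \<noteq> 0) p * q)"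
  proof
    assume "0 \<in> keys (pfilt (\<lambda>m. m \<noteq> 0) p * q)"
    then obtain a b where ab: "a \<in> keys (pfilt (\<lambda>m. m \<noteq> 0) p)" "0 = a + b" using keys_times by blast
    have "mon_degree a + mon_degree b = mon_degree (a + b)" by (simp add: mon_degree_add)
    then have "a = 0" using ab(2) mon_degree_eq_0_iff[of a] by simp
    then show False using ab(1) by (simp add: keys_pfilt)
  qed
  then have z: "lkp (pfilt (\<lambda>m. m \<noteq> 0) p * q) 0 = 0" by (simp add: in_keys_iff)
  have "p * q = single 0 (lkp p 0) * q + pfilt (\<lambda>m. m \<noteq> 0) p * q"
    by (metis split c distrib_right)
  then show ?thesis using lookup_single_mult[of 0 "lkp p 0" q 0] z by (simp add: lookup_add)
qed

text \<open>The coordinates of \<open>f\<close> modulo the ideal of the variables. A differential is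
  minimal if its values on the basis all have \<open>cst\<close> zero.\<close>

definition cst :: "('b \<Rightarrow>\<^sub>0 ('a, 'k::field) mpoly) \<Rightarrow> 'b \<Rightarrow> 'k" where
  "cst f c = lkp (lkp f c) 0"

lemma cst_0 [simp]: "cst 0 c = 0"
  by (simp add: cst_def)

lemma cst_add: "cst (f + g) c = cst f c + cst g c"
  by (simp add: cst_def lookup_add)

lemma cst_diff: "cst (f - g) c = cst f c - cst g c"
  by (simp add: cst_def lookup_minus)

lemma cst_single: "cst (single e 1) c = (if e = c then 1 else 0)"
  by (simp add: cst_def lookup_single when_def lookup_one)

lemma cst_lin_ext: "cst (lin_ext \<phi> f) c = (\<Sum>e\<in>keys f. cst f e * cst (\<phi> e) c)"
  by (simp add: cst_def lookup_lin_ext lookup_sum lookup_mult_0)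

lemma cst_lin_ext_eq:
  assumes "finite S" "\<And>e. cst f e \<noteq> 0 \<Longrightarrow> e \<in> S"
  shows "cst (lin_ext \<phi> f) c = (\<Sum>e\<in>S. cst f e * cst (\<phi> e) c)"
proof -
  have "(\<Sum>e\<in>keys f. cst f e * cst (\<phi> e) c) = (\<Sum>e\<in>S. cst f e * cst (\<phi> e) c)"
  proof (rule sum.mono_neutral_cong)
    fix e assume "e \<in> S - keys f"
    then have "lkp f e = 0" by (simp add: in_keys_iff)
    then show "cst f e * cst (\<phi> e) c = 0" by (simp add: cst_def)
  qed (use assms in auto)
  then show ?thesis by (simp add: cst_lin_ext)
qed

lemma cst_lin_ext_minimal:
  "(\<And>e. e \<in> keys f \<Longrightarrow> cst f e = 0 \<or> cst (\<phi> e) c = 0) \<Longrightarrow> cst (lin_ext \<phi> f) c = 0"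
  unfolding cst_lin_ext by (rule sum.neutral) auto

lemma whom_cst: "whom mon_degree v j f \<Longrightarrow> cst f e \<noteq> 0 \<Longrightarrow> v e = j"
  by (auto simp: whom_def cst_def in_keys_iff dest!: spec[of _ e] bspec[of _ _ 0])

text \<open>The rows of \<open>M\<close> are linearly independent in a space of dimension at most
  \<open>card S\<close>, because the columns of \<open>N\<close> give functionals \<open>L\<close>
  dual to them. The space is modelled by constant vectors over a polynomial ring in one dummy
  variable, so that \<open>kvec\<close> can be reused.\<close>

lemma card_le_if_left_inverse:
  fixes M :: "'b \<Rightarrow> 'c \<Rightarrow> 'k::field"
  assumes T: "finite T" and S: "finite S"
    and inv: "\<And>e e''. e \<in> T \<Longrightarrow> e'' \<in> T \<Longrightarrow>
      (\<Sum>e'\<in>S. M e e' * N e' e'') = (if e = e'' then 1 else 0)"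
  shows "card T \<le> card S"
proof -
  define x where "x e = (\<Sum>e'\<in>S. single e' (single 0 (M e e') :: (unit, 'k) mpoly))" for e
  define E where "E = (\<lambda>e'. single e' (1 :: (unit, 'k) mpoly)) ` S"
  define L where "L e'' f = (\<Sum>e'\<in>S. cst f e' * N e' e'')" for e'' and f :: "'c \<Rightarrow>\<^sub>0 (unit, 'k) mpoly"
  have cst_x: "cst (x e) e' = M e e'" if "e' \<in> S" for e e'
  proof -
    have "cst (x e) e' = (\<Sum>a\<in>S. if a = e' then M e e' else 0)"
      unfolding x_def cst_def lookup_sum by (rule sum.cong) (auto simp: lookup_single when_def)
    then show ?thesis using that S by simp
  qed
  have Lx: "L e'' (x e) = (if e = e'' then 1 else 0)" if "e \<in> T" "e'' \<in> T" for e e''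
    using inv[OF that] by (simp add: L_def cst_x)
  have L_sum: "L e'' (\<Sum>a\<in>A. scale (single 0 (k a)) (y a)) = (\<Sum>a\<in>A. k a * L e'' (y a))"
    for e'' A k and y :: "'b \<Rightarrow> 'c \<Rightarrow>\<^sub>0 (unit, 'k) mpoly"
  proof (induction A rule: infinite_finite_induct)
    case (insert a A)
    have "L e'' (f + g) = L e'' f + L e'' g" for f g
      by (simp add: L_def cst_add algebra_simps sum.distrib)
    moreover have "L e'' (scale (single 0 b) f) = b * L e'' f" for b f
      by (simp add: L_def cst_def lookup_kscale sum_distrib_left mult.assoc del: lookup_scale)
    ultimately show ?case using insert by simp
  qed (simp_all add: L_def)
  have inj: "inj_on x T"
  proof (rule inj_onI)
    fix a b assume ab: "a \<in> T" "b \<in> T" "x a = x b"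
    have "L a (x b) = 1" using Lx[OF ab(1,1)] ab(3) by simp
    then show "a = b" unfolding Lx[OF ab(2,1)] by (simp split: if_splits)
  qed
  have "kvec.independent (x ` T)"
  proof (rule kvec.independent_if_scalars_zero)
    fix k y assume 0: "(\<Sum>z\<in>x ` T. scale (single 0 (k z)) z) = 0" and "y \<in> x ` T"
    then obtain e where e: "e \<in> T" "y = x e" by auto
    have "0 = L e (\<Sum>a\<in>T. scale (single 0 (k (x a))) (x a))"
      using 0 by (simp add: sum.reindex[OF inj] L_def)
    also have "\<dots> = (\<Sum>a\<in>T. if a = e then k y else 0)"
      unfolding L_sum using e by (intro sum.cong) (auto simp: Lx)
    finally show "k y = 0" using e T by simp
  qed (use T in simp)
  moreover have "x ` T \<subseteq> kvec.span E"
  proof clarify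
    fix e assume "e \<in> T"
    have "single e' (single 0 (M e e')) \<in> kvec.span E" if "e' \<in> S" for e'
    proof -
      have "scale (single 0 (M e e')) (single e' 1) \<in> kvec.span E"
        using that by (intro kvec.span_scale kvec.span_base) (auto simp: E_def)
      then show ?thesis by (simp add: scale_single)
    qed
    then show "x e \<in> kvec.span E" unfolding x_def by (rule kvec.span_sum)
  qed
  ultimately have "card (x ` T) \<le> card E"
    using kvec.independent_span_bound[of E "x ` T"] S by (simp add: E_def)
  also have "\<dots> \<le> card S" unfolding E_def using S by (rule card_image_le)
  finally show ?thesis using inj by (simp add: card_image)
qed

section \<open>Minimal resolutions over all variables\<close>

text \<open>\<open>v\<close> is the degree of a basis element and \<open>r\<close> the generator of
  F_0 = R. Finiteness is asked in each single degree, which is what graded ranks need. The value of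
  \<open>d 0\<close> is left open.\<close>

locale min_res =
  fixes I :: "('a, 'k::field) mpoly set" and B :: "nat \<Rightarrow> 'b set" and v :: "'b \<Rightarrow> nat"
    and d :: "nat \<Rightarrow> 'b \<Rightarrow> ('b \<Rightarrow>\<^sub>0 ('a, 'k) mpoly)" and r :: 'b
  assumes B_0: "B 0 = {r}" and v_r: "v r = 0"
    and finite_B: "finite {e \<in> B i. v e = j}"
    and d_free: "e \<in> B (Suc i) \<Longrightarrow> d (Suc i) e \<in> free (B i)"
    and d_hom: "e \<in> B (Suc i) \<Longrightarrow> whom mon_degree v (v e) (d (Suc i) e)"
    and d_min: "e \<in> B (Suc i) \<Longrightarrow> cst (d (Suc i) e) c = 0"
    and exact_0: "lin_ext (d (Suc 0)) ` free (B (Suc 0)) = {f \<in> free (B 0). lkp f r \<in> I}"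
    and exact_Suc: "lin_ext (d (Suc (Suc i))) ` free (B (Suc (Suc i)))
      = {f \<in> free (B (Suc i)). lin_ext (d (Suc i)) f = 0}"
begin

text \<open>For i = 0 the augmentation from R to R/I, with kernel \<open>I\<close>, takes the place
  of the differential. Exactness at all positions then becomes the single equation
  \<open>image_d\<close>.\<close>

definition cycles :: "nat \<Rightarrow> ('b \<Rightarrow>\<^sub>0 ('a, 'k) mpoly) set" where
  "cycles i = (case i of 0 \<Rightarrow> {f \<in> free (B 0). lkp f r \<in> I}
    | Suc k \<Rightarrow> {f \<in> free (B (Suc k)). lin_ext (d (Suc k)) f = 0})"

lemma cycles_0: "cycles 0 = {f \<in> free (B 0). lkp f r \<in> I}"
  by (simp add: cycles_def)

lemma cycles_Suc: "cycles (Suc i) = {f \<in> free (B (Suc i)). lin_ext (d (Suc i)) f = 0}"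
  by (simp add: cycles_def)

lemma image_d: "lin_ext (d (Suc i)) ` free (B (Suc i)) = cycles i"
  by (cases i) (simp_all add: cycles_def exact_0 exact_Suc)

lemma d_cycles: "f \<in> free (B (Suc i)) \<Longrightarrow> lin_ext (d (Suc i)) f \<in> cycles i"
  using image_d by blast

lemma d_e_cycles: "e \<in> B (Suc i) \<Longrightarrow> d (Suc i) e \<in> cycles i"
  using d_cycles[OF free_single[of e "B (Suc i)" 1]] by simp

lemma cycles_free: "f \<in> cycles i \<Longrightarrow> f \<in> free (B i)"
  by (cases i) (auto simp: cycles_def)

lemma cycles_lift: "f \<in> cycles i \<Longrightarrow> \<exists>y\<in>free (B (Suc i)). lin_ext (d (Suc i)) y = f"
  unfolding image_d[symmetric] by blast

lemma d_lin_ext_hom: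
  "f \<in> free (B (Suc i)) \<Longrightarrow> wcomp mon_degree v j (lin_ext (d (Suc i)) f)
    = lin_ext (d (Suc i)) (wcomp mon_degree v j f)"
  by (rule wcomp_lin_ext) (auto simp: mon_degree_add free_def intro: d_hom)

text \<open>The component of degree \<open>j\<close> of an arbitrary preimage is again a preimage,
  since \<open>d\<close> preserves degrees.\<close>

lemma cycles_lift_hom:
  assumes "f \<in> cycles i" "whom mon_degree v j f"
  shows "\<exists>y. y \<in> free (B (Suc i)) \<and> whom mon_degree v j y \<and> lin_ext (d (Suc i)) y = f"
proof -
  obtain y where "y \<in> free (B (Suc i))" "lin_ext (d (Suc i)) y = f"
    using cycles_lift[OF assms(1)] by blast
  then show ?thesis
    using d_lin_ext_hom[of y i j] wcomp_whom[OF assms(2)]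
    by (intro exI[of _ "wcomp mon_degree v j y"]) (simp add: wcomp_free whom_wcomp)
qed

lemma cst_d: "f \<in> free (B (Suc i)) \<Longrightarrow> cst (lin_ext (d (Suc i)) f) c = 0"
  by (rule cst_lin_ext_minimal) (auto simp: free_def d_min)

lemma ideal_iff: "p \<in> I \<longleftrightarrow> single r p \<in> cycles 0"
  by (simp add: cycles_0 free_def B_0)

end

section \<open>Comparison maps between resolutions and invariance of graded ranks\<close>

locale min_res_pair = F: min_res I B v d r + F': min_res I' B' v' d' r'
  for I :: "('a, 'k::field) mpoly set" and B :: "nat \<Rightarrow> 'b set" and v d r
    and I' :: "('a, 'k) mpoly set" and B' :: "nat \<Rightarrow> 'c set" and v' d' r' +
  assumes I_subset: "I \<subseteq> I'"
begin

text \<open>The condition at \<open>r\<close> makes this a lift of the projection from R/I to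
  R/I'.\<close>

definition chain_map :: "(nat \<Rightarrow> 'b \<Rightarrow> ('c \<Rightarrow>\<^sub>0 ('a, 'k) mpoly)) \<Rightarrow> bool" where
  "chain_map \<phi> \<longleftrightarrow> \<phi> 0 r = single r' 1 \<and>
     (\<forall>i. \<forall>e\<in>B i. \<phi> i e \<in> free (B' i) \<and> whom mon_degree v' (v e) (\<phi> i e)) \<and>
     (\<forall>i. \<forall>e\<in>B (Suc i). lin_ext (d' (Suc i)) (\<phi> (Suc i) e) = lin_ext (\<phi> i) (d (Suc i) e))"

text \<open>The source is free and the target exact, so the maps are built one position at a time.
  The invariant \<open>P\<close> also records that cycles go to cycles, which makes the image of a
  boundary liftable at the next position.\<close>

lemma ex_chain_map: "\<exists>\<phi>. chain_map \<phi>"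
proof -
  define P where "P i \<phi> \<longleftrightarrow> (i = 0 \<longrightarrow> \<phi> r = single r' 1) \<and>
     (\<forall>e\<in>B i. \<phi> e \<in> free (B' i) \<and> whom mon_degree v' (v e) (\<phi> e)) \<and>
     (\<forall>f\<in>F.cycles i. lin_ext \<phi> f \<in> F'.cycles i)" for i \<phi>
  define Q where "Q i \<phi> \<psi> \<longleftrightarrow>
     (\<forall>e\<in>B (Suc i). lin_ext (d' (Suc i)) (\<psi> e) = lin_ext \<phi> (d (Suc i) e))" for i \<phi> \<psi>
  have "\<exists>\<phi>. \<forall>i. P i (\<phi> i) \<and> Q i (\<phi> i) (\<phi> (Suc i))"
  proof (rule dependent_nat_choice)
    have "lin_ext (\<lambda>_. single r' 1) f \<in> F'.cycles 0" if "f \<in> F.cycles 0" for f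
    proof -
      have f: "f = single r (lkp f r)"
        using that F.B_0 by (intro free_singleton) (simp add: F.cycles_0)
      have "lin_ext (\<lambda>_. single r' 1) f = single r' (lkp f r)"
        by (subst f) (simp add: scale_single)
      then show ?thesis using that I_subset by (auto simp: F.cycles_0 F'.ideal_iff[symmetric])
    qed
    then have "P 0 (\<lambda>_. single r' 1)"
      by (simp add: P_def F.B_0 F'.B_0 free_def whom_def F.v_r F'.v_r lookup_single when_def)
    then show "\<exists>\<phi>. P 0 \<phi>" by blast
  next
    fix \<phi> i assume P: "P i \<phi>"
    have "\<exists>y. y \<in> free (B' (Suc i)) \<and> whom mon_degree v' (v e) y \<and>
        lin_ext (d' (Suc i)) y = lin_ext \<phi> (d (Suc i) e)" if e: "e \<in> B (Suc i)" for e
    proof (rule F'.cycles_lift_hom)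
      show "lin_ext \<phi> (d (Suc i) e) \<in> F'.cycles i"
        using P F.d_e_cycles[OF e] by (simp add: P_def)
      show "whom mon_degree v' (v e) (lin_ext \<phi> (d (Suc i) e))"
      proof (rule whom_lin_ext)
        show "whom mon_degree v' (v c) (\<phi> c)" if "c \<in> keys (d (Suc i) e)" for c
          using P F.d_free[OF e] that by (auto simp: P_def free_def)
      qed (use F.d_hom[OF e] in \<open>simp_all add: mon_degree_add\<close>)
    qed
    then obtain \<psi> where \<psi>: "\<And>e. e \<in> B (Suc i) \<Longrightarrow> \<psi> e \<in> free (B' (Suc i)) \<and>
        whom mon_degree v' (v e) (\<psi> e) \<and> lin_ext (d' (Suc i)) (\<psi> e) = lin_ext \<phi> (d (Suc i) e)"
      by metis
    have "lin_ext \<psi> f \<in> F'.cycles (Suc i)" if "f \<in> F.cycles (Suc i)" for f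
    proof -
      have f: "f \<in> free (B (Suc i))" "lin_ext (d (Suc i)) f = 0"
        using that by (auto simp: F.cycles_Suc)
      have "lin_ext (d' (Suc i)) (lin_ext \<psi> f) = lin_ext (\<lambda>e. lin_ext \<phi> (d (Suc i) e)) f"
        unfolding lin_ext_lin_ext using \<psi> by (intro lin_ext_cong_free[OF f(1)]) auto
      then show ?thesis
        using f(2) \<psi> by (auto simp: F'.cycles_Suc simp flip: lin_ext_lin_ext
            intro: free_lin_ext[OF f(1)])
    qed
    then have "P (Suc i) \<psi> \<and> Q i \<phi> \<psi>" using \<psi> by (auto simp: P_def Q_def)
    then show "\<exists>\<psi>. P (Suc i) \<psi> \<and> Q i \<phi> \<psi>" by blast
  qed
  then obtain \<phi> where "\<And>i. P i (\<phi> i) \<and> Q i (\<phi> i) (\<phi> (Suc i))" by blast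
  then have "chain_map \<phi>" by (auto simp: chain_map_def P_def Q_def)
  then show ?thesis by blast
qed

lemma chain_map_free: "chain_map \<phi> \<Longrightarrow> f \<in> free (B i) \<Longrightarrow> lin_ext (\<phi> i) f \<in> free (B' i)"
  by (rule free_lin_ext) (auto simp: chain_map_def)

lemma chain_map_d:
  assumes "chain_map \<phi>" "f \<in> free (B (Suc i))"
  shows "lin_ext (d' (Suc i)) (lin_ext (\<phi> (Suc i)) f) = lin_ext (\<phi> i) (lin_ext (d (Suc i)) f)"
  unfolding lin_ext_lin_ext using assms by (intro lin_ext_cong_free[OF assms(2)]) (auto simp: chain_map_def)

end

text \<open>A lift of the identity of \<open>R/I\<close> to a minimal resolution is homotopic to the identity, and
  the homotopy vanishes modulo the variables.\<close>

lemma (in min_res) cst_self_map: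
  assumes \<gamma>_free: "\<And>i e. e \<in> B i \<Longrightarrow> \<gamma> i e \<in> free (B i)" and \<gamma>_0: "\<gamma> 0 r = single r 1"
    and \<gamma>_d: "\<And>i e. e \<in> B (Suc i) \<Longrightarrow> lin_ext (d (Suc i)) (\<gamma> (Suc i) e) = lin_ext (\<gamma> i) (d (Suc i) e)"
    and e: "e \<in> B i"
  shows "cst (\<gamma> i e) c = (if e = c then 1 else 0)"
proof -
  \<comment> \<open>Only the homotopy equation on cycles is carried along: it is what makes
    \<open>z e\<close> below a cycle, so that the next piece of the homotopy can be lifted.\<close>
  define P where "P i h \<longleftrightarrow> (\<forall>e\<in>B i. h e \<in> free (B (Suc i))) \<and>
    (\<forall>y\<in>cycles i. lin_ext (d (Suc i)) (lin_ext h y) = lin_ext (\<gamma> i) y - y)" for i h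
  define Q where "Q i h h' \<longleftrightarrow> (\<forall>e\<in>B (Suc i). 
    lin_ext (d (Suc (Suc i))) (h' e) = \<gamma> (Suc i) e - single e 1 - lin_ext h (d (Suc i) e))" for i h h'
  have "\<exists>h. \<forall>i. P i (h i) \<and> Q i (h i) (h (Suc i))"
  proof (rule dependent_nat_choice)
    have "lin_ext (\<gamma> 0) y = y" if "y \<in> cycles 0" for y
    proof -
      have "y \<in> free {r}" using that B_0 by (simp add: cycles_0)
      then have "lin_ext (\<gamma> 0) y = lin_ext (\<lambda>e. single e 1) y"
        by (rule lin_ext_cong_free) (simp add: \<gamma>_0)
      then show ?thesis by (simp add: lin_ext_unit)
    qed
    moreover have "lin_ext (\<lambda>_. 0 :: 'b \<Rightarrow>\<^sub>0 ('a, 'k) mpoly) y = 0" for y :: "'b \<Rightarrow>\<^sub>0 ('a, 'k) mpoly"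
      by (simp add: lin_ext_def)
    moreover have "lin_ext (d (Suc 0)) 0 = 0" by simp
    \<comment> \<open>\<open>\<gamma> 0\<close> is the identity, so the homotopy may start at
      zero.\<close>
    ultimately have "P 0 (\<lambda>_. 0)" unfolding P_def by auto
    then show "\<exists>h. P 0 h" by blast
  next
    fix h i assume P: "P i h"
    define z where "z e = \<gamma> (Suc i) e - single e 1 - lin_ext h (d (Suc i) e)" for e
    have "z e \<in> cycles (Suc i)" if e: "e \<in> B (Suc i)" for e
    proof -
      have "lin_ext h (d (Suc i) e) \<in> free (B (Suc i))"
        using P e by (intro free_lin_ext[OF d_free[OF e]]) (simp add: P_def)
      then have "z e \<in> free (B (Suc i))"
        unfolding z_def using e by (intro free_diff \<gamma>_free free_single)
      moreover have "lin_ext (d (Suc i)) (z e) = 0"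
        using P d_e_cycles[OF e] by (simp add: z_def lin_ext_diff P_def \<gamma>_d[OF e])
      ultimately show ?thesis by (simp add: cycles_Suc)
    qed
    then have "\<forall>e\<in>B (Suc i). \<exists>y. y \<in> free (B (Suc (Suc i))) \<and> lin_ext (d (Suc (Suc i))) y = z e"
      using cycles_lift by blast
    then obtain h' where h': "\<And>e. e \<in> B (Suc i) \<Longrightarrow>
        h' e \<in> free (B (Suc (Suc i))) \<and> lin_ext (d (Suc (Suc i))) (h' e) = z e"
      by metis
    have "lin_ext (d (Suc (Suc i))) (lin_ext h' y) = lin_ext (\<gamma> (Suc i)) y - y"
      if "y \<in> cycles (Suc i)" for y
    proof -
      have y: "y \<in> free (B (Suc i))" "lin_ext (d (Suc i)) y = 0" using that by (auto simp: cycles_Suc)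
      have "lin_ext (d (Suc (Suc i))) (lin_ext h' y) = lin_ext z y"
        unfolding lin_ext_lin_ext using h' by (intro lin_ext_cong_free[OF y(1)]) auto
      also have "\<dots> = lin_ext (\<gamma> (Suc i)) y - y - lin_ext h (lin_ext (d (Suc i)) y)"
        unfolding z_def by (simp add: lin_ext_diff_fun lin_ext_unit lin_ext_lin_ext)
      finally show ?thesis using y by simp
    qed
    then have "P (Suc i) h' \<and> Q i h h'" using h' by (auto simp: P_def Q_def z_def)
    then show "\<exists>h'. P (Suc i) h' \<and> Q i h h'" by blast
  qed
  then obtain h where h: "\<And>i. P i (h i) \<and> Q i (h i) (h (Suc i))" by blast
  show ?thesis
  proof (cases i)
    case 0
    then show ?thesis using e by (simp add: B_0 \<gamma>_0 cst_single)
  next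
    case (Suc k)
    \<comment> \<open>Both correction terms vanish modulo the variables: the first applies
      \<open>h\<close> to a value of the minimal differential, the second is a boundary.\<close>
    have "\<gamma> i e = single e 1 + lin_ext (h k) (d i e) + lin_ext (d (Suc i)) (h i e)"
      using h[of k] e by (simp add: Q_def Suc algebra_simps)
    moreover have "cst (lin_ext (h k) (d i e)) c = 0"
      using e Suc by (intro cst_lin_ext_minimal) (simp add: d_min)
    moreover have "cst (lin_ext (d (Suc i)) (h i e)) c = 0"
      using h[of i] e by (intro cst_d) (simp add: P_def)
    ultimately show ?thesis by (simp add: cst_add cst_single)
  qed
qed

text \<open>Comparison maps in both directions compose to a self-map that is the identity on
  constant terms. The maps preserve degrees, so their constant terms form one block for each degree,
  and the block in degree \<open>j\<close> has a one-sided inverse.\<close>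

lemma card_basis_le:
  assumes "min_res I B v d r" "min_res I B' v' d' r'"
  shows "card {e \<in> B i. v e = j} \<le> card {e \<in> B' i. v' e = j}"
proof -
  interpret min_res_pair I B v d r I B' v' d' r'
    using assms by (simp add: min_res_pair_def min_res_pair_axioms_def)
  interpret rev: min_res_pair I B' v' d' r' I B v d r
    using assms by (simp add: min_res_pair_def min_res_pair_axioms_def)
  obtain \<phi> where \<phi>: "chain_map \<phi>" using ex_chain_map by blast
  obtain \<psi> where \<psi>: "rev.chain_map \<psi>" using rev.ex_chain_map by blast
  define \<gamma> where "\<gamma> i e = lin_ext (\<psi> i) (\<phi> i e)" for i e
  have \<phi>_free: "\<phi> i e \<in> free (B' i)" if "e \<in> B i" for i e
    using \<phi> that by (simp add: chain_map_def)
  have \<gamma>: "cst (\<gamma> i e) c = (if e = c then 1 else 0)" if "e \<in> B i" for e c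
  proof (rule F.cst_self_map[OF _ _ _ that])
    show "\<gamma> i e \<in> free (B i)" if "e \<in> B i" for i e
      unfolding \<gamma>_def by (intro rev.chain_map_free[OF \<psi>] \<phi>_free that)
    show "\<gamma> 0 r = single r 1"
      using \<phi> \<psi> by (simp add: \<gamma>_def chain_map_def rev.chain_map_def)
    show "lin_ext (d (Suc i)) (\<gamma> (Suc i) e) = lin_ext (\<gamma> i) (d (Suc i) e)"
      if "e \<in> B (Suc i)" for i e
    proof -
      have "lin_ext (d' (Suc i)) (\<phi> (Suc i) e) = lin_ext (\<phi> i) (d (Suc i) e)"
        using \<phi> that by (simp add: chain_map_def)
      then show ?thesis
        using rev.chain_map_d[OF \<psi> \<phi>_free[OF that]]
        by (simp add: \<gamma>_def[abs_def] lin_ext_lin_ext)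
    qed
  qed
  show ?thesis
  proof (rule card_le_if_left_inverse[OF F.finite_B F'.finite_B])
    fix e e'' assume e: "e \<in> {e \<in> B i. v e = j}" and e'': "e'' \<in> {e \<in> B i. v e = j}"
    have "cst (\<gamma> i e) e'' = (\<Sum>e'\<in>{e \<in> B' i. v' e = j}. cst (\<phi> i e) e' * cst (\<psi> i e') e'')"
      unfolding \<gamma>_def
    proof (rule cst_lin_ext_eq[OF F'.finite_B])
      fix c assume c: "cst (\<phi> i e) c \<noteq> 0"
      then have "lkp (\<phi> i e) c \<noteq> 0" by (auto simp: cst_def)
      then have "c \<in> B' i" using \<phi>_free[of e i] e by (auto simp: free_def in_keys_iff)
      moreover have "v' c = j"
        using c e \<phi> by (intro whom_cst) (auto simp: chain_map_def)
      ultimately show "c \<in> {e \<in> B' i. v' e = j}" by simp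
    qed
    then show "(\<Sum>e'\<in>{e \<in> B' i. v' e = j}. cst (\<phi> i e) e' * cst (\<psi> i e') e'')
        = (if e = e'' then 1 else 0)"
      using \<gamma>[of e e''] e by simp
  qed
qed

theorem card_basis_eq:
  assumes "min_res I B v d r" "min_res I B' v' d' r'"
  shows "card {e \<in> B i. v e = j} = card {e \<in> B' i. v' e = j}"
  using card_basis_le[OF assms] card_basis_le[OF assms(2,1)] by (rule antisym)

section \<open>Existence of minimal resolutions of monomial ideals\<close>

definition carr :: "'a set \<Rightarrow> ('a, 'k::field) mpoly set" where
  "carr V = {p. \<forall>m\<in>keys p. keys m \<subseteq> V}"

lemma carrier_mpoly_ring: "carrier (mpoly_ring V) = carr V"
  by (simp add: mpoly_ring_def carr_def)

lemma carr_0 [simp]: "0 \<in> carr V"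
  by (simp add: carr_def)

lemma carr_add: "p \<in> carr V \<Longrightarrow> q \<in> carr V \<Longrightarrow> p + q \<in> carr V"
  unfolding carr_def using Poly_Mapping.keys_add[of p q] by blast

lemma carr_mult:
  assumes "p \<in> carr V" "q \<in> carr V"
  shows "p * q \<in> carr V"
  unfolding carr_def
proof (intro CollectI ballI)
  fix m assume "m \<in> keys (p * q)"
  then obtain a b where ab: "a \<in> keys p" "b \<in> keys q" "m = a + b" using keys_times by blast
  then have "keys a \<subseteq> V" "keys b \<subseteq> V" using assms by (auto simp: carr_def)
  then show "keys m \<subseteq> V" using Poly_Mapping.keys_add[of a b] ab(3) by blast
qed

lemma carr_single: "keys m \<subseteq> V \<Longrightarrow> single m k \<in> carr V"
  by (simp add: carr_def)

lemma carr_pfilt: "p \<in> carr V \<Longrightarrow> pfilt Q p \<in> carr V"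
  by (simp add: carr_def keys_pfilt)

lemma carr_sum: "(\<And>a. a \<in> A \<Longrightarrow> f a \<in> carr V) \<Longrightarrow> sum f A \<in> carr V"
  by (induction A rule: infinite_finite_induct) (auto intro: carr_add)

definition fmod :: "'a set \<Rightarrow> 'b set \<Rightarrow> ('b \<Rightarrow>\<^sub>0 ('a, 'k::field) mpoly) set" where
  "fmod V B = {f \<in> free B. \<forall>e. lkp f e \<in> carr V}"

lemma free_module_eq: "free_module V n = fmod V (free_basis n)"
  by (simp add: free_module_def fmod_def free_def carrier_mpoly_ring)

lemma fmod_free: "f \<in> fmod V B \<Longrightarrow> f \<in> free B"
  by (simp add: fmod_def)

lemma fmod_lookup: "f \<in> fmod V B \<Longrightarrow> lkp f e \<in> carr V"
  by (simp add: fmod_def)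

lemma fmod_keys: "f \<in> fmod V B \<Longrightarrow> e \<in> keys f \<Longrightarrow> e \<in> B"
  by (auto simp: fmod_def free_def)

lemma whomD: "whom w v j f \<Longrightarrow> m \<in> keys (lkp f c) \<Longrightarrow> w m + v c = j"
  by (simp add: whom_def)

lemma fmod_0 [simp]: "0 \<in> fmod V B"
  by (simp add: fmod_def)

lemma fmod_add: "f \<in> fmod V B \<Longrightarrow> g \<in> fmod V B \<Longrightarrow> f + g \<in> fmod V B"
  by (simp add: fmod_def free_add lookup_add carr_add)

lemma fmod_scale: "p \<in> carr V \<Longrightarrow> f \<in> fmod V B \<Longrightarrow> scale p f \<in> fmod V B"
  by (simp add: fmod_def free_scale carr_mult)

lemma fmod_single: "c \<in> B \<Longrightarrow> p \<in> carr V \<Longrightarrow> single c p \<in> fmod V B"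
  by (simp add: fmod_def free_single lookup_single when_def)

lemma fmod_sum: "(\<And>a. a \<in> A \<Longrightarrow> f a \<in> fmod V B) \<Longrightarrow> sum f A \<in> fmod V B"
  by (induction A rule: infinite_finite_induct) (auto intro: fmod_add)

lemma fmod_wcomp: "f \<in> fmod V B \<Longrightarrow> wcomp w v g f \<in> fmod V B"
  by (simp add: fmod_def wcomp_free lookup_wcomp carr_pfilt)

lemma whom_scale:
  assumes w: "\<And>m m'. w (m + m') = w m + w m'" and f: "whom w v i f"
    and p: "\<And>m. m \<in> keys p \<Longrightarrow> w m + i = j"
  shows "whom w v j (scale p f)"
  unfolding whom_def
proof (intro allI ballI)
  fix c m assume "m \<in> keys (lkp (scale p f) c)"
  then obtain a b where ab: "a \<in> keys p" "b \<in> keys (lkp f c)" "m = a + b"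
    using keys_times[of m p "lkp f c"] by auto
  have "w m + v c = w a + (w b + v c)" by (simp add: ab(3) w add.assoc)
  also have "\<dots> = j" using f ab p by (simp add: whom_def)
  finally show "w m + v c = j" .
qed

lemma mono_split:
  fixes m :: "'a \<Rightarrow>\<^sub>0 nat"
  assumes "m \<noteq> 0"
  shows "\<exists>v\<in>keys m. \<exists>m'. m = single v 1 + m' \<and> keys m' \<subseteq> keys m"
proof -
  have "keys m \<noteq> {}" using assms mon_degree_eq_0_iff[of m] by (auto simp: mon_degree_def)
  then obtain v where v: "v \<in> keys m" by blast
  have "m = single v 1 + (m - single v 1)"
    using v by (intro poly_mapping_eqI) (auto simp: lookup_add lookup_minus lookup_single when_def in_keys_iff)
  moreover have "keys (m - single v 1) \<subseteq> keys m"
    by (auto simp: in_keys_iff lookup_minus)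
  ultimately show ?thesis using v by blast
qed

lemma finite_monomials:
  assumes "finite V"
  shows "finite {m :: 'a \<Rightarrow>\<^sub>0 nat. keys m \<subseteq> V \<and> mon_degree m \<le> j}" (is "finite ?M")
proof (rule finite_imageD)
  have "lkp m \<in> {f. \<forall>x. (x \<in> V \<longrightarrow> f x \<in> {..j}) \<and> (x \<notin> V \<longrightarrow> f x = 0)}" if m: "m \<in> ?M" for m
  proof (intro CollectI allI conjI impI)
    fix x
    show "lkp m x = 0" if "x \<notin> V" using m that by (auto simp: in_keys_iff)
    have "lkp m x \<le> mon_degree m" if "x \<in> V"
      using m assms that member_le_sum[of x V "lkp m"] by (simp add: mon_degree_eq_sum[of V])
    then show "lkp m x \<in> {..j}" if "x \<in> V" using m that by fastforce
  qed
  then show "finite (lkp ` ?M)"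
    using finite_set_of_finite_funs[of V "{..j}" 0] assms
    by (intro finite_subset[of "lkp ` ?M"]) auto
  show "inj_on lkp ?M" by (rule inj_onI) (simp add: poly_mapping_eqI)
qed

text \<open>A nonzero coefficient would put \<open>b\<close> into the span of the other elements of
  \<open>C\<close>. In other words, \<open>C - A\<close> stays independent modulo the span of
  \<open>A\<close>.\<close>

lemma (in vector_space) independent_coeff_zero:
  assumes ind: "independent C" and A: "A \<subseteq> C" and F: "finite F" "F \<subseteq> C - A"
    and sum: "(\<Sum>b\<in>F. scale (u b) b) \<in> span A" and b: "b \<in> F"
  shows "u b = 0"
proof (rule ccontr)
  assume nz: "u b \<noteq> 0"
  have "b \<notin> A" using F b by blast
  have "(\<Sum>b\<in>F. scale (u b) b) - (\<Sum>b\<in>F - {b}. scale (u b) b) \<in> span (C - {b})"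
  proof (rule span_diff)
    show "(\<Sum>b\<in>F. scale (u b) b) \<in> span (C - {b})"
      using sum span_mono[of A "C - {b}"] A \<open>b \<notin> A\<close> by blast
    show "(\<Sum>b\<in>F - {b}. scale (u b) b) \<in> span (C - {b})"
      using F by (intro span_sum span_scale span_base) auto
  qed
  then have "scale (u b) b \<in> span (C - {b})"
    using F b by (simp add: sum.remove)
  then have "scale (inverse (u b)) (scale (u b) b) \<in> span (C - {b})" by (rule span_scale)
  then have "b \<in> span (C - {b})" using nz by simp
  then show False using ind b F by (auto simp: dependent_def)
qed

section \<open>Minimal homogeneous generators of graded submodules\<close>

abbreviation "dhom \<equiv> whom mon_degree fst"

text \<open>These are the modules to be covered while a resolution is built: first the ideal inside
  R, then the successive kernels. \<open>Z_cst\<close> puts \<open>Z\<close> into the ideal of the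
  variables times the free module, which makes the next differential minimal.\<close>

locale min_submodule =
  fixes V :: "'a set" and n :: "nat \<Rightarrow> nat" and Z :: "(nat \<times> nat \<Rightarrow>\<^sub>0 ('a, 'k::field) mpoly) set"
  assumes finite_V: "finite V"
    and Z_subset: "Z \<subseteq> fmod V (free_basis n)"
    and Z_0: "0 \<in> Z" and Z_add: "f \<in> Z \<Longrightarrow> g \<in> Z \<Longrightarrow> f + g \<in> Z"
    and Z_scale: "p \<in> carr V \<Longrightarrow> f \<in> Z \<Longrightarrow> scale p f \<in> Z"
    and Z_wcomp: "f \<in> Z \<Longrightarrow> wcomp mon_degree fst j f \<in> Z"
    and Z_cst: "f \<in> Z \<Longrightarrow> cst f c = 0"
begin

definition Zj :: "nat \<Rightarrow> (nat \<times> nat \<Rightarrow>\<^sub>0 ('a, 'k::field) mpoly) set" where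
  "Zj j = {f \<in> Z. dhom j f}"

text \<open>The degree \<open>j\<close> part of mZ, where m is generated by the variables in
  \<open>V\<close>; its complement in the degree \<open>j\<close> part of \<open>Z\<close> tells
  which new generators are needed. Writing \<open>Suc i = j\<close> makes \<open>W 0\<close> the
  zero space.\<close>

definition W :: "nat \<Rightarrow> (nat \<times> nat \<Rightarrow>\<^sub>0 ('a, 'k::field) mpoly) set" where
  "W j = kvec.span {scale (mvar v) z |v z. v \<in> V \<and> z \<in> Z \<and> (\<exists>i. Suc i = j \<and> dhom i z)}"

lemma const_carr: "single 0 a \<in> carr V"
  by (rule carr_single) simp

lemma mvar_carr: "v \<in> V \<Longrightarrow> mvar v \<in> carr V"
  unfolding mvar_def by (rule carr_single) simp

lemma subspace_Zj: "kvec.subspace (Zj j)"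
  by (rule kvec.subspaceI)
    (auto simp: Zj_def Z_0 Z_add intro!: Z_scale const_carr whom_add whom_scale[of mon_degree _ j _ _ j]
      simp: mon_degree_add split: if_splits)

lemma W_subset_Zj: "W j \<subseteq> Zj j"
  unfolding W_def
proof (rule kvec.span_minimal[OF _ subspace_Zj], clarify)
  fix v z i assume "v \<in> V" "z \<in> Z" "dhom i z" "j = Suc i"
  moreover from this have "dhom (Suc i) (scale (mvar v) z)"
    by (intro whom_scale[of mon_degree _ i]) (auto simp: mon_degree_add mvar_def)
  ultimately show "scale (mvar v) z \<in> Zj (Suc i)"
    by (simp add: Zj_def Z_scale mvar_carr)
qed

text \<open>An element of degree \<open>j\<close> involves only products of a basis element and a
  monomial of degrees at most \<open>j\<close>, and there are finitely many of them because
  \<open>V\<close> is finite.\<close>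

lemma Zj_subset_span:
  "\<exists>M. finite M \<and> Zj j \<subseteq> kvec.span M"
proof -
  let ?B = "Sigma {..j} (\<lambda>i. {..<n i})"
  let ?M = "(\<lambda>(c, m). single c (single m 1 :: ('a, 'k) mpoly)) ` (?B \<times> {m. keys m \<subseteq> V \<and> mon_degree m \<le> j})"
  have "finite ?M" using finite_monomials[OF finite_V] by simp
  moreover have "f \<in> kvec.span ?M" if f: "f \<in> Zj j" for f
  proof -
    have "f = (\<Sum>c\<in>keys f. single c (\<Sum>m\<in>keys (lkp f c). single m (lkp (lkp f c) m)))"
      by (subst poly_mapping_sum_single[of f], subst (2) poly_mapping_sum_single) (rule refl)
    also have "\<dots> = (\<Sum>c\<in>keys f. \<Sum>m\<in>keys (lkp f c). scale (single 0 (lkp (lkp f c) m)) (single c (single m 1)))"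
    proof (rule sum.cong[OF refl])
      have "single c (sum g A) = (\<Sum>a\<in>A. single c (g a))" for c and g :: "_ \<Rightarrow> ('a, 'k) mpoly" and A :: "('a \<Rightarrow>\<^sub>0 nat) set"
        by (induction A rule: infinite_finite_induct) (auto simp: single_add)
      then show "single c (\<Sum>m\<in>keys (lkp f c). single m (lkp (lkp f c) m))
          = (\<Sum>m\<in>keys (lkp f c). scale (single 0 (lkp (lkp f c) m)) (single c (single m 1)))" for c :: "nat \<times> nat"
        by (simp add: scale_single mult_single)
    qed
    also have "\<dots> \<in> kvec.span ?M"
    proof (intro kvec.span_sum kvec.span_scale kvec.span_base)
      fix c m assume c: "c \<in> keys f" and m: "m \<in> keys (lkp f c)"
      have "mon_degree m + fst c = j" "c \<in> free_basis n" "keys m \<subseteq> V"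
        using f Z_subset c m fmod_keys[of f V "free_basis n" c] fmod_lookup[of f V "free_basis n" c]
        by (auto simp: Zj_def carr_def dest: whomD)
      then show "single c (single m 1) \<in> ?M"
        by (intro image_eqI[of _ _ "(c, m)"]) (auto simp: free_basis_def)
    qed
    finally show ?thesis .
  qed
  ultimately show ?thesis by blast
qed

text \<open>Since \<open>i\<close> differs from \<open>j\<close>, no monomial of \<open>p\<close> is
  constant; a variable can be split off from each, and the remaining factor is absorbed by
  \<open>Z\<close>.\<close>

lemma scale_in_W:
  assumes z: "z \<in> Z" "dhom i z" and p: "p \<in> carr V" "\<And>m. m \<in> keys p \<Longrightarrow> mon_degree m + i = j" and "i \<noteq> j"
  shows "scale p z \<in> W j"
proof -
  have "scale p z = (\<Sum>m\<in>keys p. scale (single m (lkp p m)) z)"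
    by (subst poly_mapping_sum_single[of p]) (rule mod.scale_sum_left)
  also have "\<dots> \<in> W j"
    unfolding W_def
  proof (rule kvec.span_sum)
    fix m assume m: "m \<in> keys p"
    then have "m \<noteq> 0" using p(2)[OF m] \<open>i \<noteq> j\<close> by auto
    then obtain v m' where v: "v \<in> keys m" "m = single v 1 + m'" "keys m' \<subseteq> keys m"
      using mono_split by blast
    have V: "keys m \<subseteq> V" using p m by (simp add: carr_def)
    have "scale (single m (lkp p m)) z = scale (single 0 (lkp p m)) (scale (mvar v) (scale (single m' 1) z))"
      by (simp add: mvar_def mult_single v(2))
    also have "\<dots> \<in> kvec.span {scale (mvar v) z |v z. v \<in> V \<and> z \<in> Z \<and> (\<exists>i. Suc i = j \<and> dhom i z)}"
    proof (intro kvec.span_scale kvec.span_base CollectI exI conjI)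
      show "v \<in> V" using v V by blast
      show "scale (single m' 1) z \<in> Z" using v V z by (intro Z_scale carr_single) auto
      show "Suc (mon_degree m' + i) = j" using p(2)[OF m] by (simp add: v(2) mon_degree_add)
      show "dhom (mon_degree m' + i) (scale (single m' 1) z)"
        using z by (intro whom_scale[of mon_degree _ i]) (auto simp: mon_degree_add)
    qed (rule refl)
    finally show "scale (single m (lkp p m)) z \<in> \<dots>" .
  qed
  finally show ?thesis .
qed

text \<open>Graded Nakayama: in each degree \<open>j\<close>, a basis \<open>A\<close> of
  \<open>W j\<close> is extended to a basis \<open>C\<close> of the degree \<open>j\<close> part of
  \<open>Z\<close>, and the elements of \<open>C - A\<close> become generators. They generate by
  induction on the degree. A relation with a nonzero constant coefficient would make
  \<open>C - A\<close> dependent modulo \<open>W j\<close>.\<close>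

lemma ex_minimal_generators:
  "\<exists>n' d. (\<forall>e\<in>free_basis n'. d e \<in> Z \<and> dhom (fst e) (d e)) \<and>
     lin_ext d ` fmod V (free_basis n') = Z \<and>
     (\<forall>f\<in>fmod V (free_basis n'). lin_ext d f = 0 \<longrightarrow> (\<forall>c. cst f c = 0))"
proof -
  have "\<exists>A C. A \<subseteq> W j \<and> W j \<subseteq> kvec.span A \<and> A \<subseteq> C \<and> C \<subseteq> Zj j \<and> kvec.independent C \<and>
      Zj j \<subseteq> kvec.span C" for j
  proof -
    obtain A where A: "A \<subseteq> W j" "kvec.independent A" "W j \<subseteq> kvec.span A"
      by (rule kvec.maximal_independent_subset)
    have "A \<subseteq> Zj j" using A(1) W_subset_Zj by blast
    then obtain C where "A \<subseteq> C" "C \<subseteq> Zj j" "kvec.independent C" "Zj j \<subseteq> kvec.span C"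
      using A(2) by (rule kvec.maximal_independent_subset_extend)
    then show ?thesis using A by blast
  qed
  then obtain A C where AC: "\<And>j. A j \<subseteq> W j" "\<And>j. W j \<subseteq> kvec.span (A j)" "\<And>j. A j \<subseteq> C j"
      "\<And>j. C j \<subseteq> Zj j" "\<And>j. kvec.independent (C j)" "\<And>j. Zj j \<subseteq> kvec.span (C j)"
    by metis
  have fin: "finite (C j - A j)" for j
  proof -
    obtain M where "finite M" "Zj j \<subseteq> kvec.span M" using Zj_subset_span by blast
    then have "finite (C j)"
      using kvec.independent_span_bound[of M "C j"] AC(4,5)[of j] by blast
    then show ?thesis by blast
  qed
  define n' where "n' j = card (C j - A j)" for j
  have "\<exists>h. bij_betw h {0..<n' j} (C j - A j)" for j
    unfolding n'_def using fin by (rule ex_bij_betw_nat_finite)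
  then obtain h where h: "\<And>j. bij_betw (h j) {0..<n' j} (C j - A j)" by metis
  define d where "d e = h (fst e) (snd e)" for e
  have d_in: "d e \<in> C (fst e) - A (fst e)" if "e \<in> free_basis n'" for e
  proof -
    have "snd e \<in> {0..<n' (fst e)}" using that by (auto simp: free_basis_def)
    then show ?thesis unfolding d_def using bij_betwE[OF h] by blast
  qed
  have d_Zj: "d e \<in> Zj (fst e)" if "e \<in> free_basis n'" for e
    using d_in[OF that] AC(4) by blast
  let ?F = "fmod V (free_basis n') :: (nat \<times> nat \<Rightarrow>\<^sub>0 ('a, 'k) mpoly) set"
  have Im_add: "f + g \<in> lin_ext d ` ?F" if "f \<in> lin_ext d ` ?F" "g \<in> lin_ext d ` ?F" for f g
    using that by (auto simp flip: lin_ext_add intro!: imageI fmod_add)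
  have Im_scale: "scale p f \<in> lin_ext d ` ?F" if "f \<in> lin_ext d ` ?F" "p \<in> carr V" for f p
    using that by (auto simp flip: lin_ext_scale intro!: imageI fmod_scale)
  have Im_0: "0 \<in> lin_ext d ` ?F" by (rule image_eqI[of _ _ 0]) simp_all
  have Im_sub: "kvec.subspace (lin_ext d ` ?F)"
    by (rule kvec.subspaceI) (auto intro: Im_add Im_scale Im_0 const_carr)
  have Zj_Im: "Zj j \<subseteq> lin_ext d ` ?F" for j
  proof (induction j rule: less_induct)
    case (less j)
    have "W j \<subseteq> lin_ext d ` ?F"
      unfolding W_def
    proof (rule kvec.span_minimal[OF _ Im_sub], clarify)
      fix v z i assume "v \<in> V" "z \<in> Z" "dhom i z" "j = Suc i"
      then have "z \<in> Zj i" by (simp add: Zj_def)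
      then have "z \<in> lin_ext d ` ?F" using less[of i] \<open>j = Suc i\<close> by blast
      then show "scale (mvar v) z \<in> lin_ext d ` ?F" using \<open>v \<in> V\<close> by (intro Im_scale mvar_carr)
    qed
    then have "A j \<subseteq> lin_ext d ` ?F" using AC(1)[of j] by blast
    moreover have "C j - A j \<subseteq> lin_ext d ` ?F"
    proof
      fix x assume "x \<in> C j - A j"
      then obtain k where k: "k \<in> {0..<n' j}" "x = h j k" using bij_betw_imp_surj_on[OF h[of j]] by blast
      have "single (j, k) 1 \<in> ?F"
        using k by (intro fmod_single) (auto simp: free_basis_def carr_def)
      moreover have "lin_ext d (single (j, k) 1) = x" by (simp add: d_def k)
      ultimately show "x \<in> lin_ext d ` ?F" by blast
    qed
    ultimately have "C j \<subseteq> lin_ext d ` ?F" by blast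
    then show ?case using kvec.span_minimal[OF _ Im_sub] AC(6)[of j] by blast
  qed
  have "f \<in> lin_ext d ` ?F" if "f \<in> Z" for f
  proof (rule wcomp_closed[OF Im_0])
    show "wcomp mon_degree fst j f \<in> lin_ext d ` ?F" for j
      using Zj_Im[of j] Z_wcomp[OF that, of j] whom_wcomp[of mon_degree fst j f] by (auto simp: Zj_def)
  qed (rule Im_add)
  moreover have "lin_ext d f \<in> Z" if "f \<in> ?F" for f
  proof (rule lin_ext_in_closed[OF Z_0 Z_add])
    fix e assume "e \<in> keys f"
    then show "scale (lkp f e) (d e) \<in> Z"
      using that d_Zj[of e] by (intro Z_scale) (auto simp: Zj_def dest: fmod_keys intro: fmod_lookup)
  qed
  ultimately have im: "lin_ext d ` ?F = Z" by blast
  have "cst f c = 0" if f: "f \<in> ?F" "lin_ext d f = 0" for f c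
  proof (cases "c \<in> keys f")
    case False
    then show ?thesis by (simp add: cst_def in_keys_iff)
  next
    case c: True
    \<comment> \<open>The component in the degree of \<open>c\<close> keeps the constant term at
      \<open>c\<close>. In it, generators of degree \<open>j\<close> have constant coefficients, and
      all other generators contribute elements of \<open>W j\<close>.\<close>
    define j where "j = fst c"
    define g where "g = wcomp mon_degree fst j f"
    have g: "g \<in> ?F" unfolding g_def using f(1) by (rule fmod_wcomp)
    have g_hom: "dhom j g" unfolding g_def by (rule whom_wcomp)
    have g_basis: "e \<in> free_basis n'" if "e \<in> keys g" for e
      using g that by (auto simp: fmod_def free_def)
    have "lin_ext d g = wcomp mon_degree fst j (lin_ext d f)"
      unfolding g_def
      by (rule wcomp_lin_ext[symmetric]) (use f d_Zj in \<open>auto simp: mon_degree_add fmod_def free_def Zj_def\<close>)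
    then have "lin_ext d g = 0" using f(2) by simp
    have g_cst: "cst g e = cst f e" if "fst e = j" for e
      using that by (simp add: g_def cst_def lookup_wcomp lookup_pfilt)
    let ?K = "{e \<in> keys g. fst e = j}" and ?L = "{e \<in> keys g. fst e \<noteq> j}"
    have lkp_K: "lkp g e = single 0 (cst g e)" if "fst e = j" for e
    proof (rule poly_mapping_eqI)
      fix m
      have "lkp (lkp g e) m = 0" if "m \<noteq> 0"
        using whomD[OF g_hom, of m e] \<open>fst e = j\<close> that mon_degree_eq_0_iff[of m]
        by (auto simp: in_keys_iff)
      then show "lkp (lkp g e) m = lkp (single 0 (cst g e)) m"
        by (auto simp: cst_def lookup_single when_def)
    qed
    have inj: "inj_on d ?K"
    proof (rule inj_onI)
      fix e e' assume e: "e \<in> ?K" "e' \<in> ?K" "d e = d e'"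
      then have "snd e \<in> {0..<n' j}" "snd e' \<in> {0..<n' j}"
        using g_basis[of e] g_basis[of e'] by (auto simp: free_basis_def)
      moreover have "h j (snd e) = h j (snd e')" using e by (simp add: d_def)
      ultimately have "snd e = snd e'" using h[of j] by (auto simp: bij_betw_def inj_on_def)
      then show "e = e'" using e by (simp add: prod_eq_iff)
    qed
    have "(\<Sum>e\<in>?K. scale (lkp g e) (d e)) + (\<Sum>e\<in>?L. scale (lkp g e) (d e)) = lin_ext d g"
      unfolding lin_ext_def by (subst sum.union_disjoint[symmetric]) (auto intro!: sum.cong)
    then have "(\<Sum>e\<in>?K. scale (lkp g e) (d e)) = - (\<Sum>e\<in>?L. scale (lkp g e) (d e))"
      using \<open>lin_ext d g = 0\<close> by (simp add: eq_neg_iff_add_eq_0)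
    moreover have "(\<Sum>e\<in>?L. scale (lkp g e) (d e)) \<in> W j"
    proof -
      have "scale (lkp g e) (d e) \<in> W j" if "e \<in> ?L" for e
        using that d_Zj[OF g_basis, of e] g g_hom
        by (intro scale_in_W[of _ "fst e"]) (auto simp: Zj_def intro: fmod_lookup dest: whomD)
      then show ?thesis unfolding W_def by (rule kvec.span_sum)
    qed
    then have "- (\<Sum>e\<in>?L. scale (lkp g e) (d e)) \<in> W j" unfolding W_def by (rule kvec.span_neg)
    ultimately have "(\<Sum>e\<in>?K. scale (lkp g e) (d e)) \<in> kvec.span (A j)" using AC(2)[of j] by auto
    moreover have "(\<Sum>e\<in>?K. scale (lkp g e) (d e)) = (\<Sum>e\<in>?K. scale (single 0 (cst g e)) (d e))"
      by (rule sum.cong) (simp_all add: lkp_K)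
    \<comment> \<open>Independence concerns a set of vectors, so the coefficients are indexed by the
      vectors themselves through the inverse of \<open>d\<close>.\<close>
    moreover have "(\<Sum>b\<in>d ` ?K. scale (single 0 (cst g (the_inv_into ?K d b))) b)
        = (\<Sum>e\<in>?K. scale (single 0 (cst g e)) (d e))"
      unfolding sum.reindex[OF inj] o_def by (rule sum.cong) (simp_all add: the_inv_into_f_f[OF inj])
    ultimately have *: "cst g (the_inv_into ?K d b) = 0" if "b \<in> d ` ?K" for b
      using that d_in[OF g_basis] AC(3,5)
      by (intro kvec.independent_coeff_zero[of "C j" "A j" "d ` ?K" "\<lambda>b. cst g (the_inv_into ?K d b)"]) auto
    show ?thesis
    proof (cases "c \<in> keys g")
      case True
      then have "c \<in> ?K" by (simp add: j_def)
      then have "cst g c = 0" using *[of "d c"] the_inv_into_f_f[OF inj, of c] by auto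
      then show ?thesis using g_cst[of c] by (simp add: j_def)
    next
      case False
      then show ?thesis using g_cst[of c] by (simp add: j_def cst_def in_keys_iff)
    qed
  qed
  moreover have "d e \<in> Z \<and> dhom (fst e) (d e)" if "e \<in> free_basis n'" for e
    using d_Zj[OF that] by (simp add: Zj_def)
  ultimately show ?thesis using im by blast
qed

text \<open>Minimality of the generators is exactly \<open>Z_cst\<close> for their kernel, so the
  construction can be iterated.\<close>

lemma kernel_min_submodule:
  assumes d: "\<And>e. e \<in> free_basis n' \<Longrightarrow> dhom (fst e) (d e)"
    and c: "\<And>f c. f \<in> fmod V (free_basis n') \<Longrightarrow> lin_ext d f = 0 \<Longrightarrow> cst f c = 0"
  shows "min_submodule V n' {f \<in> fmod V (free_basis n'). lin_ext d f = 0}"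
proof
  fix f j assume f: "f \<in> {f \<in> fmod V (free_basis n'). lin_ext d f = 0}"
  have "lin_ext d (wcomp mon_degree fst j f) = wcomp mon_degree fst j (lin_ext d f)"
    by (rule wcomp_lin_ext[symmetric]) (use f d in \<open>auto simp: mon_degree_add fmod_def free_def\<close>)
  then show "wcomp mon_degree fst j f \<in> {f \<in> fmod V (free_basis n'). lin_ext d f = 0}"
    using f by (auto intro: fmod_wcomp)
qed (auto simp: finite_V lin_ext_add lin_ext_scale intro: fmod_add fmod_scale c)

end

text \<open>Keeping the monomial set \<open>M\<close> apart from the variables \<open>V\<close> lets
  the same \<open>M\<close> describe the ideal over the variables of a graph and, with
  \<open>UNIV\<close>, over all variables. It is an ideal when \<open>M\<close> is closed under
  multiples.\<close>

definition mono_ideal :: "'a set \<Rightarrow> ('a \<Rightarrow>\<^sub>0 nat) set \<Rightarrow> ('a, 'k::field) mpoly set" where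
  "mono_ideal V M = {p \<in> carr V. keys p \<subseteq> M}"

lemma carr_UNIV: "carr UNIV = UNIV"
  by (simp add: carr_def)

lemma mono_ideal_0 [simp]: "0 \<in> mono_ideal V M"
  by (simp add: mono_ideal_def)

lemma mono_ideal_add: "p \<in> mono_ideal V M \<Longrightarrow> q \<in> mono_ideal V M \<Longrightarrow> p + q \<in> mono_ideal V M"
  using Poly_Mapping.keys_add[of p q] by (auto simp: mono_ideal_def intro: carr_add)

lemma mono_ideal_mult:
  assumes "\<And>m m'. m \<in> M \<Longrightarrow> m' + m \<in> M" "p \<in> carr V" "q \<in> mono_ideal V M"
  shows "p * q \<in> mono_ideal V M"
  using assms keys_times[of _ p q] by (fastforce simp: mono_ideal_def intro: carr_mult)

lemma mono_ideal_pfilt: "p \<in> mono_ideal V M \<Longrightarrow> pfilt Q p \<in> mono_ideal V M"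
  by (auto simp: mono_ideal_def carr_pfilt keys_pfilt)

lemma minimal_graded_free_resolution_iff:
  "minimal_graded_free_resolution V I b d \<longleftrightarrow>
     b 0 = (\<lambda>j. if j = 0 then 1 else 0) \<and>
     (\<forall>i. \<forall>e \<in> free_basis (b (Suc i)). d (Suc i) e \<in> fmod V (free_basis (b i)) \<and>
        whom mon_degree fst (fst e) (d (Suc i) e) \<and> (\<forall>c. cst (d (Suc i) e) c = 0)) \<and>
     lin_ext (d (Suc 0)) ` fmod V (free_basis (b (Suc 0))) =
       {f \<in> fmod V (free_basis (b 0)). lkp f (0, 0) \<in> I} \<and>
     (\<forall>i. lin_ext (d (Suc (Suc i))) ` fmod V (free_basis (b (Suc (Suc i)))) =
       {f \<in> fmod V (free_basis (b (Suc i))). lin_ext (d (Suc i)) f = 0})"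
proof -
  have all_Suc: "(\<forall>i\<ge>1. P i) \<longleftrightarrow> (\<forall>i. P (Suc i))" for P :: "nat \<Rightarrow> bool"
  proof
    assume *: "\<forall>i. P (Suc i)"
    show "\<forall>i\<ge>1. P i"
    proof (intro allI impI)
      fix i :: nat assume "1 \<le> i"
      then show "P i" using *[THEN spec, of "i - 1"] by simp
    qed
  qed simp
  show ?thesis
    unfolding minimal_graded_free_resolution_def all_Suc
    by (simp add: free_module_eq whom_def cst_def)
qed

lemma free_basis_unit: "free_basis (\<lambda>j. if j = 0 then 1 else 0) = {(0, 0)}"
  by (auto simp: free_basis_def split: if_splits)

text \<open>Minimal generators are chosen repeatedly. Since \<open>0 \<notin> M\<close>, the
  elements of the ideal have no constant term, so its copy in R is an admissible first
  submodule.\<close>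

lemma ex_minimal_graded_free_resolution:
  assumes V: "finite V" and M_0: "0 \<notin> M" and M_add: "\<And>m m'. m \<in> M \<Longrightarrow> m' + m \<in> M"
  shows "\<exists>b d. minimal_graded_free_resolution V (mono_ideal V M :: ('a, 'k::field) mpoly set) b d"
proof -
  let ?I = "mono_ideal V M :: ('a, 'k) mpoly set"
  define b0 :: "nat \<Rightarrow> nat" where "b0 j = (if j = 0 then 1 else 0)" for j
  have b0: "free_basis b0 = {(0, 0)}" unfolding b0_def by (rule free_basis_unit)
  define Z0 where "Z0 = {f \<in> fmod V (free_basis b0). lkp f (0, 0) \<in> ?I}"
  have Z0: "min_submodule V b0 Z0"
  proof
    fix f c assume "f \<in> Z0"
    then have f: "f \<in> free {(0, 0)}" "lkp f (0, 0) \<in> ?I" by (auto simp: Z0_def b0 dest: fmod_free)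
    have "lkp (lkp f (0, 0)) 0 = 0" using f(2) M_0 by (auto simp: mono_ideal_def in_keys_iff)
    then show "cst f c = 0"
      by (subst free_singleton[OF f(1)]) (auto simp: cst_def lookup_single when_def)
  qed (auto simp: Z0_def V lookup_add lookup_wcomp
      intro: fmod_add fmod_scale fmod_wcomp mono_ideal_add mono_ideal_mult M_add mono_ideal_pfilt)
  \<comment> \<open>A state consists of the ranks of one free module and the submodule of it that
    the next differential has to cover.\<close>
  define P where "P i s \<longleftrightarrow> (i = 0 \<longrightarrow> s = (b0, Z0)) \<and> min_submodule V (fst s) (snd s)"
    for i :: nat and s :: "(nat \<Rightarrow> nat) \<times> (nat \<times> nat \<Rightarrow>\<^sub>0 ('a, 'k) mpoly) set"
  define R where "R s s' d \<longleftrightarrow>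
      (\<forall>e\<in>free_basis (fst s'). d e \<in> snd s \<and> dhom (fst e) (d e)) \<and>
      lin_ext d ` fmod V (free_basis (fst s')) = snd s \<and>
      snd s' = {f \<in> fmod V (free_basis (fst s')). lin_ext d f = 0}"
    for s s' :: "(nat \<Rightarrow> nat) \<times> (nat \<times> nat \<Rightarrow>\<^sub>0 ('a, 'k) mpoly) set" and d
  have "\<exists>s. \<forall>i. P i (s i) \<and> (\<exists>d. R (s i) (s (Suc i)) d)"
  proof (rule dependent_nat_choice)
    show "\<exists>s. P 0 s" using Z0 by (intro exI[of _ "(b0, Z0)"]) (simp add: P_def)
  next
    fix s i assume "P i s"
    then interpret min_submodule V "fst s" "snd s" by (simp add: P_def)
    obtain n' d where d: "\<forall>e\<in>free_basis n'. d e \<in> snd s \<and> dhom (fst e) (d e)"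
      "lin_ext d ` fmod V (free_basis n') = snd s"
      "\<forall>f\<in>fmod V (free_basis n'). lin_ext d f = 0 \<longrightarrow> (\<forall>c. cst f c = 0)"
      using ex_minimal_generators by blast
    let ?s' = "(n', {f \<in> fmod V (free_basis n'). lin_ext d f = 0})"
    have "P (Suc i) ?s'" using kernel_min_submodule[of n' d] d by (simp add: P_def)
    moreover have "R s ?s' d" using d by (simp add: R_def)
    ultimately show "\<exists>s'. P (Suc i) s' \<and> (\<exists>d. R s s' d)" by blast
  qed
  then obtain s where s: "\<And>i. P i (s i)" "\<And>i. \<exists>d. R (s i) (s (Suc i)) d" by blast
  then obtain D where D: "\<And>i. R (s i) (s (Suc i)) (D i)" by metis
  have sub: "min_submodule V (fst (s i)) (snd (s i))" for i using s(1)[of i] by (simp add: P_def)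
  have s0: "s 0 = (b0, Z0)" using s(1)[of 0] by (simp add: P_def)
  \<comment> \<open>\<open>D i\<close> maps position i + 1 to position i, whereas differentials are
    numbered by their source.\<close>
  have "minimal_graded_free_resolution V ?I (\<lambda>i. fst (s i)) (\<lambda>i. D (i - 1))"
    unfolding minimal_graded_free_resolution_iff
  proof (intro conjI allI ballI)
    fix i e assume e: "e \<in> free_basis (fst (s (Suc i)))"
    have De: "D i e \<in> snd (s i)" "dhom (fst e) (D i e)" using D[of i] e by (auto simp: R_def)
    show "D (Suc i - 1) e \<in> fmod V (free_basis (fst (s i)))"
      using De(1) min_submodule.Z_subset[OF sub] by auto
    show "dhom (fst e) (D (Suc i - 1) e)" using De by simp
    show "cst (D (Suc i - 1) e) c = 0" for c using min_submodule.Z_cst[OF sub De(1)] by simp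
  next
    show "lin_ext (D (Suc 0 - 1)) ` fmod V (free_basis (fst (s (Suc 0)))) =
      {f \<in> fmod V (free_basis (fst (s 0))). lkp f (0, 0) \<in> ?I}"
      using D[of 0] by (simp add: R_def s0 Z0_def)
    show "lin_ext (D (Suc (Suc i) - 1)) ` fmod V (free_basis (fst (s (Suc (Suc i))))) =
      {f \<in> fmod V (free_basis (fst (s (Suc i)))). lin_ext (D (Suc i - 1)) f = 0}" for i
      using D[of i] D[of "Suc i"] by (simp add: R_def)
    show "fst (s 0) = (\<lambda>j. if j = 0 then 1 else 0)" by (simp add: s0 b0_def[abs_def])
  qed
  then show ?thesis by blast
qed

section \<open>Extending the set of variables\<close>

text \<open>The factor of a monomial in the variables of \<open>V\<close>. The complementary factor
  \<open>mrest (- V)\<close> is a grading in which all polynomials in the variables of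
  \<open>V\<close> have weight 0.\<close>

definition mrest :: "'a set \<Rightarrow> ('a \<Rightarrow>\<^sub>0 nat) \<Rightarrow> ('a \<Rightarrow>\<^sub>0 nat)" where
  "mrest V = pfilt (\<lambda>v. v \<in> V)"

lemma mrest_add: "mrest V (m + m') = mrest V m + mrest V m'"
  by (simp add: mrest_def pfilt_add)

lemma mrest_id: "keys m \<subseteq> V \<Longrightarrow> mrest V m = m"
  unfolding mrest_def by (rule pfilt_all) auto

lemma mrest_eq_0: "keys m \<subseteq> V \<Longrightarrow> mrest (- V) m = 0"
  unfolding mrest_def by (rule pfilt_none) auto

lemma mrest_mrest_compl: "mrest V (mrest (- V) m) = 0"
  unfolding mrest_def by (rule pfilt_none) (auto simp: keys_pfilt)

lemma mrest_split: "mrest (- V) m + mrest V m = m"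
  by (rule poly_mapping_eqI) (auto simp: mrest_def lookup_add lookup_pfilt when_def)

lemma keys_mrest: "keys (mrest V m) \<subseteq> V"
  by (auto simp: mrest_def keys_pfilt)

text \<open>The large ring is the direct sum of the copies of the ring in \<open>V\<close>
  multiplied by monomials outside \<open>V\<close>. A homogeneous element for this grading lies over
  one copy, and deleting \<open>g\<close> from each of its monomials gives \<open>h\<close>.\<close>

lemma whom_mrest_factor:
  fixes f :: "'b \<Rightarrow>\<^sub>0 ('a, 'k::field) mpoly"
  assumes f: "whom (mrest (- V)) (\<lambda>_. 0) g f"
  shows "\<exists>h\<in>fmod V (keys f). f = scale (single g 1) h"
proof -
  define h where "h = (\<Sum>c\<in>keys f. single c (\<Sum>m\<in>keys (lkp f c). single (mrest V m) (lkp (lkp f c) m)))"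
  have "h \<in> fmod V (keys f)"
    unfolding h_def by (intro fmod_sum fmod_single carr_sum carr_single keys_mrest)
  moreover have "scale (single g 1) h = f"
  proof -
    have "scale (single g 1) h = (\<Sum>c\<in>keys f. single c
        (\<Sum>m\<in>keys (lkp f c). single (g + mrest V m) (lkp (lkp f c) m)))"
      by (simp add: h_def mod.scale_sum_right scale_single sum_distrib_left mult_single)
    also have "\<dots> = (\<Sum>c\<in>keys f. single c (\<Sum>m\<in>keys (lkp f c). single m (lkp (lkp f c) m)))"
    proof (intro sum.cong arg_cong2[where f = single] refl)
      fix c m assume "m \<in> keys (lkp f c)"
      then have "mrest (- V) m = g" using whomD[OF f] by simp
      then show "g + mrest V m = m" using mrest_split[of V m] by simp
    qed
    also have "\<dots> = f" by (simp only: poly_mapping_sum_single[symmetric])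
    finally show ?thesis .
  qed
  ultimately show ?thesis by auto
qed

lemma scale_monom_eq_0:
  assumes "scale (single g (1::'k::field)) f = 0"
  shows "f = 0"
proof (intro poly_mapping_eqI)
  fix c m
  have "lkp (lkp (scale (single g 1) f) c) (g + m) = lkp (lkp f c) m"
    by (simp add: lookup_single_mult)
  then show "lkp (lkp f c) m = lkp (lkp 0 c) m" using assms by simp
qed

text \<open>The differentials have entries in the ring of \<open>V\<close>, so they respect the
  grading by exponents outside \<open>V\<close>. In weight g the complex is the original one
  multiplied by the monomial g, and exactness is checked there.\<close>

lemma min_res_base_change:
  fixes d :: "nat \<Rightarrow> nat \<times> nat \<Rightarrow> (nat \<times> nat \<Rightarrow>\<^sub>0 ('a, 'k::field) mpoly)"
  assumes res: "minimal_graded_free_resolution V (mono_ideal V M) b d"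
    and M_add: "\<And>m m'. m \<in> M \<Longrightarrow> m' + m \<in> M" and M_rest: "\<And>m. m \<in> M \<Longrightarrow> mrest V m \<in> M"
  shows "min_res (mono_ideal UNIV M) (\<lambda>i. free_basis (b i)) fst d (0, 0)"
proof -
  note res' = res[unfolded minimal_graded_free_resolution_iff]
  have b0: "free_basis (b 0) = {(0, 0)}" unfolding conjunct1[OF res'] by (rule free_basis_unit)
  note res_d = bspec[OF spec[OF conjunct1[OF conjunct2[OF res']]]]
  note d_fmod = conjunct1[OF res_d]
  note res_0 = conjunct1[OF conjunct2[OF conjunct2[OF res']]]
  note res_Suc = spec[OF conjunct2[OF conjunct2[OF conjunct2[OF res']]]]
  have one: "single e 1 \<in> fmod V (free_basis n)" if "e \<in> free_basis n" for e n
    using that by (intro fmod_single) (simp_all add: carr_def)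
  let ?W = "\<lambda>g. wcomp (mrest (- V)) (\<lambda>_. 0) g"
  have d_W: "?W g (lin_ext (d (Suc i)) f) = lin_ext (d (Suc i)) (?W g f)"
    if "f \<in> free (free_basis (b (Suc i)))" for i g f
  proof (rule wcomp_lin_ext)
    fix e assume "e \<in> keys f"
    then have "d (Suc i) e \<in> fmod V (free_basis (b i))"
      using that unfolding free_def by (intro d_fmod) blast
    then show "whom (mrest (- V)) (\<lambda>_. 0) 0 (d (Suc i) e)"
      unfolding whom_def using fmod_lookup by (fastforce simp: carr_def intro: mrest_eq_0)
  qed (rule mrest_add)
  \<comment> \<open>A preimage is found weight by weight: pull out the monomial \<open>g\<close>,
    lift over the ring of \<open>V\<close>, multiply back.\<close>
  have surj: "f \<in> lin_ext (d (Suc i)) ` free (free_basis (b (Suc i)))"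
    if lift: "\<And>g h. ?W g f = scale (single g 1) h \<Longrightarrow> h \<in> fmod V (free_basis (b i)) \<Longrightarrow>
      h \<in> lin_ext (d (Suc i)) ` fmod V (free_basis (b (Suc i)))" and f: "f \<in> free (free_basis (b i))" for i f
  proof (rule wcomp_closed)
    fix g
    obtain h where h: "h \<in> fmod V (keys (?W g f))" "?W g f = scale (single g 1) h"
      using whom_mrest_factor[OF whom_wcomp] by blast
    have "h \<in> fmod V (free_basis (b i))"
      using h(1) wcomp_free[OF f, of "mrest (- V)" "\<lambda>_. 0" g] by (auto simp: fmod_def free_def)
    then obtain y where y: "h = lin_ext (d (Suc i)) y" "y \<in> fmod V (free_basis (b (Suc i)))"
      using lift[OF h(2)] by blast
    have "?W g f = lin_ext (d (Suc i)) (scale (single g 1) y)" by (simp add: h(2) y(1) lin_ext_scale)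
    then show "?W g f \<in> lin_ext (d (Suc i)) ` free (free_basis (b (Suc i)))"
      using fmod_free[OF y(2)] by (auto intro!: imageI free_scale)
  next
    show "0 \<in> lin_ext (d (Suc i)) ` free (free_basis (b (Suc i)))"
      by (rule image_eqI[of _ _ 0]) simp_all
  qed (auto simp flip: lin_ext_add intro!: imageI free_add)
  show ?thesis
  proof
    show "free_basis (b 0) = {(0, 0)}" by (rule b0)
    show "fst (0, 0) = (0 :: nat)" by simp
    have "{e \<in> free_basis (b i). fst e = j} \<subseteq> {j} \<times> {..<b i j}" for i j
      by (auto simp: free_basis_def)
    then show "finite {e \<in> free_basis (b i). fst e = j}" for i j
      by (rule finite_subset) simp
    fix i e assume e: "e \<in> free_basis (b (Suc i))"
    show "d (Suc i) e \<in> free (free_basis (b i))" using d_fmod[OF e] by (rule fmod_free)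
    show "dhom (fst e) (d (Suc i) e)" using res_d[OF e] by (rule conjunct1[OF conjunct2])
    show "cst (d (Suc i) e) c = 0" for c using res_d[OF e] by blast
  next
    show "lin_ext (d (Suc 0)) ` free (free_basis (b (Suc 0)))
      = {f \<in> free (free_basis (b 0)). lkp f (0, 0) \<in> mono_ideal UNIV M}" (is "?L = ?R")
    proof (intro equalityI subsetI)
      fix f assume "f \<in> ?L"
      then obtain y where y: "f = lin_ext (d (Suc 0)) y" "y \<in> free (free_basis (b (Suc 0)))" by blast
      have "lin_ext (d (Suc 0)) y \<in> ?R"
      proof (rule lin_ext_in_closed)
        fix e assume "e \<in> keys y"
        then have "e \<in> free_basis (b (Suc 0))" using y by (auto simp: free_def)
        then have "lin_ext (d (Suc 0)) (single e 1) \<in> lin_ext (d (Suc 0)) ` fmod V (free_basis (b (Suc 0)))"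
          by (intro imageI one)
        then have "d (Suc 0) e \<in> {f \<in> fmod V (free_basis (b 0)). lkp f (0, 0) \<in> mono_ideal V M}"
          unfolding res_0 by simp
        then have "d (Suc 0) e \<in> free (free_basis (b 0))" "lkp (d (Suc 0) e) (0, 0) \<in> mono_ideal UNIV M"
          by (auto dest: fmod_free simp: mono_ideal_def carr_UNIV)
        then show "scale (lkp y e) (d (Suc 0) e) \<in> ?R"
          by (simp add: free_scale mono_ideal_mult M_add carr_UNIV)
      qed (auto intro: free_add mono_ideal_add simp: lookup_add)
      then show "f \<in> ?R" by (simp add: y)
    next
      fix f assume f: "f \<in> ?R"
      show "f \<in> ?L"
      proof (rule surj)
        fix g h assume h: "?W g f = scale (single g 1) h" "h \<in> fmod V (free_basis (b 0))"
        have "keys (lkp h (0, 0)) \<subseteq> M"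
        proof
          fix m assume m: "m \<in> keys (lkp h (0, 0))"
          have "keys m \<subseteq> V" using m fmod_lookup[OF h(2)] by (auto simp: carr_def)
          have gm: "g + m \<in> keys (lkp (?W g f) (0, 0))"
            using m by (simp add: h(1) keys_monom_mult)
          then have "g + m \<in> M" using f by (auto simp: lookup_wcomp keys_pfilt mono_ideal_def)
          \<comment> \<open>\<open>g\<close> has no variable in \<open>V\<close>, so restricting
            \<open>g + m\<close> to \<open>V\<close> returns \<open>m\<close>; closure of
            \<open>M\<close> under restriction thus removes the factor \<open>g\<close>.\<close>
          then have "mrest V (g + m) \<in> M" by (rule M_rest)
          moreover have "mrest (- V) (g + m) = g" using whomD[OF whom_wcomp gm] by simp
          then have "mrest V g = 0" using mrest_mrest_compl[of V "g + m"] by simp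
          ultimately show "m \<in> M" using \<open>keys m \<subseteq> V\<close> by (simp add: mrest_add mrest_id)
        qed
        then have "h \<in> {f \<in> fmod V (free_basis (b 0)). lkp f (0, 0) \<in> mono_ideal V M}"
          using h(2) by (simp add: mono_ideal_def fmod_lookup)
        then show "h \<in> lin_ext (d (Suc 0)) ` fmod V (free_basis (b (Suc 0)))" unfolding res_0 .
      qed (use f in simp)
    qed
  next
    fix i
    show "lin_ext (d (Suc (Suc i))) ` free (free_basis (b (Suc (Suc i))))
      = {f \<in> free (free_basis (b (Suc i))). lin_ext (d (Suc i)) f = 0}" (is "?L = ?R")
    proof (intro equalityI subsetI)
      fix f assume "f \<in> ?L"
      then obtain y where y: "f = lin_ext (d (Suc (Suc i))) y" "y \<in> free (free_basis (b (Suc (Suc i))))"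
        by blast
      have "lin_ext (d (Suc (Suc i))) y \<in> ?R"
      proof (rule lin_ext_in_closed)
        fix e assume "e \<in> keys y"
        then have "e \<in> free_basis (b (Suc (Suc i)))" using y by (auto simp: free_def)
        then have "lin_ext (d (Suc (Suc i))) (single e 1)
            \<in> lin_ext (d (Suc (Suc i))) ` fmod V (free_basis (b (Suc (Suc i))))"
          by (intro imageI one)
        then have "d (Suc (Suc i)) e \<in> {f \<in> fmod V (free_basis (b (Suc i))). lin_ext (d (Suc i)) f = 0}"
          unfolding res_Suc by simp
        then show "scale (lkp y e) (d (Suc (Suc i)) e) \<in> ?R"
          by (auto intro!: free_scale dest: fmod_free simp: lin_ext_scale)
      qed (auto intro: free_add simp: lin_ext_add)
      then show "f \<in> ?R" by (simp add: y)
    next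
      fix f assume f: "f \<in> ?R"
      show "f \<in> ?L"
      proof (rule surj)
        fix g h assume h: "?W g f = scale (single g 1) h" "h \<in> fmod V (free_basis (b (Suc i)))"
        have "lin_ext (d (Suc i)) (?W g f) = ?W g (lin_ext (d (Suc i)) f)"
          using f by (intro d_W[symmetric]) simp
        then have "scale (single g 1) (lin_ext (d (Suc i)) h) = 0"
          using f by (simp add: h(1) lin_ext_scale)
        then have "lin_ext (d (Suc i)) h = 0" by (rule scale_monom_eq_0)
        then show "h \<in> lin_ext (d (Suc (Suc i))) ` fmod V (free_basis (b (Suc (Suc i))))"
          unfolding res_Suc using h(2) by simp
      qed (use f in simp)
    qed
  qed
qed

text \<open>Existence over the finite \<open>V\<close> and uniqueness over all variables settle the
  definite description: every minimal resolution over \<open>V\<close> has, after base change, the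
  graded ranks of \<open>res\<close>, whose basis may have any type.\<close>

lemma graded_betti_eq_card:
  fixes M :: "('a \<Rightarrow>\<^sub>0 nat) set"
  assumes V: "finite V" and M_0: "0 \<notin> M" and M_add: "\<And>m m'. m \<in> M \<Longrightarrow> m' + m \<in> M"
    and M_rest: "\<And>m. m \<in> M \<Longrightarrow> mrest V m \<in> M"
    and res: "min_res (mono_ideal UNIV M :: ('a, 'k::field) mpoly set) B v d r"
  shows "graded_betti V (mono_ideal V M :: ('a, 'k) mpoly set) i j = card {e \<in> B i. v e = j}"
proof -
  have eq: "b i j = card {e \<in> B i. v e = j}"
    if "minimal_graded_free_resolution V (mono_ideal V M :: ('a, 'k) mpoly set) b d'" for b d' i j
  proof -
    have "{e \<in> free_basis (b i). fst e = j} = {j} \<times> {..<b i j}" by (auto simp: free_basis_def)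
    then have "b i j = card {e \<in> free_basis (b i). fst e = j}" by simp
    also have "\<dots> = card {e \<in> B i. v e = j}"
      by (rule card_basis_eq[OF min_res_base_change[OF that M_add M_rest] res])
    finally show ?thesis .
  qed
  obtain b d' where b: "minimal_graded_free_resolution V (mono_ideal V M :: ('a, 'k) mpoly set) b d'"
    using ex_minimal_graded_free_resolution[OF V M_0 M_add] by blast
  have "graded_betti V (mono_ideal V M :: ('a, 'k) mpoly set) = b"
    unfolding graded_betti_def
  proof (rule the_equality)
    show "\<exists>d. minimal_graded_free_resolution V (mono_ideal V M :: ('a, 'k) mpoly set) b d"
      using b by blast
    fix b' assume "\<exists>d. minimal_graded_free_resolution V (mono_ideal V M :: ('a, 'k) mpoly set) b' d"
    then obtain d'' where "minimal_graded_free_resolution V (mono_ideal V M :: ('a, 'k) mpoly set) b' d''" ..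
    then show "b' = b" using eq[OF b] eq by (intro ext) simp
  qed
  then show ?thesis using eq[OF b] by simp
qed

section \<open>Edge ideals\<close>

text \<open>The monomials divisible by \<open>\<Prod>v\<in>e. v\<close> for some \<open>e \<in> E\<close>.\<close>

definition div_mons :: "'a set set \<Rightarrow> ('a \<Rightarrow>\<^sub>0 nat) set" where
  "div_mons E = {m. \<exists>e\<in>E. e \<subseteq> keys m}"

lemma keys_add_nat: "keys (m + m') = keys m \<union> keys (m' :: 'a \<Rightarrow>\<^sub>0 nat)"
  by (auto simp: in_keys_iff lookup_add)

lemma div_mons_add: "m \<in> div_mons E \<Longrightarrow> m' + m \<in> div_mons E"
  by (auto simp: div_mons_def keys_add_nat)

lemma div_mons_mrest:
  assumes "\<And>e. e \<in> E \<Longrightarrow> e \<subseteq> V" "m \<in> div_mons E"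
  shows "mrest V m \<in> div_mons E"
proof -
  obtain e where "e \<in> E" "e \<subseteq> keys m" using assms(2) by (auto simp: div_mons_def)
  then have "e \<subseteq> keys (mrest V m)" using assms(1)[of e] by (auto simp: mrest_def keys_pfilt)
  then show ?thesis using \<open>e \<in> E\<close> by (auto simp: div_mons_def)
qed

lemma carr_uminus: "p \<in> carr V \<Longrightarrow> - p \<in> carr V"
  by (simp add: carr_def in_keys_iff)

lemma carr_1: "1 \<in> carr V"
  by (simp add: carr_def)

lemma mpoly_ring_simps [simp]:
  "p \<oplus>\<^bsub>mpoly_ring V\<^esub> q = p + q" "p \<otimes>\<^bsub>mpoly_ring V\<^esub> q = p * q"
  "\<zero>\<^bsub>mpoly_ring V\<^esub> = 0" "\<one>\<^bsub>mpoly_ring V\<^esub> = 1"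
  by (simp_all add: mpoly_ring_def)

lemma ring_mpoly_ring: "ring (mpoly_ring V)"
proof (rule ringI)
  show "abelian_group (mpoly_ring V)"
  proof (rule abelian_groupI)
    fix p assume "p \<in> carrier (mpoly_ring V)"
    then show "\<exists>q\<in>carrier (mpoly_ring V). q \<oplus>\<^bsub>mpoly_ring V\<^esub> p = \<zero>\<^bsub>mpoly_ring V\<^esub>"
      by (intro bexI[of _ "- p"]) (auto simp: carrier_mpoly_ring carr_uminus)
  qed (auto simp: carrier_mpoly_ring add_ac intro: carr_add)
  show "Group.monoid (mpoly_ring V)"
    by (rule monoidI) (auto simp: carrier_mpoly_ring mult_ac carr_mult carr_1)
qed (auto simp: algebra_simps)

text \<open>Because the ends of an edge are distinct, a monomial is divisible by their product as
  soon as both occur in it. So the right side is an ideal containing the generators, and each term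
  of its elements is a multiple of a generator.\<close>

lemma edge_ideal_eq:
  assumes G: "finite_simple_graph G"
  shows "(edge_ideal G :: ('a, 'k::field) mpoly set) = mono_ideal (verts G) (div_mons (edges G))"
    (is "_ = ?J")
proof -
  let ?R = "mpoly_ring (verts G) :: ('a, 'k) mpoly ring"
  let ?S = "{mvar u * mvar v |u v. {u, v} \<in> edges G} :: ('a, 'k) mpoly set"
  have edge: "u \<in> verts G \<and> v \<in> verts G \<and> u \<noteq> v" if "{u, v} \<in> edges G" for u v
    using G that by (auto simp: finite_simple_graph_def)
  have mvar_mult: "mvar u * mvar v = (single (single u 1 + single v 1) 1 :: ('a, 'k) mpoly)" for u v
    by (simp add: mvar_def mult_single)
  have J_ideal: "ideal ?J ?R"
  proof (rule idealI)
    show "ring ?R" by (rule ring_mpoly_ring)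
    show "subgroup ?J (add_monoid ?R)"
    proof (rule group.subgroupI)
      show "Group.group (add_monoid ?R)"
        using abelian_group.a_group[OF ring.is_abelian_group[OF ring_mpoly_ring]] .
      show "?J \<noteq> {}" using mono_ideal_0 by blast
      fix p assume p: "p \<in> ?J"
      then have "- p \<in> ?J" by (simp add: mono_ideal_def carr_uminus in_keys_iff subset_iff)
      moreover have "inv\<^bsub>add_monoid ?R\<^esub> p = - p"
      proof (rule group.inv_equality)
        show "Group.group (add_monoid ?R)"
          using abelian_group.a_group[OF ring.is_abelian_group[OF ring_mpoly_ring]] .
      qed (use p carr_uminus[of p "verts G"] in \<open>auto simp: mono_ideal_def mpoly_ring_def carr_def\<close>)
      ultimately show "inv\<^bsub>add_monoid ?R\<^esub> p \<in> ?J" by simp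
    next
      fix p q assume "p \<in> ?J" "q \<in> ?J"
      then show "p \<otimes>\<^bsub>add_monoid ?R\<^esub> q \<in> ?J"
        using mono_ideal_add by (simp add: mpoly_ring_def)
    qed (auto simp: mono_ideal_def mpoly_ring_def carr_def)
  next
    fix p q assume "p \<in> ?J" "q \<in> carrier ?R"
    then have "q * p \<in> ?J" by (intro mono_ideal_mult div_mons_add) (auto simp: carrier_mpoly_ring)
    then show "q \<otimes>\<^bsub>?R\<^esub> p \<in> ?J" "p \<otimes>\<^bsub>?R\<^esub> q \<in> ?J" by (simp_all add: mpoly_ring_def mult.commute)
  qed
  have S_sub: "?S \<subseteq> ?J"
  proof clarify
    fix u v assume "{u, v} \<in> edges G"
    then show "mvar u * mvar v \<in> ?J"
      unfolding mvar_mult using edge[of u v]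
      by (auto simp: mono_ideal_def carr_def div_mons_def keys_add_nat intro!: bexI[of _ "{u, v}"])
  qed
  have J_sub: "?J \<subseteq> I" if I: "ideal I ?R" and S: "?S \<subseteq> I" for I
  proof
    interpret ideal I ?R by (rule I)
    note a_closed' = additive_subgroup.a_closed[OF is_additive_subgroup]
    fix p assume p: "p \<in> ?J"
    have single_in: "single m (lkp p m) \<in> I" if m: "m \<in> keys p" for m
    proof -
      obtain e where e: "e \<in> edges G" "e \<subseteq> keys m" using p m by (auto simp: mono_ideal_def div_mons_def)
      obtain u v where uv: "e = {u, v}" "u \<noteq> v"
        using G e(1) card_2_iff[of e] by (auto simp: finite_simple_graph_def)
      \<comment> \<open>Subtraction of exponents is truncated; here it is exact because
        \<open>u\<close> and \<open>v\<close> are different and both occur in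
        \<open>m\<close>.\<close>
      let ?m' = "m - (single u 1 + single v 1)"
      have m_eq: "m = ?m' + (single u 1 + single v 1)"
        using e(2) uv
        by (intro poly_mapping_eqI) (auto simp: lookup_add lookup_minus lookup_single when_def in_keys_iff)
      have "keys ?m' \<subseteq> keys m" by (auto simp: in_keys_iff lookup_minus)
      then have "keys ?m' \<subseteq> verts G" using p m by (auto simp: mono_ideal_def carr_def)
      then have c: "single ?m' (lkp p m) \<in> carrier ?R" by (simp add: carrier_mpoly_ring carr_single)
      have "mvar u * mvar v \<in> I" using S e(1) uv(1) by blast
      from I_l_closed[OF this c] have "single ?m' (lkp p m) * (mvar u * mvar v) \<in> I"
        by (simp add: mpoly_ring_def)
      then have "single (?m' + (single u 1 + single v 1)) (lkp p m) \<in> I"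
        unfolding mvar_mult by (simp only: mult_single mult_1_right)
      then show ?thesis using m_eq by simp
    qed
    have sum_in: "sum f A \<in> I" if "\<And>a. a \<in> A \<Longrightarrow> f a \<in> I" for f and A :: "('a \<Rightarrow>\<^sub>0 nat) set"
      using that
    proof (induction A rule: infinite_finite_induct)
      case (insert a A)
      then show ?case using a_closed'[of "f a" "sum f A"] by simp
    qed (use additive_subgroup.zero_closed[OF is_additive_subgroup] in simp_all)
    show "p \<in> I" by (subst poly_mapping_sum_single[of p]) (intro sum_in single_in)
  qed
  show ?thesis
    unfolding edge_ideal_def genideal_def
  proof (rule equalityI)
    show "\<Inter> {I. ideal I ?R \<and> ?S \<subseteq> I} \<subseteq> ?J" using J_ideal S_sub by (intro Inter_lower) simp
    show "?J \<subseteq> \<Inter> {I. ideal I ?R \<and> ?S \<subseteq> I}" using J_sub by (intro Inter_greatest) simp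
  qed
qed

section \<open>The Koszul complex of a set of variables\<close>

lemma cst_scale_mvar: "cst (scale (mvar x) f) c = 0"
proof -
  have "single x (1 :: nat) \<noteq> 0" using mon_degree_single[of x 1] by (auto simp del: mon_degree_single)
  then show ?thesis by (simp add: cst_def lookup_mult_0 mvar_def lookup_single when_def)
qed

lemma whom_scale_mvar:
  "whom mon_degree v j f \<Longrightarrow> whom mon_degree v (Suc j) (scale (mvar x) f)"
  by (rule whom_scale[of mon_degree v j]) (auto simp: mon_degree_add mvar_def)

lemma whom_single_1: "v e = j \<Longrightarrow> whom mon_degree v j (single e 1)"
  by (simp add: whom_def lookup_single when_def)

lemma mono_factor:
  fixes p :: "('a, 'k::field) mpoly"
  assumes "\<And>m. m \<in> keys p \<Longrightarrow> x \<in> keys m"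
  shows "\<exists>q. p = mvar x * q"
proof
  let ?q = "\<Sum>m\<in>keys p. single (m - single x 1) (lkp p m)"
  have "mvar x * ?q = (\<Sum>m\<in>keys p. single (single x 1 + (m - single x 1)) (lkp p m))"
    by (simp add: sum_distrib_left mvar_def mult_single)
  also have "\<dots> = (\<Sum>m\<in>keys p. single m (lkp p m))"
  proof (intro sum.cong arg_cong2[where f = single] refl)
    fix m assume "m \<in> keys p"
    then have "lkp m x \<noteq> 0" using assms by (auto simp: in_keys_iff)
    then show "single x 1 + (m - single x 1) = m"
      by (intro poly_mapping_eqI) (auto simp: lookup_add lookup_minus lookup_single when_def)
  qed
  finally show "p = mvar x * ?q" by (simp only: poly_mapping_sum_single[symmetric])
qed

text \<open>A chain on subsets of \<open>insert y U\<close> is uniquely the sum of a part free of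
  \<open>y\<close> and of \<open>y\<close> wedged in front of another chain without
  \<open>y\<close>. \<open>free_part\<close> and \<open>link_part\<close> read off the two, and
  \<open>ins_vertex\<close> wedges. Placing \<open>y\<close> in front avoids signs that depend on an
  ordering of the vertices.\<close>

definition free_part :: "'a \<Rightarrow> ('a set \<Rightarrow>\<^sub>0 ('a, 'k::field) mpoly) \<Rightarrow> ('a set \<Rightarrow>\<^sub>0 ('a, 'k) mpoly)" where
  "free_part y = lin_ext (\<lambda>T. if y \<in> T then 0 else single T 1)"

definition link_part :: "'a \<Rightarrow> ('a set \<Rightarrow>\<^sub>0 ('a, 'k::field) mpoly) \<Rightarrow> ('a set \<Rightarrow>\<^sub>0 ('a, 'k) mpoly)" where
  "link_part y = lin_ext (\<lambda>T. if y \<in> T then single (T - {y}) 1 else 0)"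

definition ins_vertex :: "'a \<Rightarrow> ('a set \<Rightarrow>\<^sub>0 ('a, 'k::field) mpoly) \<Rightarrow> ('a set \<Rightarrow>\<^sub>0 ('a, 'k) mpoly)" where
  "ins_vertex y = lin_ext (\<lambda>T. single (insert y T) 1)"

lemma part_split: "f = free_part y f + ins_vertex y (link_part y f)"
proof -
  have "free_part y f + ins_vertex y (link_part y f) = lin_ext (\<lambda>T. single T 1) f"
    unfolding free_part_def ins_vertex_def link_part_def lin_ext_lin_ext lin_ext_plus_fun[symmetric]
    by (rule lin_ext_cong) (auto simp: insert_absorb)
  then show ?thesis by (simp add: lin_ext_unit)
qed

lemma lin_ext_zero_fun: "lin_ext (\<lambda>_. 0) f = 0"
  by (simp add: lin_ext_def)

lemma free_part_free:
  assumes "f \<in> free B" "\<And>T. T \<in> B \<Longrightarrow> y \<notin> T"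
  shows "free_part y f = f"
proof -
  have "free_part y f = lin_ext (\<lambda>T. single T 1) f"
    unfolding free_part_def using assms by (intro lin_ext_cong_free[OF assms(1)]) auto
  then show ?thesis by (simp add: lin_ext_unit)
qed

lemma link_part_free:
  assumes "f \<in> free B" "\<And>T. T \<in> B \<Longrightarrow> y \<notin> T"
  shows "link_part y f = 0"
proof -
  have "link_part y f = lin_ext (\<lambda>T. 0) f"
    unfolding link_part_def using assms by (intro lin_ext_cong_free[OF assms(1)]) auto
  then show ?thesis by (simp add: lin_ext_zero_fun)
qed

lemma free_part_ins_vertex: "free_part y (ins_vertex y f) = 0"
  by (simp add: free_part_def ins_vertex_def lin_ext_lin_ext lin_ext_zero_fun)

lemma link_part_ins_vertex:
  assumes "f \<in> free B" "\<And>T. T \<in> B \<Longrightarrow> y \<notin> T"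
  shows "link_part y (ins_vertex y f) = f"
proof -
  have "link_part y (ins_vertex y f) = lin_ext (\<lambda>T. single T 1) f"
    unfolding link_part_def ins_vertex_def lin_ext_lin_ext
    using assms by (intro lin_ext_cong_free[OF assms(1)]) auto
  then show ?thesis by (simp add: lin_ext_unit)
qed

lemma whom_ins_vertex:
  assumes "f \<in> free B" "\<And>T. T \<in> B \<Longrightarrow> y \<notin> T \<and> finite T" "whom mon_degree card j f"
  shows "whom mon_degree card (Suc j) (ins_vertex y f)"
  unfolding ins_vertex_def
proof (rule whom_lin_ext)
  show "whom mon_degree (\<lambda>T. Suc (card T)) (Suc j) f" using assms(3) by (simp add: whom_def)
  show "whom mon_degree card (Suc (card T)) (single (insert y T) 1)" if "T \<in> keys f" for T
    using that assms(1,2) by (intro whom_single_1) (auto simp: free_def)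
qed (rule mon_degree_add)

definition subsets_of_card :: "'a set \<Rightarrow> nat \<Rightarrow> 'a set set" where
  "subsets_of_card U i = {T. T \<subseteq> U \<and> card T = i}"

text \<open>The new complex is the mapping cone of multiplication by \<open>y\<close> on the old
  one; it resolves R/J with J = I + (y) because \<open>y\<close> is regular modulo \<open>I\<close>.
  It sends \<open>a + ins_vertex y b\<close> to
  \<open>d a + y b - ins_vertex y (d b)\<close>.\<close>

lemma min_res_insert:
  fixes I J :: "('a, 'k::field) mpoly set"
  assumes U: "finite U" "y \<notin> U"
    and res: "min_res I (subsets_of_card U) card d {}"
    and regular: "\<And>p. mvar y * p \<in> I \<Longrightarrow> p \<in> I"
    and J: "\<And>p. p \<in> J \<longleftrightarrow> (\<exists>s q. s \<in> I \<and> p = s + mvar y * q)"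
  shows "\<exists>d'. min_res J (subsets_of_card (insert y U)) card d' {}"
proof -
  interpret K: min_res I "subsets_of_card U" card d "{}" by (rule res)
  let ?B = "subsets_of_card U" and ?B' = "subsets_of_card (insert y U)"
  \<comment> \<open>\<open>d 0\<close> is unspecified in a resolution; making it zero lets the
    formula for \<open>d'\<close> cover the singleton of \<open>y\<close> as well.\<close>
  define dd where "dd i = (case i of 0 \<Rightarrow> (\<lambda>_. 0) | Suc _ \<Rightarrow> d i)" for i
  define d' where "d' i T = (if y \<in> T then scale (mvar y) (single (T - {y}) 1) - ins_vertex y (dd (i - 1) (T - {y}))
    else d i T)" for i T
  have B_y: "y \<notin> T \<and> finite T" if "T \<in> ?B i" for T i
    using that U by (auto simp: subsets_of_card_def intro: finite_subset)
  have B_sub: "?B i \<subseteq> ?B' i" for i by (auto simp: subsets_of_card_def)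
  have B'_del: "T - {y} \<in> ?B i" if "T \<in> ?B' (Suc i)" "y \<in> T" for T i
    using that U by (auto simp: subsets_of_card_def)
  have B'_ins: "insert y T \<in> ?B' (Suc i)" if "T \<in> ?B i" for T i
    using that B_y[OF that] by (auto simp: subsets_of_card_def)
  have B'_no: "T \<in> ?B i" if "T \<in> ?B' i" "y \<notin> T" for T i
    using that by (auto simp: subsets_of_card_def)
  have free_sub: "f \<in> free (?B' i)" if "f \<in> free (?B i)" for i and f :: "'a set \<Rightarrow>\<^sub>0 ('a, 'k) mpoly"
    using that B_sub[of i] by (auto simp: free_def)
  have P_free: "free_part y f \<in> free (?B i)" if "f \<in> free (?B' i)" for f :: "'a set \<Rightarrow>\<^sub>0 ('a, 'k) mpoly" and i
    unfolding free_part_def using that by (rule free_lin_ext) (auto intro: free_single B'_no)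
  have Q_free: "link_part y f \<in> free (?B i)" if "f \<in> free (?B' (Suc i))"
    for f :: "'a set \<Rightarrow>\<^sub>0 ('a, 'k) mpoly" and i
    unfolding link_part_def using that by (rule free_lin_ext) (auto intro: free_single B'_del)
  have E_free: "ins_vertex y f \<in> free (?B' (Suc i))" if "f \<in> free (?B i)"
    for f :: "'a set \<Rightarrow>\<^sub>0 ('a, 'k) mpoly" and i
    unfolding ins_vertex_def using that by (rule free_lin_ext) (auto intro: free_single B'_ins)
  have dd_d: "lin_ext (dd i) (lin_ext (d (Suc i)) f) = 0" if "f \<in> free (?B (Suc i))" for f i
    using K.d_cycles[OF that] by (cases i) (auto simp: dd_def lin_ext_zero_fun K.cycles_Suc)
  have dd_free: "dd i T \<in> free (?B (i - 1))" if "T \<in> ?B i" for T i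
    using that K.d_free by (cases i) (auto simp: dd_def)
  have d'_eq: "lin_ext (d' (Suc i)) f = lin_ext (d (Suc i)) (free_part y f)
      + scale (mvar y) (link_part y f) - ins_vertex y (lin_ext (dd i) (link_part y f))" for i f
    unfolding free_part_def ins_vertex_def link_part_def lin_ext_lin_ext lin_ext_plus_fun[symmetric]
      lin_ext_diff_fun[symmetric] lin_ext_scale_fun[symmetric]
    by (rule lin_ext_cong) (auto simp: d'_def ins_vertex_def)
  have parts: "free_part y (a + ins_vertex y b) = a \<and> link_part y (a + ins_vertex y b) = b"
    if "a \<in> free (?B i)" "b \<in> free (?B j)" for a b :: "'a set \<Rightarrow>\<^sub>0 ('a, 'k) mpoly" and i j
  proof -
    have "free_part y (a + ins_vertex y b) = free_part y a + free_part y (ins_vertex y b)"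
      "link_part y (a + ins_vertex y b) = link_part y a + link_part y (ins_vertex y b)"
      by (simp_all add: free_part_def link_part_def lin_ext_add)
    then show ?thesis
      using free_part_free[OF that(1)] link_part_free[OF that(1)] link_part_ins_vertex[OF that(2)] B_y
      by (simp add: free_part_ins_vertex)
  qed
  have d'_ins_vertex: "lin_ext (d' (Suc i)) (a + ins_vertex y b) = lin_ext (d (Suc i)) a + scale (mvar y) b
      - ins_vertex y (lin_ext (dd i) b)" if "a \<in> free (?B (Suc i))" "b \<in> free (?B i)" for a b i
    using d'_eq[of i "a + ins_vertex y b"] parts[OF that] by simp
  have split: "\<exists>a b. a \<in> free (?B (Suc i)) \<and> b \<in> free (?B i) \<and> f = a + ins_vertex y b"
    if "f \<in> free (?B' (Suc i))" for f :: "'a set \<Rightarrow>\<^sub>0 ('a, 'k) mpoly" and i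
    by (intro exI[of _ "free_part y f"] exI[of _ "link_part y f"] conjI P_free[OF that] Q_free[OF that]
        part_split)
  have d'_zero_iff: "lin_ext (d' (Suc i)) (a + ins_vertex y b) = 0 \<longleftrightarrow>
      lin_ext (d (Suc i)) a + scale (mvar y) b = 0 \<and> lin_ext (dd i) b = 0" (is "?l = 0 \<longleftrightarrow> ?p = 0 \<and> ?q = 0")
    if ab: "a \<in> free (?B (Suc i))" "b \<in> free (?B i)" for a b i
  proof
    have p: "?p \<in> free (?B i)" by (intro free_add free_scale ab K.cycles_free[OF K.d_cycles])
    have q: "- ?q \<in> free (?B (i - 1))" by (intro free_uminus free_lin_ext[OF ab(2)] dd_free)
    have eq: "?l = ?p + ins_vertex y (- ?q)" using d'_ins_vertex[OF ab] by (simp add: ins_vertex_def lin_ext_uminus)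
    assume "?l = 0"
    then have "?p + ins_vertex y (- ?q) = 0" using eq by simp
    then have "free_part y 0 = ?p" "link_part y 0 = - ?q" using parts[OF p q] by auto
    then show "?p = 0 \<and> ?q = 0" by (simp add: free_part_def link_part_def)
  next
    assume "?p = 0 \<and> ?q = 0"
    then show "?l = 0" using d'_ins_vertex[OF ab] by (simp add: ins_vertex_def)
  qed
  have "min_res J ?B' card d' {}"
  proof
    show B0: "?B' 0 = {{}}" using U by (auto simp: subsets_of_card_def dest: finite_subset)
    show "card {} = 0" by simp
    have "{e \<in> ?B' i. card e = j} \<subseteq> Pow (insert y U)" for i j by (auto simp: subsets_of_card_def)
    then show "finite {e \<in> ?B' i. card e = j}" for i j by (rule finite_subset) (simp add: U)
    fix i T assume T: "T \<in> ?B' (Suc i)"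
    have T': "T - {y} \<in> ?B i \<and> card T = Suc i \<and> card (T - {y}) = i" if "y \<in> T"
      using B'_del[OF T that] T by (auto simp: subsets_of_card_def)
    show "d' (Suc i) T \<in> free (?B' i)"
    proof (cases "y \<in> T")
      case True
      have "ins_vertex y (dd i (T - {y})) \<in> free (?B' i)"
      proof (cases i)
        case 0
        then show ?thesis by (simp add: dd_def ins_vertex_def)
      next
        case (Suc k)
        then show ?thesis using E_free dd_free[of "T - {y}" i] T'[OF True] by simp
      qed
      then show ?thesis
        using True T' B_sub[of i] by (auto simp: d'_def intro!: free_diff free_scale free_single)
    next
      case False
      then show ?thesis using K.d_free[OF B'_no[OF T]] by (simp add: d'_def free_sub)
    qed
    show "whom mon_degree card (card T) (d' (Suc i) T)"
    proof (cases "y \<in> T")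
      case True
      have "whom mon_degree card (Suc i) (ins_vertex y (dd i (T - {y})))"
      proof (cases i)
        case 0
        then show ?thesis by (simp add: dd_def ins_vertex_def)
      next
        case (Suc k)
        then have "T - {y} \<in> ?B (Suc k)" using T' True by simp
        then show ?thesis
          using K.d_free[of "T - {y}" k] K.d_hom[of "T - {y}" k] B_y T' True Suc
          by (intro whom_ins_vertex[of _ "?B k"]) (auto simp: dd_def)
      qed
      moreover have "whom mon_degree card (Suc i) (scale (mvar y) (single (T - {y}) 1))"
        using T' True by (intro whom_scale_mvar whom_single_1) simp
      ultimately show ?thesis using T' True by (auto simp: d'_def intro!: whom_diff)
    next
      case False
      then show ?thesis using K.d_hom[OF B'_no[OF T]] by (simp add: d'_def)
    qed
    show "cst (d' (Suc i) T) c = 0" for c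
    proof (cases "y \<in> T")
      case True
      have "cst (ins_vertex y (dd i (T - {y}))) c = 0"
        unfolding ins_vertex_def
      proof (intro cst_lin_ext_minimal disjI1)
        fix e
        show "cst (dd i (T - {y})) e = 0"
          using K.d_min[of "T - {y}"] T' True by (cases i) (auto simp: dd_def)
      qed
      then show ?thesis using True by (simp add: d'_def cst_diff cst_scale_mvar)
    next
      case False
      then show ?thesis using K.d_min[OF B'_no[OF T]] by (simp add: d'_def)
    qed
  next
    have B0: "?B' 0 = {{}}" using U by (auto simp: subsets_of_card_def dest: finite_subset)
    show "lin_ext (d' (Suc 0)) ` free (?B' (Suc 0)) = {f \<in> free (?B' 0). lkp f {} \<in> J}" (is "?L = ?R")
    proof (intro equalityI subsetI)
      fix f assume "f \<in> ?L"
      then obtain a b where ab: "a \<in> free (?B (Suc 0))" "b \<in> free (?B 0)" "f = lin_ext (d' (Suc 0)) (a + ins_vertex y b)"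
        using split by blast
      have f: "f = lin_ext (d (Suc 0)) a + scale (mvar y) b"
        using ab d'_ins_vertex[OF ab(1,2)] by (simp add: dd_def lin_ext_zero_fun ins_vertex_def)
      have c: "lin_ext (d (Suc 0)) a \<in> K.cycles 0" using ab(1) by (rule K.d_cycles)
      then have "lkp (lin_ext (d (Suc 0)) a) {} \<in> I" by (simp add: K.cycles_0)
      then have "lkp f {} \<in> J" unfolding J f by (auto simp: lookup_add)
      moreover have "f \<in> free (?B' 0)"
        unfolding f using c ab(2) by (intro free_add free_scale free_sub) (auto simp: K.cycles_0)
      ultimately show "f \<in> ?R" by simp
    next
      fix f assume f: "f \<in> ?R"
      then obtain s q where sq: "s \<in> I" "lkp f {} = s + mvar y * q" by (auto simp: J)
      have "single {} s \<in> K.cycles 0" using sq(1) K.ideal_iff by simp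
      then obtain a where a: "a \<in> free (?B (Suc 0))" "lin_ext (d (Suc 0)) a = single {} s"
        using K.cycles_lift by blast
      have b: "single {} q \<in> free (?B 0)" by (simp add: K.B_0 free_single)
      have "f = single {} (lkp f {})" using f B0 by (intro free_singleton) simp
      also have "\<dots> = lin_ext (d' (Suc 0)) (a + ins_vertex y (single {} q))"
        using d'_ins_vertex[OF a(1) b] a(2)
        by (simp add: sq(2) single_add scale_single dd_def lin_ext_zero_fun ins_vertex_def)
      finally show "f \<in> ?L" by (rule image_eqI) (intro free_add free_sub[OF a(1)] E_free[OF b])
    qed
  next
    fix i
    show "lin_ext (d' (Suc (Suc i))) ` free (?B' (Suc (Suc i))) =
      {f \<in> free (?B' (Suc i)). lin_ext (d' (Suc i)) f = 0}" (is "?L = ?R")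
    proof (intro equalityI subsetI)
      fix f assume "f \<in> ?L"
      then obtain a b where ab: "a \<in> free (?B (Suc (Suc i)))" "b \<in> free (?B (Suc i))"
          "f = lin_ext (d' (Suc (Suc i))) (a + ins_vertex y b)"
        using split by blast
      let ?p = "lin_ext (d (Suc (Suc i))) a + scale (mvar y) b" and ?q = "- lin_ext (d (Suc i)) b"
      have f: "f = ?p + ins_vertex y ?q"
        using ab d'_ins_vertex[OF ab(1,2)] by (simp add: dd_def ins_vertex_def lin_ext_uminus)
      have a: "lin_ext (d (Suc (Suc i))) a \<in> K.cycles (Suc i)" using ab(1) by (rule K.d_cycles)
      have p: "?p \<in> free (?B (Suc i))"
        using K.cycles_free[OF a] ab(2) by (intro free_add free_scale)
      have q: "?q \<in> free (?B i)" using ab(2) by (intro free_uminus K.cycles_free[OF K.d_cycles])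
      have "lin_ext (d' (Suc i)) f = 0"
        unfolding f d'_zero_iff[OF p q]
        using a dd_d[OF ab(2)] by (simp add: lin_ext_add lin_ext_scale lin_ext_uminus K.cycles_Suc)
      then show "f \<in> ?R" using p q unfolding f by (auto intro: free_add free_sub E_free)
    next
      fix f assume f: "f \<in> ?R"
      then obtain a b where ab: "a \<in> free (?B (Suc i))" "b \<in> free (?B i)" "f = a + ins_vertex y b"
        using split by blast
      then have eqs: "lin_ext (d (Suc i)) a + scale (mvar y) b = 0" "lin_ext (dd i) b = 0"
        using f d'_zero_iff[OF ab(1,2)] by auto
      \<comment> \<open>At the bottom this is regularity: y b is a boundary, so its entry lies in
        \<open>I\<close>, and hence so does the entry of \<open>b\<close>. Higher up it is the
        second equation.\<close>
      have "b \<in> K.cycles i"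
      proof (cases i)
        case 0
        have "lin_ext (d (Suc 0)) (- a) \<in> K.cycles 0"
          using ab(1) 0 by (intro K.d_cycles free_uminus) simp
        moreover have "lin_ext (d (Suc 0)) (- a) = scale (mvar y) b"
          using minus_unique[OF eqs(1)] 0 by (simp add: lin_ext_uminus)
        ultimately have "lkp b {} \<in> I" by (auto simp: K.cycles_0 intro: regular)
        then show ?thesis using ab(2) 0 by (simp add: K.cycles_0)
      next
        case (Suc k)
        then show ?thesis using eqs(2) ab(2) by (simp add: K.cycles_Suc dd_def)
      qed
      then obtain b' where b': "b' \<in> free (?B (Suc i))" "lin_ext (d (Suc i)) b' = b"
        using K.cycles_lift by blast
      have "a + scale (mvar y) b' \<in> K.cycles (Suc i)"
        using ab(1) b' eqs(1) by (simp add: K.cycles_Suc free_add free_scale lin_ext_add lin_ext_scale)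
      then obtain a' where a': "a' \<in> free (?B (Suc (Suc i)))"
          "lin_ext (d (Suc (Suc i))) a' = a + scale (mvar y) b'"
        using K.cycles_lift by blast
      have nb: "- b' \<in> free (?B (Suc i))" using b'(1) by (rule free_uminus)
      \<comment> \<open>In the differential of this preimage the terms y b' cancel, and the wedged
        part returns \<open>b\<close>.\<close>
      have "lin_ext (d' (Suc (Suc i))) (a' + ins_vertex y (- b')) = f"
        using d'_ins_vertex[OF a'(1) nb] a'(2) b'(2) ab(3) by (simp add: dd_def lin_ext_uminus ins_vertex_def)
      moreover have "a' + ins_vertex y (- b') \<in> free (?B' (Suc (Suc i)))"
        using a'(1) nb by (intro free_add free_sub E_free)
      ultimately show "f \<in> ?L" by blast
    qed
  qed
  then show ?thesis by blast
qed

text \<open>Induction on \<open>U\<close>: a new variable is regular modulo the ideal of the earlier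
  ones. A subset of size i has degree i, so this resolution is linear.\<close>

lemma ex_koszul:
  assumes "finite U"
  shows "\<exists>d. min_res (mono_ideal UNIV (div_mons ((\<lambda>u. {u}) ` U)) :: ('a, 'k::field) mpoly set)
    (subsets_of_card U) card d {}"
  using assms
proof (induction U)
  case empty
  have B: "subsets_of_card {} i = (if i = 0 then {{}} else {})" for i :: nat
    by (auto simp: subsets_of_card_def)
  have F0: "free ({} :: 'a set set) = {0 :: 'a set \<Rightarrow>\<^sub>0 ('a, 'k) mpoly}" by (auto simp: free_def)
  have F1: "f = 0" if "f \<in> free {{}}" "lkp f {} = 0" for f :: "'a set \<Rightarrow>\<^sub>0 ('a, 'k) mpoly"
    using free_singleton[OF that(1)] that(2) by simp
  have "min_res (mono_ideal UNIV {} :: ('a, 'k) mpoly set) (subsets_of_card ({} :: 'a set)) card (\<lambda>_ _. 0) {}"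
    by unfold_locales (auto simp: B F0 mono_ideal_def carr_UNIV dest: F1)
  then show ?case by (auto simp: div_mons_def)
next
  case (insert y U)
  let ?I = "\<lambda>U. mono_ideal UNIV (div_mons ((\<lambda>u. {u}) ` U)) :: ('a, 'k) mpoly set"
  have M: "m \<in> div_mons ((\<lambda>u. {u}) ` U) \<longleftrightarrow> (\<exists>u\<in>U. u \<in> keys m)" for m and U :: "'a set"
    by (auto simp: div_mons_def)
  obtain d where d: "min_res (?I U) (subsets_of_card U) card d {}" using insert.IH by blast
  show ?case
  proof (rule min_res_insert[OF insert.hyps d])
    fix p assume "mvar y * p \<in> ?I U"
    then show "p \<in> ?I U"
      using insert.hyps
      by (auto simp: mono_ideal_def carr_UNIV mvar_def keys_monom_mult M keys_add_nat image_subset_iff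
          split: if_splits dest!: bspec)
  next
    fix p
    show "p \<in> ?I (insert y U) \<longleftrightarrow> (\<exists>s q. s \<in> ?I U \<and> p = s + mvar y * q)"
    proof
      assume p: "p \<in> ?I (insert y U)"
      let ?Q = "\<lambda>m. m \<in> div_mons ((\<lambda>u. {u}) ` U)"
      have "y \<in> keys m" if "m \<in> keys (pfilt (\<lambda>m. \<not> ?Q m) p)" for m
        using that p by (auto simp: keys_pfilt mono_ideal_def M subset_iff simp del: image_insert)
      then have "\<exists>q. pfilt (\<lambda>m. \<not> ?Q m) p = mvar y * q" by (rule mono_factor)
      then obtain q where q: "pfilt (\<lambda>m. \<not> ?Q m) p = mvar y * q" by blast
      have "p = pfilt ?Q p + mvar y * q" by (rule pfilt_split[of p ?Q, unfolded q])
      moreover have "pfilt ?Q p \<in> ?I U" by (auto simp: mono_ideal_def carr_UNIV keys_pfilt)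
      ultimately show "\<exists>s q. s \<in> ?I U \<and> p = s + mvar y * q" by blast
    next
      assume "\<exists>s q. s \<in> ?I U \<and> p = s + mvar y * q"
      then obtain s q where p: "s \<in> ?I U" "p = s + mvar y * q" by blast
      have "s \<in> ?I (insert y U)" using p(1) by (auto simp: mono_ideal_def M subset_iff simp del: image_insert)
      moreover have "mvar y * q \<in> ?I (insert y U)"
        by (auto simp: mono_ideal_def carr_UNIV mvar_def keys_monom_mult M keys_add_nat simp del: image_insert)
      ultimately show "p \<in> ?I (insert y U)" unfolding p(2) by (rule mono_ideal_add)
    qed
  qed
qed

section \<open>The resolution of a cone\<close>

text \<open>The mapping cone has the summands F_(n-1)(-1), K_n(-1) and F_n; the free module on the
  disjoint union of their bases is handled through triples.\<close>

abbreviation sum3 :: "'b set \<Rightarrow> 'c set \<Rightarrow> 'e set \<Rightarrow> ('b + ('c + 'e)) set" where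
  "sum3 A B C \<equiv> Sum_Type.Plus A (Sum_Type.Plus B C)"

definition inj1 :: "('b \<Rightarrow>\<^sub>0 ('a, 'k::field) mpoly) \<Rightarrow> ('b + ('c + 'e) \<Rightarrow>\<^sub>0 ('a, 'k) mpoly)" where
  "inj1 = lin_ext (\<lambda>e. single (Inl e) 1)"

definition inj2 :: "('c \<Rightarrow>\<^sub>0 ('a, 'k::field) mpoly) \<Rightarrow> ('b + ('c + 'e) \<Rightarrow>\<^sub>0 ('a, 'k) mpoly)" where
  "inj2 = lin_ext (\<lambda>e. single (Inr (Inl e)) 1)"

definition inj3 :: "('e \<Rightarrow>\<^sub>0 ('a, 'k::field) mpoly) \<Rightarrow> ('b + ('c + 'e) \<Rightarrow>\<^sub>0 ('a, 'k) mpoly)" where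
  "inj3 = lin_ext (\<lambda>e. single (Inr (Inr e)) 1)"

definition triple :: "('b \<Rightarrow>\<^sub>0 ('a, 'k::field) mpoly) \<Rightarrow> ('c \<Rightarrow>\<^sub>0 ('a, 'k) mpoly) \<Rightarrow> ('e \<Rightarrow>\<^sub>0 ('a, 'k) mpoly)
    \<Rightarrow> ('b + ('c + 'e) \<Rightarrow>\<^sub>0 ('a, 'k) mpoly)" where
  "triple a b c = inj1 a + (inj2 b + inj3 c)"

definition prj1 :: "('b + ('c + 'e) \<Rightarrow>\<^sub>0 ('a, 'k::field) mpoly) \<Rightarrow> ('b \<Rightarrow>\<^sub>0 ('a, 'k) mpoly)" where
  "prj1 = lin_ext (case_sum (\<lambda>e. single e 1) (\<lambda>_. 0))"

definition prj2 :: "('b + ('c + 'e) \<Rightarrow>\<^sub>0 ('a, 'k::field) mpoly) \<Rightarrow> ('c \<Rightarrow>\<^sub>0 ('a, 'k) mpoly)" where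
  "prj2 = lin_ext (case_sum (\<lambda>_. 0) (case_sum (\<lambda>e. single e 1) (\<lambda>_. 0)))"

definition prj3 :: "('b + ('c + 'e) \<Rightarrow>\<^sub>0 ('a, 'k::field) mpoly) \<Rightarrow> ('e \<Rightarrow>\<^sub>0 ('a, 'k) mpoly)" where
  "prj3 = lin_ext (case_sum (\<lambda>_. 0) (case_sum (\<lambda>_. 0) (\<lambda>e. single e 1)))"

lemma prj_triple [simp]:
  "prj1 (triple a b c) = a" "prj2 (triple a b c) = b" "prj3 (triple a b c) = c"
  by (simp_all add: prj1_def prj2_def prj3_def triple_def inj1_def inj2_def inj3_def lin_ext_add
      lin_ext_lin_ext lin_ext_unit lin_ext_zero_fun)

lemma triple_prj: "triple (prj1 f) (prj2 f) (prj3 f) = f"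
proof -
  have "triple (prj1 f) (prj2 f) (prj3 f) = lin_ext (\<lambda>e. single e 1) f"
    unfolding triple_def prj1_def prj2_def prj3_def inj1_def inj2_def inj3_def lin_ext_lin_ext
      lin_ext_plus_fun[symmetric]
    by (rule lin_ext_cong) (auto split: sum.split)
  then show ?thesis by (simp add: lin_ext_unit)
qed

lemma triple_eq_iff: "triple a b c = triple a' b' c' \<longleftrightarrow> a = a' \<and> b = b' \<and> c = c'"
  by (metis prj_triple)

lemma triple_0: "triple 0 0 0 = 0"
  by (simp add: triple_def inj1_def inj2_def inj3_def)

lemma triple_eq_0_iff: "triple a b c = 0 \<longleftrightarrow> a = 0 \<and> b = 0 \<and> c = 0"
  unfolding triple_0[symmetric] triple_eq_iff ..

lemma inj_free:
  "a \<in> free A \<Longrightarrow> inj1 a \<in> free (sum3 A B C)"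
  "b \<in> free B \<Longrightarrow> inj2 b \<in> free (sum3 A B C)"
  "c \<in> free C \<Longrightarrow> inj3 c \<in> free (sum3 A B C)"
  unfolding inj1_def inj2_def inj3_def by (auto intro!: free_single elim!: free_lin_ext)

lemma triple_free:
  "a \<in> free A \<Longrightarrow> b \<in> free B \<Longrightarrow> c \<in> free C \<Longrightarrow> triple a b c \<in> free (sum3 A B C)"
  unfolding triple_def by (intro free_add inj_free)

lemma prj_free:
  assumes "f \<in> free (sum3 A B C)"
  shows "prj1 f \<in> free A" "prj2 f \<in> free B" "prj3 f \<in> free C"
  unfolding prj1_def prj2_def prj3_def
  by (rule free_lin_ext[OF assms]; auto simp: free_single)+

lemma triple_cases:
  assumes "f \<in> free (sum3 A B C)"
  obtains a b c where "f = triple a b c" "a \<in> free A" "b \<in> free B" "c \<in> free C"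
  using triple_prj[of f] prj_free[OF assms] by metis

lemma cst_uminus: "cst (- f) c = - cst f c"
  by (simp add: cst_def)

lemma cst_triple:
  assumes "\<And>e. cst a e = 0" "\<And>e. cst b e = 0" "\<And>e. cst c e = 0"
  shows "cst (triple a b c) e = 0"
  unfolding triple_def inj1_def inj2_def inj3_def cst_add
  by (simp add: cst_lin_ext_minimal assms)

lemma whom_triple:
  assumes "whom mon_degree (\<lambda>e. w (Inl e)) j a" "whom mon_degree (\<lambda>e. w (Inr (Inl e))) j b"
    "whom mon_degree (\<lambda>e. w (Inr (Inr e))) j c"
  shows "whom mon_degree w j (triple a b c)"
  unfolding triple_def inj1_def inj2_def inj3_def
  by (intro whom_add whom_lin_ext[OF mon_degree_add whom_single_1[OF refl]] assms)

lemma whom_Suc: "whom mon_degree v j f \<Longrightarrow> whom mon_degree (\<lambda>e. Suc (v e)) (Suc j) f"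
  by (simp add: whom_def)

lemma scale_mvar_eq_0: "scale (mvar x :: ('a, 'k::field) mpoly) f = 0 \<Longrightarrow> f = 0"
  unfolding mvar_def by (rule scale_monom_eq_0)

text \<open>In the application \<open>I\<close> is I(H), \<open>J\<close> is generated by the cover,
  and \<open>L\<close> = I + xJ is I(G). The two degree conditions keep units out of the comparison
  map in positive positions.\<close>

locale cone_res = min_res_pair I B v d r J B' v' d' r'
  for I :: "('a, 'k::field) mpoly set" and B :: "nat \<Rightarrow> 'b set" and v d r
    and J :: "('a, 'k) mpoly set" and B' :: "nat \<Rightarrow> 'c set" and v' d' r' +
  fixes x :: 'a and L :: "('a, 'k) mpoly set"
  assumes regular: "mvar x * p \<in> I \<Longrightarrow> p \<in> I"
    and L_iff: "p \<in> L \<longleftrightarrow> (\<exists>s\<in>I. \<exists>q\<in>J. p = s + mvar x * q)"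
    and v_gt: "e \<in> B (Suc i) \<Longrightarrow> v e > Suc i"
    and v'_eq: "c \<in> B' i \<Longrightarrow> v' c = i"
begin

text \<open>Missing are F_0(-1) in position 1 and K_0(-1) in position 0, which cancel because the
  unit entry maps one isomorphically to the other. \<open>cone_deg\<close> adds one on both twisted
  summands.\<close>

definition cone_basis :: "nat \<Rightarrow> ('b + ('c + 'b)) set" where
  "cone_basis n = sum3 (if n \<le> 1 then {} else B (n - 1)) (if n = 0 then {} else B' n) (B n)"

definition cone_deg :: "'b + ('c + 'b) \<Rightarrow> nat" where
  "cone_deg = case_sum (\<lambda>e. Suc (v e)) (case_sum (\<lambda>e. Suc (v' e)) v)"

definition \<phi> :: "nat \<Rightarrow> 'b \<Rightarrow> ('c \<Rightarrow>\<^sub>0 ('a, 'k) mpoly)" where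
  "\<phi> = (SOME \<phi>. chain_map \<phi>)"

lemma \<phi>: "chain_map \<phi>"
  unfolding \<phi>_def using ex_chain_map by (rule someI_ex)

text \<open>The differential of the first summand once F_0(-1) has been cancelled, so that the
  values of \<open>d 1\<close> are dropped.\<close>

definition dd :: "nat \<Rightarrow> 'b \<Rightarrow> ('b \<Rightarrow>\<^sub>0 ('a, 'k) mpoly)" where
  "dd k = (if k \<le> 1 then (\<lambda>_. 0) else d k)"

text \<open>The inverse of \<open>\<phi> 0\<close>. Eliminating that unit entry creates a new entry
  from K_1(-1) to F_0, namely x times \<open>\<tau>\<close> after \<open>d' 1\<close>: the case n =
  1 in \<open>cone_d\<close>.\<close>

definition \<tau> :: "('c \<Rightarrow>\<^sub>0 ('a, 'k) mpoly) \<Rightarrow> ('b \<Rightarrow>\<^sub>0 ('a, 'k) mpoly)" where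
  "\<tau> = lin_ext (\<lambda>_. single r 1)"

text \<open>The mapping cone of \<open>(\<phi>, x) : F(-1) \<rightarrow> K(-1) \<oplus> F\<close>, where \<open>F\<close> and \<open>K\<close> resolve
  \<open>R/I\<close> and \<open>R/J\<close>, after cancelling the unit entry \<open>\<phi>\<^sub>0\<close>.\<close>

definition cone_d :: "nat \<Rightarrow> 'b + ('c + 'b) \<Rightarrow> ('b + ('c + 'b) \<Rightarrow>\<^sub>0 ('a, 'k) mpoly)" where
  "cone_d n = case_sum
     (\<lambda>e. triple (- dd (n - 1) e) (- \<phi> (n - 1) e) (scale (mvar x) (single e 1)))
     (case_sum
       (\<lambda>e. if n = 1 then triple 0 0 (scale (mvar x) (\<tau> (d' n e))) else triple 0 (d' n e) 0)
       (\<lambda>e. triple 0 0 (d n e)))"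

lemma basis_0: "cone_basis 0 = sum3 {} {} {r}"
  by (simp add: cone_basis_def F.B_0)

lemma basis_1: "cone_basis (Suc 0) = sum3 {} (B' (Suc 0)) (B (Suc 0))"
  by (simp add: cone_basis_def)

lemma basis_Suc: "cone_basis (Suc (Suc i)) = sum3 (B (Suc i)) (B' (Suc (Suc i))) (B (Suc (Suc i)))"
  by (simp add: cone_basis_def)

lemma free_empty: "f \<in> free {} \<longleftrightarrow> f = 0"
  by (auto simp: free_def)

lemma cone_d_triple: "lin_ext (cone_d (Suc (Suc i))) (triple a b c) =
  triple (- lin_ext (dd (Suc i)) a) (lin_ext (d' (Suc (Suc i))) b - lin_ext (\<phi> (Suc i)) a)
    (scale (mvar x) a + lin_ext (d (Suc (Suc i))) c)"
  by (simp add: cone_d_def triple_def inj1_def inj2_def inj3_def lin_ext_add lin_ext_diff lin_ext_lin_ext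
      lin_ext_plus_fun lin_ext_diff_fun lin_ext_uminus lin_ext_uminus_fun lin_ext_scale lin_ext_scale_fun)

lemma cone_d_triple_1: "lin_ext (cone_d (Suc 0)) (triple 0 b c) =
  triple 0 0 (lin_ext (d (Suc 0)) c + scale (mvar x) (\<tau> (lin_ext (d' (Suc 0)) b)))"
  by (simp add: cone_d_def triple_def inj1_def inj2_def inj3_def lin_ext_add lin_ext_lin_ext \<tau>_def
      lin_ext_plus_fun lin_ext_scale lin_ext_scale_fun)

lemma \<tau>_eq: "f \<in> free (B' 0) \<Longrightarrow> \<tau> f = single r (lkp f r')"
proof -
  assume "f \<in> free (B' 0)"
  then have "f = single r' (lkp f r')" by (intro free_singleton) (simp add: F'.B_0)
  then have "\<tau> f = \<tau> (single r' (lkp f r'))" by simp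
  then show ?thesis by (simp add: \<tau>_def scale_single)
qed

lemma \<tau>_\<phi>: "f \<in> free (B 0) \<Longrightarrow> \<tau> (lin_ext (\<phi> 0) f) = f"
proof -
  assume f: "f \<in> free (B 0)"
  have "\<tau> (lin_ext (\<phi> 0) f) = lin_ext (\<lambda>e. single e 1) f"
    unfolding \<tau>_def lin_ext_lin_ext
    using \<phi> by (intro lin_ext_cong_free[OF f]) (auto simp: F.B_0 chain_map_def)
  then show ?thesis by (simp add: lin_ext_unit)
qed

lemma \<phi>_\<tau>: "f \<in> free (B' 0) \<Longrightarrow> lin_ext (\<phi> 0) (\<tau> f) = f"
proof -
  assume f: "f \<in> free (B' 0)"
  have "lin_ext (\<phi> 0) (\<tau> f) = lin_ext (\<lambda>e. single e 1) f"
    unfolding \<tau>_def lin_ext_lin_ext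
    using \<phi> by (intro lin_ext_cong_free[OF f]) (auto simp: F'.B_0 chain_map_def)
  then show ?thesis by (simp add: lin_ext_unit)
qed

lemma \<tau>_free: "\<tau> f \<in> free (B 0)"
  unfolding \<tau>_def by (rule free_lin_ext[of _ UNIV]) (auto simp: free_def F.B_0)

lemma dd_free: "a \<in> free (B (Suc i)) \<Longrightarrow> lin_ext (dd (Suc i)) a \<in> free (if i = 0 then {} else B i)"
  by (auto simp: dd_def lin_ext_zero_fun intro: free_lin_ext F.d_free)

lemma dd_d: "a \<in> free (B (Suc (Suc i))) \<Longrightarrow> lin_ext (dd (Suc i)) (lin_ext (d (Suc (Suc i))) a) = 0"
  using F.d_cycles[of a "Suc i"] by (auto simp: dd_def lin_ext_zero_fun F.cycles_Suc)

lemma cone_d_Suc_cases: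
  assumes "f \<in> lin_ext (cone_d (Suc (Suc i))) ` free (cone_basis (Suc (Suc i)))"
  obtains a b c where "a \<in> free (B (Suc i))" "b \<in> free (B' (Suc (Suc i)))" "c \<in> free (B (Suc (Suc i)))"
    "f = triple (- lin_ext (dd (Suc i)) a) (lin_ext (d' (Suc (Suc i))) b - lin_ext (\<phi> (Suc i)) a)
      (scale (mvar x) a + lin_ext (d (Suc (Suc i))) c)"
proof -
  obtain g where g: "g \<in> free (cone_basis (Suc (Suc i)))" "f = lin_ext (cone_d (Suc (Suc i))) g"
    using assms by blast
  obtain a b c where "g = triple a b c" "a \<in> free (B (Suc i))" "b \<in> free (B' (Suc (Suc i)))"
      "c \<in> free (B (Suc (Suc i)))"
    using g(1) unfolding basis_Suc by (rule triple_cases)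
  then show ?thesis using that g(2) cone_d_triple by blast
qed

text \<open>The common lifting step for exactness in positions 1 and above. The two equations make b
  - \<phi> a' and c + x a' cycles, hence boundaries of some b' and c', and (-a', b', c') is the
  preimage. For i = 0 the first entry vanishes with \<open>dd\<close>.\<close>

lemma cone_lift:
  assumes a': "a' \<in> free (B (Suc i))" and b: "b \<in> free (B' (Suc i))" and c: "c \<in> free (B (Suc i))"
    and b_eq: "lin_ext (d' (Suc i)) b = lin_ext (\<phi> i) (lin_ext (d (Suc i)) a')"
    and c_eq: "lin_ext (d (Suc i)) c + scale (mvar x) (lin_ext (d (Suc i)) a') = 0"
  shows "triple (lin_ext (dd (Suc i)) a') b c
    \<in> lin_ext (cone_d (Suc (Suc i))) ` free (cone_basis (Suc (Suc i)))"
proof -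
  have "b - lin_ext (\<phi> (Suc i)) a' \<in> F'.cycles (Suc i)"
    using a' b b_eq chain_map_free[OF \<phi> a'] chain_map_d[OF \<phi> a']
    by (simp add: F'.cycles_Suc free_diff lin_ext_diff)
  then obtain b' where b': "b' \<in> free (B' (Suc (Suc i)))"
      "lin_ext (d' (Suc (Suc i))) b' = b - lin_ext (\<phi> (Suc i)) a'"
    using F'.cycles_lift by blast
  have "c + scale (mvar x) a' \<in> F.cycles (Suc i)"
    using a' c c_eq by (simp add: F.cycles_Suc free_add free_scale lin_ext_add lin_ext_scale)
  then obtain c' where c': "c' \<in> free (B (Suc (Suc i)))"
      "lin_ext (d (Suc (Suc i))) c' = c + scale (mvar x) a'"
    using F.cycles_lift by blast
  have "triple (lin_ext (dd (Suc i)) a') b c = lin_ext (cone_d (Suc (Suc i))) (triple (- a') b' c')"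
    unfolding cone_d_triple by (simp add: b'(2) c'(2) lin_ext_uminus)
  moreover have "triple (- a') b' c' \<in> free (cone_basis (Suc (Suc i)))"
    unfolding basis_Suc by (intro triple_free free_uminus a' b' c')
  ultimately show ?thesis by (rule image_eqI)
qed

text \<open>Boundaries from F_1 fill \<open>I\<close>, and those from K_1, multiplied by x, fill
  xJ.\<close>

lemma cone_exact_0: "lin_ext (cone_d (Suc 0)) ` free (cone_basis (Suc 0))
  = {f \<in> free (cone_basis 0). lkp f (Inr (Inr r)) \<in> L}" (is "?L = ?R")
proof (intro equalityI subsetI)
  fix f assume "f \<in> ?L"
  then obtain g where g: "g \<in> free (cone_basis (Suc 0))" "f = lin_ext (cone_d (Suc 0)) g" by blast
  obtain a b c where abc: "g = triple a b c" "a \<in> free {}" "b \<in> free (B' (Suc 0))" "c \<in> free (B (Suc 0))"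
    using g(1) unfolding basis_1 by (rule triple_cases)
  let ?c = "lin_ext (d (Suc 0)) c" and ?b = "lin_ext (d' (Suc 0)) b"
  have c: "?c \<in> F.cycles 0" and b: "?b \<in> F'.cycles 0"
    using abc F.d_cycles F'.d_cycles by blast+
  then have b0: "?b \<in> free (B' 0)" by (simp add: F'.cycles_0)
  have f: "f = triple 0 0 (?c + scale (mvar x) (\<tau> ?b))"
    using g(2) abc cone_d_triple_1 by (simp add: free_empty)
  have free: "?c + scale (mvar x) (\<tau> ?b) \<in> free {r}"
    using c \<tau>_free by (auto simp: F.cycles_0 F.B_0 intro!: free_add free_scale)
  have "f \<in> free (cone_basis 0)" unfolding f basis_0 by (intro triple_free free free_0)
  moreover have "lkp f (Inr (Inr r)) = lkp ?c r + mvar x * lkp ?b r'"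
  proof -
    have "f = triple 0 0 (single r (lkp ?c r + mvar x * lkp ?b r'))"
      unfolding f using free_singleton[OF free] \<tau>_eq[OF b0] by (simp add: lookup_add)
    then show ?thesis by (simp add: triple_def inj1_def inj2_def inj3_def scale_single)
  qed
  moreover have "lkp ?c r \<in> I" "lkp ?b r' \<in> J" using b c by (auto simp: F.cycles_0 F'.cycles_0)
  ultimately show "f \<in> ?R" by (auto simp: L_iff)
next
  fix f assume f: "f \<in> ?R"
  then obtain a b c where abc: "f = triple a b c" "a \<in> free {}" "b \<in> free {}" "c \<in> free {r}"
    unfolding basis_0 by (blast elim: triple_cases)
  then have f_eq: "f = triple 0 0 (single r (lkp c r))"
    using free_singleton[OF abc(4)] by (simp add: free_empty)
  then have "lkp f (Inr (Inr r)) = lkp c r"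
    by (simp add: triple_def inj1_def inj2_def inj3_def scale_single)
  then obtain s q where sq: "s \<in> I" "q \<in> J" "lkp c r = s + mvar x * q" using f by (auto simp: L_iff)
  have "single r s \<in> F.cycles 0" "single r' q \<in> F'.cycles 0"
    using sq F.ideal_iff F'.ideal_iff by auto
  then obtain c' b' where c': "c' \<in> free (B (Suc 0))" "lin_ext (d (Suc 0)) c' = single r s"
    and b': "b' \<in> free (B' (Suc 0))" "lin_ext (d' (Suc 0)) b' = single r' q"
    using F.cycles_lift F'.cycles_lift by meson
  have "\<tau> (single r' q) = single r q" by (simp add: \<tau>_def scale_single)
  then have "f = lin_ext (cone_d (Suc 0)) (triple 0 b' c')"
    unfolding cone_d_triple_1 by (simp add: f_eq b'(2) c'(2) sq(3) single_add scale_single)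
  moreover have "triple 0 b' c' \<in> free (cone_basis (Suc 0))"
    unfolding basis_1 by (intro triple_free b' c' free_0)
  ultimately show "f \<in> ?L" by (rule image_eqI)
qed

lemma cone_exact_1: "lin_ext (cone_d (Suc (Suc 0))) ` free (cone_basis (Suc (Suc 0)))
  = {f \<in> free (cone_basis (Suc 0)). lin_ext (cone_d (Suc 0)) f = 0}" (is "?L = ?R")
proof (intro equalityI subsetI)
  fix f assume "f \<in> ?L"
  then obtain a b c where abc: "a \<in> free (B (Suc 0))" "b \<in> free (B' (Suc (Suc 0)))" "c \<in> free (B (Suc (Suc 0)))"
    "f = triple (- lin_ext (dd (Suc 0)) a) (lin_ext (d' (Suc (Suc 0))) b - lin_ext (\<phi> (Suc 0)) a)
      (scale (mvar x) a + lin_ext (d (Suc (Suc 0))) c)" (is "_ = triple _ ?b ?c")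
    by (rule cone_d_Suc_cases)
  then have f: "f = triple 0 ?b ?c" by (simp add: dd_def lin_ext_zero_fun)
  have b: "lin_ext (d' (Suc (Suc 0))) b \<in> F'.cycles (Suc 0)" using abc by (intro F'.d_cycles)
  have c: "lin_ext (d (Suc (Suc 0))) c \<in> F.cycles (Suc 0)" using abc by (intro F.d_cycles)
  have a: "lin_ext (d (Suc 0)) a \<in> free (B 0)" using abc by (intro F.cycles_free[OF F.d_cycles])
  \<comment> \<open>As \<open>\<tau>\<close> inverts \<open>\<phi> 0\<close>, the path of
    \<open>a\<close> through K cancels its direct path x (d a) into F_0.\<close>
  have "\<tau> (lin_ext (d' (Suc 0)) ?b) = - lin_ext (d (Suc 0)) a"
    using b chain_map_d[OF \<phi> abc(1)] \<tau>_\<phi>[OF a]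
    by (simp add: F'.cycles_Suc lin_ext_diff \<tau>_def lin_ext_uminus)
  then have "lin_ext (cone_d (Suc 0)) f = 0"
    using c by (simp add: f cone_d_triple_1 F.cycles_Suc lin_ext_add lin_ext_scale triple_0)
  moreover have "f \<in> free (cone_basis (Suc 0))"
    unfolding f basis_1
    using abc F.cycles_free[OF c] F'.cycles_free[OF b] chain_map_free[OF \<phi> abc(1)]
    by (intro triple_free free_0 free_diff free_add free_scale)
  ultimately show "f \<in> ?R" by simp
next
  fix f assume f: "f \<in> ?R"
  then obtain a b c where abc: "f = triple a b c" "a \<in> free {}" "b \<in> free (B' (Suc 0))" "c \<in> free (B (Suc 0))"
    unfolding basis_1 by (blast elim: triple_cases)
  let ?c = "lin_ext (d (Suc 0)) c" and ?b = "lin_ext (d' (Suc 0)) b"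
  have a: "a = 0" using abc by (simp add: free_empty)
  have eq: "?c + scale (mvar x) (\<tau> ?b) = 0"
    using f by (simp add: abc(1) a cone_d_triple_1 triple_eq_0_iff)
  have b0: "?b \<in> free (B' 0)" using abc by (intro F'.cycles_free[OF F'.d_cycles])
  \<comment> \<open>The equation shows that x times the entry of \<open>?b\<close> lies in
    \<open>I\<close>; by regularity of x the entry itself does, so \<open>\<tau> ?b\<close> is the
    boundary of some \<open>a'\<close>.\<close>
  have "lin_ext (d (Suc 0)) (- c) \<in> F.cycles 0" using abc(4) by (intro F.d_cycles free_uminus)
  moreover have "lin_ext (d (Suc 0)) (- c) = scale (mvar x) (\<tau> ?b)"
    using minus_unique[OF eq] by (simp add: lin_ext_uminus)
  ultimately have "mvar x * lkp ?b r' \<in> I" using \<tau>_eq[OF b0] by (simp add: F.cycles_0)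
  then have "\<tau> ?b \<in> F.cycles 0" using \<tau>_eq[OF b0] F.ideal_iff regular by auto
  then obtain a' where a': "a' \<in> free (B (Suc 0))" "lin_ext (d (Suc 0)) a' = \<tau> ?b"
    using F.cycles_lift by blast
  have "triple (lin_ext (dd (Suc 0)) a') b c \<in> ?L"
    using abc(3,4) a' eq \<phi>_\<tau>[OF b0] by (intro cone_lift) auto
  then show "f \<in> ?L" by (simp add: abc(1) a dd_def lin_ext_zero_fun)
qed

lemma cone_exact_Suc: "lin_ext (cone_d (Suc (Suc (Suc i)))) ` free (cone_basis (Suc (Suc (Suc i))))
  = {f \<in> free (cone_basis (Suc (Suc i))). lin_ext (cone_d (Suc (Suc i))) f = 0}" (is "?L = ?R")
proof (intro equalityI subsetI)
  fix f assume "f \<in> ?L"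
  then obtain a b c where abc: "a \<in> free (B (Suc (Suc i)))" "b \<in> free (B' (Suc (Suc (Suc i))))"
    "c \<in> free (B (Suc (Suc (Suc i))))"
    "f = triple (- lin_ext (dd (Suc (Suc i))) a) (lin_ext (d' (Suc (Suc (Suc i)))) b - lin_ext (\<phi> (Suc (Suc i))) a)
      (scale (mvar x) a + lin_ext (d (Suc (Suc (Suc i)))) c)" (is "_ = triple _ ?b ?c")
    by (rule cone_d_Suc_cases)
  let ?a = "- lin_ext (d (Suc (Suc i))) a"
  have f: "f = triple ?a ?b ?c" using abc(4) by (simp add: dd_def)
  have b: "lin_ext (d' (Suc (Suc (Suc i)))) b \<in> F'.cycles (Suc (Suc i))" using abc by (intro F'.d_cycles)
  have c: "lin_ext (d (Suc (Suc (Suc i)))) c \<in> F.cycles (Suc (Suc i))" using abc by (intro F.d_cycles)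
  have a: "lin_ext (d (Suc (Suc i))) a \<in> free (B (Suc i))" using abc by (intro F.cycles_free[OF F.d_cycles])
  have "lin_ext (cone_d (Suc (Suc i))) f = 0"
    using b c chain_map_d[OF \<phi> abc(1)] dd_d[OF abc(1)]
    by (simp add: f cone_d_triple F.cycles_Suc F'.cycles_Suc lin_ext_add lin_ext_diff lin_ext_uminus
        lin_ext_scale triple_eq_0_iff)
  moreover have "f \<in> free (cone_basis (Suc (Suc i)))"
    unfolding f basis_Suc
    using abc a F.cycles_free[OF c] F'.cycles_free[OF b] chain_map_free[OF \<phi> abc(1)]
    by (intro triple_free free_uminus free_diff free_add free_scale)
  ultimately show "f \<in> ?R" by simp
next
  fix f assume f: "f \<in> ?R"
  then obtain a b c where abc: "f = triple a b c" "a \<in> free (B (Suc i))" "b \<in> free (B' (Suc (Suc i)))"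
      "c \<in> free (B (Suc (Suc i)))"
    unfolding basis_Suc by (blast elim: triple_cases)
  have eqs: "lin_ext (dd (Suc i)) a = 0" "lin_ext (d' (Suc (Suc i))) b = lin_ext (\<phi> (Suc i)) a"
      "scale (mvar x) a + lin_ext (d (Suc (Suc i))) c = 0"
    using f by (simp_all add: abc(1) cone_d_triple triple_eq_0_iff)
  \<comment> \<open>For i = 0 the equation for \<open>dd\<close> says nothing about
    \<open>a\<close>. That \<open>a\<close> is a cycle is read off the third equation instead:
    applying \<open>d\<close> leaves x (d a) = 0.\<close>
  have "lin_ext (d (Suc i)) (scale (mvar x) a + lin_ext (d (Suc (Suc i))) c) = 0"
    using eqs(3) by simp
  moreover have "lin_ext (d (Suc (Suc i))) c \<in> F.cycles (Suc i)" using abc(4) by (rule F.d_cycles)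
  ultimately have "scale (mvar x) (lin_ext (d (Suc i)) a) = 0"
    by (simp add: lin_ext_add lin_ext_scale F.cycles_Suc)
  then have "lin_ext (d (Suc i)) a = 0" by (rule scale_mvar_eq_0)
  then have "a \<in> F.cycles (Suc i)" using abc(2) by (simp add: F.cycles_Suc)
  then obtain a' where a': "a' \<in> free (B (Suc (Suc i)))" "lin_ext (d (Suc (Suc i))) a' = a"
    using F.cycles_lift by blast
  have "triple (lin_ext (dd (Suc (Suc i))) a') b c \<in> ?L"
    using abc(3,4) a' eqs by (intro cone_lift) (auto simp: add.commute)
  then show "f \<in> ?L" by (simp add: abc(1) dd_def a')
qed

lemma cone_basis_cases:
  assumes "e \<in> cone_basis (Suc i)"
  obtains k e1 where "i = Suc k" "e = Inl e1" "e1 \<in> B (Suc k)"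
    | e1 where "e = Inr (Inl e1)" "e1 \<in> B' (Suc i)"
    | e1 where "e = Inr (Inr e1)" "e1 \<in> B (Suc i)"
  using assms by (cases i) (auto simp: cone_basis_def)

lemma cone_min_res: "min_res L cone_basis cone_deg cone_d (Inr (Inr r))"
proof
  show "cone_basis 0 = {Inr (Inr r)}" by (auto simp: basis_0)
  show "cone_deg (Inr (Inr r)) = 0" by (simp add: cone_deg_def F.v_r)
  fix i j
  have "{e \<in> cone_basis i. cone_deg e = j} \<subseteq> sum3 {e \<in> B (i - 1). v e = j - 1}
      {e \<in> B' i. v' e = j - 1} {e \<in> B i. v e = j}"
    by (auto simp: cone_basis_def cone_deg_def split: if_splits)
  then show "finite {e \<in> cone_basis i. cone_deg e = j}"
    by (rule finite_subset) (simp add: F.finite_B F'.finite_B)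
next
  fix i e assume "e \<in> cone_basis (Suc i)"
  then show "cone_d (Suc i) e \<in> free (cone_basis i)"
  proof (cases rule: cone_basis_cases)
    case (1 k e1)
    have "dd (Suc k) e1 \<in> free (if k = 0 then {} else B k)"
      using dd_free[OF free_single[OF 1(3), of 1]] by simp
    moreover have "\<phi> (Suc k) e1 \<in> free (B' (Suc k))" using \<phi> 1(3) by (simp add: chain_map_def)
    ultimately show ?thesis using 1
      by (auto simp: cone_d_def cone_basis_def intro!: triple_free free_uminus free_scale free_single)
  next
    case (2 e1)
    then show ?thesis
      using F'.d_free[OF 2(2)] \<tau>_free
      by (cases i) (auto simp: cone_d_def cone_basis_def intro!: triple_free free_scale)
  next
    case (3 e1)
    then show ?thesis
      using F.d_free[OF 3(2)] by (auto simp: cone_d_def cone_basis_def intro!: triple_free)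
  qed
next
  fix i e assume "e \<in> cone_basis (Suc i)"
  then show "whom mon_degree cone_deg (cone_deg e) (cone_d (Suc i) e)"
  proof (cases rule: cone_basis_cases)
    case (1 k e1)
    have "whom mon_degree v (v e1) (dd (Suc k) e1)" using F.d_hom[OF 1(3)] by (simp add: dd_def)
    moreover have "whom mon_degree v' (v e1) (\<phi> (Suc k) e1)" using \<phi> 1(3) by (simp add: chain_map_def)
    ultimately show ?thesis using 1
      by (auto simp: cone_d_def cone_deg_def
          intro!: whom_triple whom_uminus whom_Suc whom_scale_mvar whom_single_1)
  next
    case (2 e1)
    have "whom mon_degree v (v' e1) (\<tau> (d' (Suc 0) e1))" if "i = 0"
      unfolding \<tau>_def
    proof (rule whom_lin_ext)
      show "whom mon_degree v' (v' e1) (d' (Suc 0) e1)" using F'.d_hom[OF 2(2)] that by simp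
      fix c assume "c \<in> keys (d' (Suc 0) e1)"
      then have "c \<in> B' 0" using F'.d_free[OF 2(2)] that by (auto simp: free_def)
      then show "whom mon_degree v (v' c) (single r 1)"
        by (intro whom_single_1) (simp add: F'.B_0 F.v_r F'.v_r)
    qed (rule mon_degree_add)
    then show ?thesis
      using F'.d_hom[OF 2(2)] 2
      by (auto simp: cone_d_def cone_deg_def intro!: whom_triple whom_Suc whom_scale_mvar)
  next
    case (3 e1)
    then show ?thesis using F.d_hom[OF 3(2)] by (auto simp: cone_d_def cone_deg_def intro!: whom_triple)
  qed
next
  fix i e c assume "e \<in> cone_basis (Suc i)"
  then show "cst (cone_d (Suc i) e) c = 0"
  proof (cases rule: cone_basis_cases)
    case (1 k e1)
    have "cst (dd (Suc k) e1) c = 0" for c using F.d_min[OF 1(3)] by (simp add: dd_def)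
    \<comment> \<open>Degrees forbid units: a constant entry would join \<open>e1\<close>, of degree
      above k + 1, to a basis element of K of degree exactly k + 1.\<close>
    moreover have "cst (\<phi> (Suc k) e1) c = 0" for c
    proof (rule ccontr)
      assume nz: "cst (\<phi> (Suc k) e1) c \<noteq> 0"
      then have "v' c = v e1" using \<phi> 1(3) by (intro whom_cst) (auto simp: chain_map_def)
      moreover have "c \<in> keys (\<phi> (Suc k) e1)" using nz by (auto simp: cst_def in_keys_iff)
      then have "c \<in> B' (Suc k)" using \<phi> 1(3) by (auto simp: chain_map_def free_def)
      ultimately show False using v_gt[OF 1(3)] v'_eq by simp
    qed
    ultimately show ?thesis using 1 by (auto simp: cone_d_def cst_scale_mvar cst_uminus intro!: cst_triple)
  next
    case (2 e1)
    then show ?thesis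
      using F'.d_min[OF 2(2)] by (auto simp: cone_d_def cst_scale_mvar intro!: cst_triple)
  next
    case (3 e1)
    then show ?thesis using F.d_min[OF 3(2)] by (auto simp: cone_d_def intro!: cst_triple)
  qed
next
  show "lin_ext (cone_d (Suc (Suc i))) ` free (cone_basis (Suc (Suc i)))
    = {f \<in> free (cone_basis (Suc i)). lin_ext (cone_d (Suc i)) f = 0}" for i
    by (cases i) (simp_all only: cone_exact_1 cone_exact_Suc)
qed (rule cone_exact_0)

end

section \<open>Strands\<close>

context min_res
begin

text \<open>A basis element killed by the differential would be a boundary, but boundaries have no
  constant terms.\<close>

lemma d_nonzero:
  assumes e: "e \<in> B (Suc i)"
  shows "d (Suc i) e \<noteq> 0"
proof
  assume "d (Suc i) e = 0"
  then have "single e 1 \<in> cycles (Suc i)" using e by (simp add: cycles_Suc free_single)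
  then obtain y where y: "y \<in> free (B (Suc (Suc i)))" "lin_ext (d (Suc (Suc i))) y = single e 1"
    using cycles_lift by blast
  have "cst (single e (1 :: ('a, 'k) mpoly)) e = 0" using cst_d[OF y(1), of e] unfolding y(2) .
  then show False by (simp add: cst_single)
qed

lemma d_monomial:
  assumes e: "e \<in> B (Suc i)"
  obtains c m where "c \<in> B i" "m \<in> keys (lkp (d (Suc i) e) c)" "mon_degree m + v c = v e"
proof -
  have "keys (d (Suc i) e) \<noteq> {}" using d_nonzero[OF e] by (metis poly_mapping_sum_single sum.empty)
  then obtain c where c: "c \<in> keys (d (Suc i) e)" by blast
  then have "lkp (d (Suc i) e) c \<noteq> 0" by (simp add: in_keys_iff)
  then have "keys (lkp (d (Suc i) e) c) \<noteq> {}" by (metis poly_mapping_sum_single sum.empty)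
  then obtain m where m: "m \<in> keys (lkp (d (Suc i) e) c)" by blast
  show ?thesis
    using that[of c m] c m d_free[OF e] whomD[OF d_hom[OF e] m] by (auto simp: free_def)
qed

text \<open>The differential of a basis element has a nonzero entry, which by minimality is not
  constant. So degrees rise by at least one per position, starting from at least 2 in position
  1.\<close>

lemma degree_gt:
  assumes I: "\<And>p m. p \<in> I \<Longrightarrow> m \<in> keys p \<Longrightarrow> 2 \<le> mon_degree m" and e: "e \<in> B (Suc i)"
  shows "Suc i < v e"
  using e
proof (induction i arbitrary: e)
  case 0
  obtain c m where cm: "c \<in> B 0" "m \<in> keys (lkp (d (Suc 0) e) c)" "mon_degree m + v c = v e"
    using d_monomial[OF 0] by blast
  have "lkp (d (Suc 0) e) r \<in> I" using d_e_cycles[OF 0] by (simp add: cycles_0)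
  then have "2 \<le> mon_degree m" using I cm(1,2) by (auto simp: B_0)
  then show ?case using cm(3) by simp
next
  case (Suc i)
  obtain c m where cm: "c \<in> B (Suc i)" "m \<in> keys (lkp (d (Suc (Suc i)) e) c)" "mon_degree m + v c = v e"
    using d_monomial[OF Suc.prems] by blast
  have "m \<noteq> 0" using d_min[OF Suc.prems, of c] cm(2) by (auto simp: cst_def in_keys_iff)
  then have "0 < mon_degree m" using mon_degree_eq_0_iff[of m] by simp
  then show ?case using Suc.IH[OF cm(1)] cm(3) by simp
qed

text \<open>A homogeneous element of \<open>I\<close> lifts to a homogeneous combination of
  generators, in which no generator can have larger degree than the element.\<close>

lemma ex_basis_1:
  assumes p: "p \<in> I" "p \<noteq> 0" "\<And>m. m \<in> keys p \<Longrightarrow> mon_degree m = j"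
  shows "\<exists>e\<in>B (Suc 0). v e \<le> j"
proof -
  have "single r p \<in> cycles 0" using p(1) ideal_iff by simp
  moreover have "whom mon_degree v j (single r p)"
    using p(3) by (auto simp: whom_def lookup_single when_def v_r)
  ultimately obtain y where y: "y \<in> free (B (Suc 0))" "whom mon_degree v j y"
      "lin_ext (d (Suc 0)) y = single r p"
    using cycles_lift_hom by blast
  have "single r p \<noteq> 0" using p(2) by (metis lookup_single_eq lookup_zero)
  then have "y \<noteq> 0" using y(3) by auto
  then have "keys y \<noteq> {}" by (metis poly_mapping_sum_single sum.empty)
  then obtain e where e: "e \<in> keys y" by blast
  then have "lkp y e \<noteq> 0" by (simp add: in_keys_iff)
  then have "keys (lkp y e) \<noteq> {}" by (metis poly_mapping_sum_single sum.empty)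
  then obtain m where "m \<in> keys (lkp y e)" by blast
  then have "mon_degree m + v e = j" by (rule whomD[OF y(2)])
  then show ?thesis using y(1) e by (intro bexI[of _ e]) (auto simp: free_def)
qed

lemma strand_eq:
  fixes M :: "('a \<Rightarrow>\<^sub>0 nat) set"
  assumes "finite V" "0 \<notin> M" "\<And>m m'. m \<in> M \<Longrightarrow> m' + m \<in> M" "\<And>m. m \<in> M \<Longrightarrow> mrest V m \<in> M"
    and I: "I = mono_ideal UNIV M"
  shows "strand V (mono_ideal V M :: ('a, 'k) mpoly set) j = {i. \<exists>e\<in>B i. v e = i + j}"
proof -
  have "min_res (mono_ideal UNIV M) B v d r" using min_res_axioms by (simp add: I)
  note graded_betti_eq_card[OF assms(1-4) this]
  then show ?thesis unfolding strand_def using finite_B by auto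
qed

end

section \<open>Strands of a cone and their connectedness\<close>

lemma connected_strand_iff:
  "connected_strand V I j \<longleftrightarrow> (\<exists>q p. q \<le> p \<and> strand V I j = {q..p})"
proof
  assume *: "connected_strand V I j"
  let ?q = "Min (strand V I j)" and ?p = "Max (strand V I j)"
  have "strand V I j = {?q..?p}" "strand V I j \<noteq> {}" using * by (auto simp: connected_strand_def)
  moreover from this have "?q \<le> ?p" by (metis atLeastatMost_empty_iff)
  ultimately show "\<exists>q p. q \<le> p \<and> strand V I j = {q..p}" by blast
next
  assume "\<exists>q p. q \<le> p \<and> strand V I j = {q..p}"
  then obtain q p where qp: "q \<le> p" "strand V I j = {q..p}" by blast
  have "Min {q..p} = q" by (rule Min_eqI) (use qp(1) in auto)
  moreover have "Max {q..p} = p" by (rule Max_eqI) (use qp(1) in auto)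
  ultimately show "connected_strand V I j" using qp by (simp add: connected_strand_def)
qed

lemma bex_sum3: "(\<exists>e\<in>sum3 A B C. P e) \<longleftrightarrow>
    (\<exists>e\<in>A. P (Inl e)) \<or> (\<exists>e\<in>B. P (Inr (Inl e))) \<or> (\<exists>e\<in>C. P (Inr (Inr e)))"
  by (auto elim!: PlusE)

text \<open>The hypotheses of \<open>cone_res\<close> are checked on monomials, for which I(H), (U)
  and I(G) are given by divisibility conditions; the strands are then read off the three summands of
  the cone.\<close>

lemma strand_cone:
  fixes H :: "'a graph" and U :: "'a set" and x :: 'a
  defines "S \<equiv> \<lambda>j. strand (verts H) (edge_ideal H :: ('a, 'k::field) mpoly set) j"
    and "T \<equiv> \<lambda>j. strand (verts (cone x U H)) (edge_ideal (cone x U H) :: ('a, 'k) mpoly set) j"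
  assumes H: "finite_simple_graph H" "nontrivial H" "vertex_cover H U" "x \<notin> verts H"
  shows "T 0 = {0}" "1 \<in> S 1"
    "1 \<le> j \<Longrightarrow> 0 \<notin> S j \<and> T j = S j \<union> Suc ` S j \<union> (if j = 1 then {1..card U} else {})"
proof -
  let ?G = "cone x U H"
  define MH where "MH = div_mons (edges H)"
  define MU where "MU = div_mons ((\<lambda>u. {u}) ` U)"
  define MG where "MG = div_mons (edges ?G)"
  have U: "U \<subseteq> verts H" using H(3) by (simp add: vertex_cover_def)
  have fin: "finite (verts H)" using H(1) by (simp add: finite_simple_graph_def)
  then have fin_U: "finite U" using U finite_subset by blast
  have edge_H: "e \<subseteq> verts H \<and> card e = 2" if "e \<in> edges H" for e
    using H(1) that by (simp add: finite_simple_graph_def)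
  have "card {x, u} = 2" if "u \<in> U" for u using that U H(4) by (subst card_2_iff) blast
  then have G: "finite_simple_graph ?G"
    using H(4) fin U edge_H by (auto simp: finite_simple_graph_def cone_def)
  have edge_G: "e \<subseteq> verts ?G \<and> card e = 2" if "e \<in> edges ?G" for e
    using G that by (simp add: finite_simple_graph_def)
  have MU: "m \<in> MU \<longleftrightarrow> (\<exists>u\<in>U. u \<in> keys m)" for m by (auto simp: MU_def div_mons_def)
  have MG: "m \<in> MG \<longleftrightarrow> m \<in> MH \<or> (x \<in> keys m \<and> m \<in> MU)" for m
    unfolding MG_def MH_def MU div_mons_def cone_def by (simp add: Bex_def) blast
  have MH_MU: "MH \<subseteq> MU"
    using H(3) by (fastforce simp: MH_def MU_def div_mons_def vertex_cover_def)
  \<comment> \<open>\<open>x\<close> lies in no edge of \<open>H\<close>, so it can be cancelled: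
    this is its regularity modulo I(H).\<close>
  have MH_x: "m \<in> MH" if m: "single x 1 + m \<in> MH" for m
  proof -
    obtain e where e: "e \<in> edges H" "e \<subseteq> insert x (keys m)"
      using m by (auto simp: MH_def div_mons_def keys_add_nat)
    then have "e \<subseteq> keys m" using edge_H[OF e(1)] H(4) by blast
    then show ?thesis using e(1) by (auto simp: MH_def div_mons_def)
  qed
  have MH_0: "0 \<notin> MH" and MG_0: "0 \<notin> MG"
    unfolding MH_def MG_def using edge_H[of "{}"] edge_G[of "{}"] by (auto simp: div_mons_def)
  have MH_add: "m' + m \<in> MH" if "m \<in> MH" for m m'
    using that unfolding MH_def by (rule div_mons_add)
  have MG_add: "m' + m \<in> MG" if "m \<in> MG" for m m'
    using that unfolding MG_def by (rule div_mons_add)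
  have MH_rest: "mrest (verts H) m \<in> MH" if "m \<in> MH" for m
    using that edge_H unfolding MH_def by (intro div_mons_mrest) auto
  have MG_rest: "mrest (verts ?G) m \<in> MG" if "m \<in> MG" for m
    using that edge_G unfolding MG_def by (intro div_mons_mrest) auto
  let ?IH = "mono_ideal UNIV MH :: ('a, 'k) mpoly set"
  let ?IU = "mono_ideal UNIV MU :: ('a, 'k) mpoly set"
  let ?IG = "mono_ideal UNIV MG :: ('a, 'k) mpoly set"
  obtain b d where "minimal_graded_free_resolution (verts H) (mono_ideal (verts H) MH :: ('a, 'k) mpoly set) b d"
    using ex_minimal_graded_free_resolution[OF fin MH_0 MH_add] by blast
  then have F: "min_res ?IH (\<lambda>i. free_basis (b i)) fst d (0, 0)"
    using MH_add MH_rest by (rule min_res_base_change)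
  obtain d' where K: "min_res ?IU (subsets_of_card U) card d' {}"
    using ex_koszul[OF fin_U] unfolding MU_def by blast
  interpret cone_res ?IH "\<lambda>i. free_basis (b i)" fst d "(0, 0)" ?IU "subsets_of_card U" card d' "{}" x ?IG
  proof (intro cone_res.intro min_res_pair.intro F K min_res_pair_axioms.intro cone_res_axioms.intro)
    show "?IH \<subseteq> ?IU" using MH_MU by (auto simp: mono_ideal_def)
    show "p \<in> ?IH" if "mvar x * p \<in> ?IH" for p
      using that MH_x by (auto simp: mono_ideal_def carr_UNIV mvar_def keys_monom_mult)
    show "p \<in> ?IG \<longleftrightarrow> (\<exists>s\<in>?IH. \<exists>q\<in>?IU. p = s + mvar x * q)" for p
    proof
      assume p: "p \<in> ?IG"
      \<comment> \<open>The terms of \<open>p\<close> in I(H) form \<open>s\<close>. All others are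
        divisible by x and by a variable of the cover; as x is not in the cover, dividing by x
        leaves an element of (U).\<close>
      let ?Q = "\<lambda>m. m \<in> MH"
      have *: "x \<in> keys m \<and> m \<in> MU" if "m \<in> keys (pfilt (\<lambda>m. \<not> ?Q m) p)" for m
        using that p by (auto simp: keys_pfilt mono_ideal_def MG)
      then have "\<exists>q. pfilt (\<lambda>m. \<not> ?Q m) p = mvar x * q" by (intro mono_factor) blast
      then obtain q where q: "pfilt (\<lambda>m. \<not> ?Q m) p = mvar x * q" by blast
      have "m \<in> MU" if "m \<in> keys q" for m
      proof -
        have "single x 1 + m \<in> keys (mvar x * q)" using that by (simp add: mvar_def keys_monom_mult)
        then have "single x 1 + m \<in> MU" using * unfolding q by blast
        then show ?thesis using U H(4) by (auto simp: MU keys_add_nat)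
      qed
      then have "q \<in> ?IU" by (auto simp: mono_ideal_def carr_UNIV)
      moreover have "p = pfilt ?Q p + mvar x * q" by (rule pfilt_split[of p ?Q, unfolded q])
      moreover have "pfilt ?Q p \<in> ?IH" by (auto simp: mono_ideal_def carr_UNIV keys_pfilt)
      ultimately show "\<exists>s\<in>?IH. \<exists>q\<in>?IU. p = s + mvar x * q" by blast
    next
      assume "\<exists>s\<in>?IH. \<exists>q\<in>?IU. p = s + mvar x * q"
      then obtain s q where sq: "s \<in> ?IH" "q \<in> ?IU" "p = s + mvar x * q" by blast
      have "s \<in> ?IG" using sq(1) by (auto simp: mono_ideal_def MG)
      moreover have "single x 1 + m \<in> MG" if "m \<in> keys q" for m
        using sq(2) that by (auto simp: mono_ideal_def subset_iff MG MU keys_add_nat)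
      then have "mvar x * q \<in> ?IG"
        by (auto simp: mono_ideal_def carr_UNIV mvar_def keys_monom_mult)
      ultimately show "p \<in> ?IG" unfolding sq(3) by (rule mono_ideal_add)
    qed
    show "Suc i < fst e" if "e \<in> free_basis (b (Suc i))" for e i
    proof (rule min_res.degree_gt[OF F _ that])
      fix p :: "('a, 'k) mpoly" and m assume "p \<in> ?IH" "m \<in> keys p"
      then obtain e where e: "e \<in> edges H" "e \<subseteq> keys m" by (auto simp: mono_ideal_def MH_def div_mons_def)
      have "2 = (\<Sum>v\<in>e. 1 :: nat)" using edge_H[OF e(1)] by simp
      also have "\<dots> \<le> (\<Sum>v\<in>e. lkp m v)" using e(2) by (intro sum_mono) (auto simp: in_keys_iff Suc_le_eq)
      also have "\<dots> \<le> mon_degree m" unfolding mon_degree_def using e(2) by (intro sum_mono2) auto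
      finally show "2 \<le> mon_degree m" .
    qed
    show "card c = i" if "c \<in> subsets_of_card U i" for c i using that by (simp add: subsets_of_card_def)
  qed
  have S: "S j = {i. \<exists>e\<in>free_basis (b i). fst e = i + j}" for j
    unfolding S_def edge_ideal_eq[OF H(1)] MH_def[symmetric]
    by (rule F.strand_eq[OF fin MH_0]) (simp_all add: MH_rest MH_add)
  have "finite (verts ?G)" using fin by (simp add: cone_def)
  then have T: "T j = {i. \<exists>e\<in>cone_basis i. cone_deg e = i + j}" for j
    unfolding T_def edge_ideal_eq[OF G] MG_def[symmetric]
    by (rule min_res.strand_eq[OF cone_min_res _ MG_0])
      (simp_all add: MG_rest MG_add)
  \<comment> \<open>The disjuncts are the summands F_(i-1)(-1), K_i(-1) and F_i. In the second,
    degree i + 1 forces j = 1, and subsets of size i exist up to i = card U.\<close>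
  have T_iff: "i \<in> T j \<longleftrightarrow> (1 < i \<and> (\<exists>e\<in>free_basis (b (i - 1)). Suc (fst e) = i + j)) \<or>
      (0 < i \<and> j = 1 \<and> i \<le> card U) \<or> i \<in> S j" for i j
  proof -
    have "(\<exists>e\<in>subsets_of_card U i. Suc (card e) = i + j) \<longleftrightarrow> j = 1 \<and> i \<le> card U"
    proof
      assume "\<exists>e\<in>subsets_of_card U i. Suc (card e) = i + j"
      then show "j = 1 \<and> i \<le> card U" using fin_U by (auto simp: subsets_of_card_def card_mono)
    next
      assume j: "j = 1 \<and> i \<le> card U"
      then obtain e where "e \<subseteq> U" "card e = i" using obtain_subset_with_card_n[of i U] by blast
      then show "\<exists>e\<in>subsets_of_card U i. Suc (card e) = i + j"
        using j by (intro bexI[of _ e]) (auto simp: subsets_of_card_def)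
    qed
    then show ?thesis
      unfolding T S mem_Collect_eq cone_basis_def bex_sum3 by (simp add: cone_deg_def)
  qed
  have S_0: "S 0 = {0}"
  proof -
    have "i = 0" if "i \<in> S 0" for i
    proof (rule ccontr)
      assume "i \<noteq> 0"
      then obtain k where "i = Suc k" by (cases i) auto
      then obtain e where "e \<in> free_basis (b (Suc k))" "fst e = Suc k" using \<open>i \<in> S 0\<close> by (auto simp: S)
      then show False using v_gt[of e k] by simp
    qed
    then show ?thesis using F.B_0 by (auto simp: S)
  qed
  show "T 0 = {0}"
  proof (rule Set.set_eqI)
    fix i
    have "\<not> (1 < i \<and> (\<exists>e\<in>free_basis (b (i - 1)). Suc (fst e) = i + 0))"
    proof
      assume *: "1 < i \<and> (\<exists>e\<in>free_basis (b (i - 1)). Suc (fst e) = i + 0)"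
      then obtain k where k: "i = Suc (Suc k)" by (cases i; cases "i - 1") auto
      then obtain e where "e \<in> free_basis (b (Suc k))" "fst e = Suc k" using * by auto
      then show False using v_gt[of e k] by simp
    qed
    then show "i \<in> T 0 \<longleftrightarrow> i \<in> {0}" unfolding T_iff S_0 by auto
  qed
  \<comment> \<open>An edge provides a generator of degree at most 2, and degrees in position 1
    exceed 1.\<close>
  show "1 \<in> S 1"
  proof -
    obtain e where e: "e \<in> edges H" using H(2) by (auto simp: nontrivial_def)
    then obtain u v where uv: "e = {u, v}" "u \<noteq> v" using edge_H card_2_iff[of e] by blast
    let ?m = "single u 1 + single v (1::nat)"
    have "single ?m (1 :: 'k) \<in> ?IH"
      using e uv by (auto simp: mono_ideal_def carr_UNIV MH_def div_mons_def keys_add_nat intro!: bexI[of _ e])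
    then have "\<exists>e\<in>free_basis (b (Suc 0)). fst e \<le> 2"
    proof (rule F.ex_basis_1)
      show "single ?m (1 :: 'k) \<noteq> 0"
      proof
        assume eq: "single ?m (1 :: 'k) = 0"
        have "lkp (single ?m (1 :: 'k)) ?m = lkp 0 ?m" by (simp only: eq)
        then show False by simp
      qed
    qed (auto simp: mon_degree_add)
    then obtain e where e: "e \<in> free_basis (b (Suc 0))" "fst e \<le> 2" by blast
    then have "fst e = 1 + 1" using v_gt[OF e(1)] by simp
    then show ?thesis using e(1) unfolding S by (auto intro!: bexI[of _ e])
  qed
  assume j: "1 \<le> j"
  have S_pos: "0 \<notin> S j" using j F.B_0 by (auto simp: S)
  \<comment> \<open>Raising both position and degree by one preserves j. The bound 1 < i leaves out
    only a shifted position 0, which is not in \<open>S j\<close>.\<close>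
  have shift: "(1 < i \<and> (\<exists>e\<in>free_basis (b (i - 1)). Suc (fst e) = i + j)) \<longleftrightarrow> i \<in> Suc ` S j" for i
    using S_pos by (cases i; cases "i - 1") (auto simp: S image_iff)
  have "T j = S j \<union> Suc ` S j \<union> (if j = 1 then {1..card U} else {})"
  proof (rule Set.set_eqI)
    show "i \<in> T j \<longleftrightarrow> i \<in> S j \<union> Suc ` S j \<union> (if j = 1 then {1..card U} else {})" for i
      unfolding T_iff shift by auto
  qed
  then show "0 \<notin> S j \<and> T j = S j \<union> Suc ` S j \<union> (if j = 1 then {1..card U} else {})"
    using S_pos by blast
qed

text \<open>The hypothesis excludes q = Suc p, where the left side is empty and the right side is a
  singleton.\<close>

lemma interval_Un_Suc: "q \<le> p \<Longrightarrow> {q..p} \<union> Suc ` {q..p} = {q..Suc p}" for q p :: nat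
  unfolding image_Suc_atLeastAtMost by auto

theorem theorem3p5:
  fixes H G :: "'a graph" and U :: "'a set" and x :: 'a
    and I\<^sub>H I\<^sub>G :: "('a, 'k::field) mpoly set"
  assumes "finite_simple_graph H" and "nontrivial H"
    and "vertex_cover H U"
    and "x \<notin> verts H"
    and "G = cone x U H"
    and "I\<^sub>H = edge_ideal H" and "I\<^sub>G = edge_ideal G"
  shows "(\<forall>j. connected_strand (verts H) I\<^sub>H j \<longrightarrow> connected_strand (verts G) I\<^sub>G j) \<and>
         (strand_connected (verts H) I\<^sub>H \<longrightarrow> strand_connected (verts G) I\<^sub>G)"
proof -
  let ?S = "strand (verts H) I\<^sub>H" and ?T = "strand (verts G) I\<^sub>G"
  note cone = strand_cone[where 'k = 'k, OF assms(1-4), folded assms(5), folded assms(6,7)]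
  have conn: "connected_strand (verts G) I\<^sub>G j" if c: "connected_strand (verts H) I\<^sub>H j" for j
  proof (cases "j = 0")
    case True
    then show ?thesis unfolding connected_strand_iff using cone(1) by (intro exI[of _ 0]) simp
  next
    case False
    obtain q p where qp: "q \<le> p" "?S j = {q..p}" using c by (auto simp: connected_strand_iff)
    have T: "0 \<notin> ?S j" "?T j = {q..Suc p} \<union> (if j = 1 then {1..card U} else {})"
      using cone(3)[of j] False qp by (auto simp: interval_Un_Suc)
    show ?thesis
    proof (cases "j = 1")
      case True
      \<comment> \<open>The strand contains 1 but not 0, so it starts exactly where the Koszul
        interval does.\<close>
      have "q = 1" using True T(1) cone(2) qp by auto
      have "{1..Suc p} \<union> {1..card U} = {1..max (Suc p) (card U)}"
        by (rule Set.set_eqI) (auto simp: le_max_iff_disj)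
      then have "?T j = {1..max (Suc p) (card U)}" using T(2) True \<open>q = 1\<close> by simp
      then show ?thesis
        unfolding connected_strand_iff by (intro exI[of _ 1] exI[of _ "max (Suc p) (card U)"]) simp
    next
      case False
      then have "?T j = {q..Suc p}" using T(2) by simp
      then show ?thesis
        unfolding connected_strand_iff using qp(1) by (intro exI[of _ q] exI[of _ "Suc p"]) simp
    qed
  qed
  moreover have "connected_strand (verts G) I\<^sub>G j"
    if c: "strand_connected (verts H) I\<^sub>H" and ne: "?T j \<noteq> {}" for j
  proof (cases "j = 0")
    case True
    then show ?thesis unfolding connected_strand_iff using cone(1) by (intro exI[of _ 0]) simp
  next
    case False
    \<comment> \<open>The Koszul summand adds positions only for j = 1, where the strand of
      \<open>H\<close> is nonempty because it contains 1.\<close>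
    then have "?S j \<noteq> {}" using cone(2) cone(3)[of j] ne by (cases "j = 1") auto
    then show ?thesis using c conn by (simp add: strand_connected_def)
  qed
  ultimately show ?thesis by (simp add: strand_connected_def)
qed

end
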